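(* Let $k=1$ and $\delta>0$. Then the semigroup $\mathcal P_t$ has a spectral gap in the space of measurable functions weighted by $H^\delta$.
   Context: Fix $\alpha,\gamma,T,T_\infty>0$ and an even $C^2$ function $V_1$ with $V_1(x)=\frac{x^2}{2}+R_1(x)$, $\sup_{|x|>1}\max_{m\le2}|R_1^{(m)}(x)|/|x|^{1-m}<\infty$. On $\mathbb R^4\ni x=(p_0,q_0,p_1,q_1)$, $H=\frac{p_0^2+p_1^2}2+V_1(q_0)+V_1(q_1)+\frac\alpha2(q_0-q_1)^2$ (normalized so $H\ge0$). The diffusion is $dq_i=p_idt$, $dp_0=-V_1'(q_0)dt+\alpha(q_1-q_0)dt-\gamma p_0dt+\sqrt{2\gamma T}dw_0$, $dp_1=-V_1'(q_1)dt+\alpha(q_0-q_1)dt+\sqrt{2\gamma T_\infty}dw_1$; $(\mathcal P_t\phi)(x)=\mathbb E_x\phi(x(t))$. For a weight $V\ge0$, $\|\phi\|_V=\sup_x|\phi(x)|/(1+V(x))$; $\mathcal P_t$ has a spectral gap in the space of measurable functions weighted by $V$ if there exist a probability measure $\mu_\star$ and $C,\tilde\gamma>0$ with $\|\mathcal P_t\phi-\mu_\star(\phi)\|_V\le Ce^{-\tilde\gamma t}\|\phi-\mu_\star(\phi)\|_V$ for all $t\ge0$ and measurable $\phi$ with $\|\phi\|_V<\infty$. *)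

theory Defs
  imports "HOL-Probability.Probability"
begin

type_synonym state = "real \<times> real \<times> real \<times> real"  (* (p0, q0, p1, q1) *)

definition ham :: "(real \<Rightarrow> real) \<Rightarrow> real \<Rightarrow> state \<Rightarrow> real" where
  "ham V1 \<alpha> x = (case x of (p0, q0, p1, q1) \<Rightarrow>
     (p0^2 + p1^2) / 2 + V1 q0 + V1 q1 + \<alpha> / 2 * (q0 - q1)^2)"

definition drift :: "(real \<Rightarrow> real) \<Rightarrow> real \<Rightarrow> real \<Rightarrow> state \<Rightarrow> state" where
  "drift V1d \<alpha> \<gamma> x = (case x of (p0, q0, p1, q1) \<Rightarrow>
     (- V1d q0 + \<alpha> * (q1 - q0) - \<gamma> * p0, p0, - V1d q1 + \<alpha> * (q0 - q1), p1))"

definition brownian2 :: "'a measure \<Rightarrow> (real \<Rightarrow> 'a \<Rightarrow> real) \<Rightarrow> (real \<Rightarrow> 'a \<Rightarrow> real) \<Rightarrow> bool" where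
  "brownian2 M w0 w1 \<longleftrightarrow> prob_space M \<and>
     (\<forall>t. w0 t \<in> borel_measurable M \<and> w1 t \<in> borel_measurable M) \<and>
     (\<forall>\<omega>\<in>space M. w0 0 \<omega> = 0 \<and> w1 0 \<omega> = 0 \<and>
        continuous_on {0..} (\<lambda>t. w0 t \<omega>) \<and> continuous_on {0..} (\<lambda>t. w1 t \<omega>)) \<and>
     (\<forall>ts :: real list. sorted_wrt (<) ts \<and> (\<forall>t\<in>set ts. 0 \<le> t) \<longrightarrow>
        (let W = (\<lambda>j::nat. if j = 0 then w0 else w1);
             inc = (\<lambda>(j, i) \<omega>. W j (ts ! Suc i) \<omega> - W j (ts ! i) \<omega>)
         in prob_space.indep_vars M (\<lambda>_. borel) inc ({0, 1} \<times> {..<length ts - 1}) \<and>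
            (\<forall>j\<in>{0::nat, 1}. \<forall>i < length ts - 1.
               distributed M lborel (inc (j, i))
                 (\<lambda>y. ennreal (normal_density 0 (sqrt (ts ! Suc i - ts ! i)) y)))))"

text \<open>X is a (pathwise) solution of the SDE started at x and driven by w0, w1.
  Since the noise is additive, the SDE is the integral equation below.\<close>
definition sde_solution ::
  "(real \<Rightarrow> real) \<Rightarrow> real \<Rightarrow> real \<Rightarrow> real \<Rightarrow> real \<Rightarrow> 'a measure \<Rightarrow>
   (real \<Rightarrow> 'a \<Rightarrow> real) \<Rightarrow> (real \<Rightarrow> 'a \<Rightarrow> real) \<Rightarrow> state \<Rightarrow> (real \<Rightarrow> 'a \<Rightarrow> state) \<Rightarrow> bool" where
  "sde_solution V1d \<alpha> \<gamma> T Tinf M w0 w1 x X \<longleftrightarrow>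
     (\<forall>t\<ge>0. X t \<in> borel_measurable M) \<and>
     (\<forall>\<omega>\<in>space M. continuous_on {0..} (\<lambda>t. X t \<omega>) \<and>
        (\<forall>t\<ge>0. X t \<omega> = x + integral {0..t} (\<lambda>s. drift V1d \<alpha> \<gamma> (X s \<omega>))
             + (sqrt (2 * \<gamma> * T) * w0 t \<omega>, 0, sqrt (2 * \<gamma> * Tinf) * w1 t \<omega>, 0)))"

definition wnorm :: "('b \<Rightarrow> real) \<Rightarrow> ('b \<Rightarrow> real) \<Rightarrow> ereal" where
  "wnorm V \<psi> = (SUP x. ereal (\<bar>\<psi> x\<bar> / (1 + V x)))"

definition C2_with :: "(real \<Rightarrow> real) \<Rightarrow> (real \<Rightarrow> real) \<Rightarrow> (real \<Rightarrow> real) \<Rightarrow> bool" where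
  "C2_with f f' f'' \<longleftrightarrow> (\<forall>x. (f has_real_derivative f' x) (at x)) \<and>
     (\<forall>x. (f' has_real_derivative f'' x) (at x)) \<and> continuous_on UNIV f''"

end

theory Submission
  imports Defs
begin

text \<open>The state weight is compared with a quadratic form \<open>N\<close> for which the linear part of the drift is
  strictly contracting: although only the first oscillator is damped, the coupling propagates the
  damping, and \<open>N\<close> is the energy plus suitable cross terms. The remaining drift is bounded, so
  subtracting the (additive) noise from the solution gives, path by path, an affine recursion for \<open>N\<close>;
  no stochastic calculus is needed to conclude that \<open>N\<^sup>\<delta>\<close> is a Lyapunov function.

  For the minorization, two solutions started at \<open>x\<close> and \<open>x'\<close> are coupled by a deterministic path
  from \<open>x' - x\<close> to \<open>0\<close> that respects \<open>dq = p dt\<close>: adding it to a solution amounts to adding a bounded adapted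
  shift to the noise. For the Euler scheme the shift is undone one Gaussian increment at a time by the
  Cauchy-Schwarz inequality, which in the limit yields a Harnack inequality
  \<open>(P f x')\<^sup>2 \<le> e\<^sup>c (P f\<^sup>2) x\<close>, hence a uniform bound below one for the total variation distance on balls.
  Convergence of the Euler scheme also gives the Markov property and shows that the transition
  probabilities do not depend on the driving Brownian motion. Harris' theorem, in the form with a
  weighted oscillation seminorm, then gives the spectral gap.\<close>

section \<open>Gaussian shifts\<close>

text \<open>The noise acts on the two momenta only, and this shapes both halves. In the coupling a
  displacement can be removed only along paths whose positions are driven by their own momenta; each
  oscillator has its own noise, so each is steered separately, and a quadratic momentum profile with
  one free coefficient suffices. Squares enter the Harnack inequality because Cauchy-Schwarz
  replaces a Gaussian likelihood ratio by its second moment, which is explicit; a step of length h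
  costs a factor exp of order h, so t / h steps cost a bounded factor. For the Lyapunov form, the
  energy dissipates only the square of p0; cross terms have to hand the decay on to the force on the
  first oscillator, to p1 and to q1. As \<delta> is any positive number, moments of
  \<open>N powr \<delta>\<close> are reduced to an integer moment of the noise, averaged over the
  time grid. The measure is chosen before the probability space, hence the need for transition
  probabilities that do not depend on the realization. Harris' theorem works at integer times; a
  moment bound bridges the remaining fraction of a unit.\<close>

abbreviation gauss :: "real measure" where "gauss \<equiv> density lborel (\<lambda>x. ennreal (std_normal_density x))"

lemma prob_gauss: "prob_space gauss"
  by (rule prob_space_normal_density) simp

lemma nn_integral_gauss:
  "g \<in> borel_measurable borel \<Longrightarrow> (\<integral>\<^sup>+z. g z \<partial>gauss) = (\<integral>\<^sup>+z. ennreal (std_normal_density z) * g z \<partial>lborel)"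
  by (subst nn_integral_density) auto

text \<open>One-dimensional Cameron-Martin formula: the exponential is the density of the law of z +
  v with respect to that of z.\<close>

lemma nn_integral_gauss_shift:
  assumes [measurable]: "g \<in> borel_measurable borel"
  shows "(\<integral>\<^sup>+z. g (z + v) \<partial>gauss) = (\<integral>\<^sup>+z. ennreal (exp (v * z - v\<^sup>2 / 2)) * g z \<partial>gauss)"
proof -
  have dens: "std_normal_density (z - v) = std_normal_density z * exp (v * z - v\<^sup>2 / 2)" for z
    by (simp add: std_normal_density_def exp_add[symmetric] power2_diff field_simps)
  have "(\<integral>\<^sup>+z. g (z + v) \<partial>gauss) = (\<integral>\<^sup>+z. ennreal (std_normal_density z) * g (z + v) \<partial>lborel)"
    by (rule nn_integral_gauss) simp
  also have "\<dots> = (\<integral>\<^sup>+z. ennreal (std_normal_density (z - v)) * g z \<partial>lborel)"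
    using nn_integral_real_affine[of "\<lambda>z. ennreal (std_normal_density (z - v)) * g z" 1 v]
    by (simp add: add.commute)
  also have "\<dots> = (\<integral>\<^sup>+z. ennreal (std_normal_density z) * (ennreal (exp (v * z - v\<^sup>2 / 2)) * g z) \<partial>lborel)"
    by (simp add: dens ennreal_mult mult.assoc)
  also have "\<dots> = (\<integral>\<^sup>+z. ennreal (exp (v * z - v\<^sup>2 / 2)) * g z \<partial>gauss)"
    by (subst nn_integral_gauss) auto
  finally show ?thesis .
qed

lemma nn_integral_gauss_exp: "(\<integral>\<^sup>+z. ennreal (exp (v * z - v\<^sup>2 / 2)) \<partial>gauss) = 1"
proof -
  interpret prob_space gauss by (rule prob_gauss)
  show ?thesis using nn_integral_gauss_shift[of "\<lambda>_. 1" v] emeasure_space_1 by simp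
qed

text \<open>Cauchy-Schwarz separates g from the likelihood ratio, whose second moment is exp of the
  squared shift.\<close>

lemma gauss_shift_le:
  assumes [measurable]: "g \<in> borel_measurable borel"
  shows "(\<integral>\<^sup>+z. g (z + v) \<partial>gauss)\<^sup>2 \<le> ennreal (exp (v\<^sup>2)) * (\<integral>\<^sup>+z. (g z)\<^sup>2 \<partial>gauss)"
proof -
  have "(\<integral>\<^sup>+z. ennreal (exp (v * z - v\<^sup>2 / 2)) * g z \<partial>gauss)\<^sup>2
      \<le> (\<integral>\<^sup>+z. (ennreal (exp (v * z - v\<^sup>2 / 2)))\<^sup>2 \<partial>gauss) * (\<integral>\<^sup>+z. (g z)\<^sup>2 \<partial>gauss)"
    by (rule Cauchy_Schwarz_nn_integral) auto
  \<comment> \<open>The squared ratio for v is a constant times the ratio for 2 v, and the latter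
    has mean one.\<close>
  also have "(\<integral>\<^sup>+z. (ennreal (exp (v * z - v\<^sup>2 / 2)))\<^sup>2 \<partial>gauss)
      = (\<integral>\<^sup>+z. ennreal (exp (v\<^sup>2)) * ennreal (exp ((2 * v) * z - (2 * v)\<^sup>2 / 2)) \<partial>gauss)"
    by (intro nn_integral_cong)
       (simp add: ennreal_power ennreal_mult[symmetric] exp_add[symmetric] exp_double[symmetric]
          power2_eq_square algebra_simps flip: exp_add)
  also have "\<dots> = ennreal (exp (v\<^sup>2)) * (\<integral>\<^sup>+z. ennreal (exp ((2 * v) * z - (2 * v)\<^sup>2 / 2)) \<partial>gauss)"
    by (rule nn_integral_cmult) measurable
  also have "\<dots> = ennreal (exp (v\<^sup>2))"
    by (simp only: nn_integral_gauss_exp mult_1_right)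
  finally show ?thesis by (simp add: nn_integral_gauss_shift)
qed

definition gauss2 :: "(real \<times> real) measure" where "gauss2 = gauss \<Otimes>\<^sub>M gauss"

lemma sets_gauss2[simp, measurable_cong]: "sets gauss2 = sets borel"
proof -
  have "sets gauss2 = sets (borel \<Otimes>\<^sub>M borel)"
    unfolding gauss2_def by (intro sets_pair_measure_cong) auto
  then show ?thesis unfolding borel_prod .
qed

lemma space_gauss2[simp]: "space gauss2 = UNIV"
  using sets_eq_imp_space_eq[OF sets_gauss2] by simp

lemma prob_gauss2: "prob_space gauss2"
proof -
  interpret g: prob_space gauss by (rule prob_gauss)
  interpret pair_prob_space gauss gauss ..
  show ?thesis unfolding gauss2_def by unfold_locales
qed

lemma nn_integral_gauss2:
  assumes [measurable]: "g \<in> borel_measurable borel"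
  shows "(\<integral>\<^sup>+z. g z \<partial>gauss2) = (\<integral>\<^sup>+z0. (\<integral>\<^sup>+z1. g (z0, z1) \<partial>gauss) \<partial>gauss)"
proof -
  interpret g: prob_space gauss by (rule prob_gauss)
  interpret pair_prob_space gauss gauss ..
  have "g \<in> borel_measurable (gauss \<Otimes>\<^sub>M gauss)"
    using assms measurable_cong_sets[OF sets_gauss2 refl] unfolding gauss2_def by blast
  then show ?thesis unfolding gauss2_def by (simp add: g.nn_integral_fst)
qed

lemma nn_integral_gauss_measurable:
  assumes [measurable]: "g \<in> borel_measurable (borel :: (real \<times> real) measure)"
  shows "(\<lambda>z0. \<integral>\<^sup>+z1. g (z0, z1) \<partial>gauss :: ennreal) \<in> borel_measurable borel"
proof -
  interpret g: prob_space gauss by (rule prob_gauss)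
  have [measurable]: "g \<in> borel_measurable (borel \<Otimes>\<^sub>M gauss)"
  proof -
    have "sets (borel \<Otimes>\<^sub>M gauss) = sets (borel :: (real \<times> real) measure)"
      by (subst borel_prod[symmetric], intro sets_pair_measure_cong) auto
    then show ?thesis using assms measurable_cong_sets by blast
  qed
  show ?thesis by measurable
qed

text \<open>The two coordinates are shifted one after the other. The factor depends on the shift
  alone and not on g, so the exponents simply add.\<close>

lemma gauss2_shift_le:
  assumes [measurable]: "g \<in> borel_measurable borel"
  shows "(\<integral>\<^sup>+z. g (z + v) \<partial>gauss2)\<^sup>2
    \<le> ennreal (exp ((fst v)\<^sup>2 + (snd v)\<^sup>2)) * (\<integral>\<^sup>+z. (g z)\<^sup>2 \<partial>gauss2)"
proof -
  obtain v0 v1 where v: "v = (v0, v1)" by fastforce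
  have [measurable]: "(\<lambda>z. g (z0, z)) \<in> borel_measurable borel" for z0
    by measurable
  have [measurable]: "(\<lambda>z. g (z, z1)) \<in> borel_measurable borel" for z1
    by measurable
  let ?G = "\<lambda>z0. \<integral>\<^sup>+z1. g (z0, z1 + v1) \<partial>gauss"
  have "(\<lambda>z::real \<times> real. (fst z, snd z + v1)) \<in> borel_measurable borel"
    by (intro borel_measurable_continuous_onI continuous_intros)
  from measurable_compose[OF this assms]
  have "(\<lambda>z. g (fst z, snd z + v1)) \<in> borel_measurable borel" .
  from nn_integral_gauss_measurable[OF this]
  have G[measurable]: "?G \<in> borel_measurable borel" by simp
  have "(\<integral>\<^sup>+z. g (z + v) \<partial>gauss2)\<^sup>2 = (\<integral>\<^sup>+z0. ?G (z0 + v0) \<partial>gauss)\<^sup>2"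
    by (subst nn_integral_gauss2) (auto simp: v)
  also have "\<dots> \<le> ennreal (exp (v0\<^sup>2)) * (\<integral>\<^sup>+z0. (?G z0)\<^sup>2 \<partial>gauss)"
    by (rule gauss_shift_le) measurable
  also have "\<dots> \<le> ennreal (exp (v0\<^sup>2)) *
      (\<integral>\<^sup>+z0. ennreal (exp (v1\<^sup>2)) * (\<integral>\<^sup>+z1. (g (z0, z1))\<^sup>2 \<partial>gauss) \<partial>gauss)"
    by (intro mult_left_mono nn_integral_mono gauss_shift_le) auto
  also have "\<dots> = ennreal (exp (v0\<^sup>2)) * (ennreal (exp (v1\<^sup>2)) * (\<integral>\<^sup>+z. (g z)\<^sup>2 \<partial>gauss2))"
    using nn_integral_gauss_measurable[of "\<lambda>z. (g z)\<^sup>2"]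
    by (subst nn_integral_cmult) (auto simp: nn_integral_gauss2)
  also have "\<dots> = ennreal (exp ((fst v)\<^sup>2 + (snd v)\<^sup>2)) * (\<integral>\<^sup>+z. (g z)\<^sup>2 \<partial>gauss2)"
    by (simp add: v exp_add ennreal_mult mult.assoc)
  finally show ?thesis .
qed

lemma integrable_gauss2:
  assumes "g \<in> borel_measurable borel" "\<And>z. \<bar>g z\<bar> \<le> (B::real)"
  shows "integrable gauss2 g"
proof -
  interpret prob_space gauss2 by (rule prob_gauss2)
  show ?thesis using assms by (intro integrable_const_bound[where B=B]) auto
qed

lemma integral_gauss2_shift_le:
  assumes g[measurable]: "g \<in> borel_measurable borel" and B: "\<And>z. 0 \<le> g z" "\<And>z. g z \<le> (B::real)"
  shows "(\<integral>z. g (z + v) \<partial>gauss2)\<^sup>2 \<le> exp ((fst v)\<^sup>2 + (snd v)\<^sup>2) * (\<integral>z. (g z)\<^sup>2 \<partial>gauss2)"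
proof -
  have i1: "integrable gauss2 (\<lambda>z. g (z + v))" using B by (intro integrable_gauss2[where B=B]) auto
  have B2: "(g z)\<^sup>2 \<le> B\<^sup>2" for z using B by (intro power_mono) auto
  have i2: "integrable gauss2 (\<lambda>z. (g z)\<^sup>2)" using B2 by (intro integrable_gauss2[where B="B\<^sup>2"]) auto
  have nn: "(\<integral>z. g (z + v) \<partial>gauss2) \<ge> 0" "(\<integral>z. (g z)\<^sup>2 \<partial>gauss2) \<ge> 0" using B by auto
  have "ennreal ((\<integral>z. g (z + v) \<partial>gauss2)\<^sup>2) = (\<integral>\<^sup>+z. ennreal (g (z + v)) \<partial>gauss2)\<^sup>2"
    using nn B i1 by (simp add: nn_integral_eq_integral ennreal_power)
  also have "\<dots> \<le> ennreal (exp ((fst v)\<^sup>2 + (snd v)\<^sup>2)) * (\<integral>\<^sup>+z. (ennreal (g z))\<^sup>2 \<partial>gauss2)"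
    by (rule gauss2_shift_le[of "\<lambda>z. ennreal (g z)"]) auto
  also have "(\<integral>\<^sup>+z. (ennreal (g z))\<^sup>2 \<partial>gauss2) = ennreal (\<integral>z. (g z)\<^sup>2 \<partial>gauss2)"
    using B i2 by (simp add: nn_integral_eq_integral[symmetric] ennreal_power)
  finally show ?thesis using nn
    by (subst (asm) ennreal_mult[symmetric]) (auto simp: ennreal_le_iff)
qed

section \<open>Steering one oscillator to rest along a time grid\<close>

lemma sum_index_quadratic: "(\<Sum>i<m. real i * (real n - real i)) = real n * real m * (real m - 1) / 2 - (real m - 1) * real m * (2 * real m - 1) / 6"
  by (induction m) (auto simp: field_simps power2_eq_square)

text \<open>The momentum profile p (1 - s) + a s (1 - s) leads from p to 0 for every a, since the
  second term vanishes at both ends. This leaves a free to make the total displacement equal to - q.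
  The bound on a does not involve n.\<close>

lemma discrete_path_slope:
  fixes p q t :: real and n :: nat
  assumes n: "n \<ge> 2" and t: "t > 0"
  shows "\<exists>a. \<bar>a\<bar> \<le> 8 * (\<bar>q\<bar> / t + \<bar>p\<bar>) \<and>
    (\<Sum>i<n. (t / n) * (p * (1 - i / n) + a * (i / n * (1 - i / n)))) = - q"
proof -
  define S1 where "S1 = (\<Sum>i<n. 1 - real i / n)"
  define S2 where "S2 = (\<Sum>i<n. real i / n * (1 - real i / n))"
  have n0: "real n \<ge> 2" using n by simp
  have "S2 = (\<Sum>i<n. real i * (real n - real i)) / (real n)\<^sup>2"
    unfolding S2_def sum_divide_distrib using n0
    by (intro sum.cong) (auto simp: field_simps power2_eq_square)
  also have "\<dots> = ((real n)\<^sup>2 - 1) / (6 * real n)"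
    unfolding sum_index_quadratic using n0 by (simp add: field_simps power2_eq_square)
  \<comment> \<open>This uses n at least 2; for n = 1 the sum \<open>S2\<close> vanishes and no a
    exists in general.\<close>
  also have "\<dots> \<ge> real n / 8"
  proof -
    have "(real n)\<^sup>2 \<ge> 2\<^sup>2" using n0 by (intro power_mono) auto
    then show ?thesis using n0 by (simp add: field_simps power2_eq_square)
  qed
  finally have S2: "S2 \<ge> real n / 8" .
  have S1: "\<bar>S1\<bar> \<le> real n"
  proof -
    have "\<bar>S1\<bar> \<le> (\<Sum>i<n. \<bar>1 - real i / n\<bar>)" unfolding S1_def by (rule sum_abs)
    also have "\<dots> \<le> (\<Sum>i<n. 1)" using n0 by (intro sum_mono) (auto simp: abs_le_iff field_simps)
    finally show ?thesis by simp
  qed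
  define a where "a = - (q * n / t + p * S1) / S2"
  have "\<bar>a\<bar> = \<bar>q * n / t + p * S1\<bar> / S2" using S2 n0 by (simp add: a_def abs_divide)
  also have "\<dots> \<le> \<bar>q * n / t + p * S1\<bar> / (real n / 8)"
    using S2 n0 by (intro divide_left_mono) auto
  also have "\<dots> \<le> (\<bar>q\<bar> * n / t + \<bar>p\<bar> * n) / (real n / 8)"
  proof (intro divide_right_mono)
    have "\<bar>q * n / t + p * S1\<bar> \<le> \<bar>q * n / t\<bar> + \<bar>p * S1\<bar>" by (rule abs_triangle_ineq)
    also have "\<dots> \<le> \<bar>q\<bar> * n / t + \<bar>p\<bar> * n"
      using S1 t by (auto simp: abs_mult intro!: mult_left_mono)
    finally show "\<bar>q * n / t + p * S1\<bar> \<le> \<bar>q\<bar> * n / t + \<bar>p\<bar> * n" .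
  qed auto
  also have "\<dots> = 8 * (\<bar>q\<bar> / t + \<bar>p\<bar>)" using n0 t by (simp add: field_simps)
  finally have "\<bar>a\<bar> \<le> 8 * (\<bar>q\<bar> / t + \<bar>p\<bar>)" .
  moreover have "(\<Sum>i<n. (t / n) * (p * (1 - i / n) + a * (i / n * (1 - i / n)))) = (t / n) * (p * S1 + a * S2)"
    unfolding S1_def S2_def by (simp add: sum_distrib_left sum.distrib[symmetric] algebra_simps)
  moreover have "(t / n) * (p * S1 + a * S2) = - q"
    using S2 n0 t by (simp add: a_def field_simps)
  ultimately show ?thesis by auto
qed

text \<open>The point is that C depends only on r and t: momentum and slope stay bounded as the grid
  is refined, so the cost of the coupling survives the limit.\<close>

lemma discrete_path:
  assumes n: "n \<ge> 2" and t: "t > 0" and r: "\<bar>p\<bar> \<le> r" "\<bar>q\<bar> \<le> r"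
    and C: "C = (r + 8 * (r / t + r)) * (1 + t + 1 / t)"
  shows "\<exists>P Q :: nat \<Rightarrow> real. P 0 = p \<and> Q 0 = q \<and> P n = 0 \<and> Q n = 0 \<and>
    (\<forall>i<n. Q (Suc i) = Q i + t / n * P i \<and> \<bar>P (Suc i) - P i\<bar> \<le> t / n * C \<and> \<bar>P i\<bar> \<le> C)"
proof -
  from discrete_path_slope[OF n t, of q p] obtain a where
    a: "\<bar>a\<bar> \<le> 8 * (\<bar>q\<bar> / t + \<bar>p\<bar>)"
    and s: "(\<Sum>i<n. (t / n) * (p * (1 - i / n) + a * (i / n * (1 - i / n)))) = - q" by blast
  define P where "P i = p * (1 - real i / n) + a * (real i / n * (1 - real i / n))" for i :: nat
  define Q where "Q i = q + (\<Sum>j<i. t / n * P j)" for i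
  \<comment> \<open>\<open>A\<close> bounds the profile and its slope in the rescaled time i / n. In
    real time the slope is at most \<open>A / t\<close>; the last factor of C covers both
    bounds.\<close>
  define A where "A = r + 8 * (r / t + r)"
  have n0: "real n \<ge> 2" using n by simp
  have r0: "r \<ge> 0" using r by linarith
  have "\<bar>p\<bar> + \<bar>a\<bar> \<le> r + 8 * (\<bar>q\<bar> / t + \<bar>p\<bar>)" using a r by linarith
  also have "\<dots> \<le> A" unfolding A_def using r t by (intro add_left_mono mult_left_mono add_mono divide_right_mono) auto
  finally have pa: "\<bar>p\<bar> + \<bar>a\<bar> \<le> A" .
  have A0: "A \<ge> 0" using pa by linarith
  have CA: "A \<le> C" "A / t \<le> C"
    using A0 t unfolding C A_def[symmetric] by (auto simp: field_simps)
  have P: "\<bar>P i\<bar> \<le> A" if "i < n" for i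
  proof -
    define s where "s = real i / n"
    have s: "0 \<le> s" "s \<le> 1" using that n0 by (auto simp: s_def)
    have "\<bar>P i\<bar> \<le> \<bar>p\<bar> * \<bar>1 - s\<bar> + \<bar>a\<bar> * \<bar>s * (1 - s)\<bar>"
      unfolding P_def s_def[symmetric] abs_mult[symmetric] by (rule abs_triangle_ineq)
    also have "\<dots> \<le> \<bar>p\<bar> * 1 + \<bar>a\<bar> * 1"
      using s by (intro add_mono mult_left_mono) (auto simp: abs_mult mult_le_one)
    finally show ?thesis using pa by simp
  qed
  have dP: "\<bar>P (Suc i) - P i\<bar> \<le> t / n * C" if "i < n" for i
  proof -
    define s where "s = real i / n"
    define d where "d = 1 / real n"
    have s: "0 \<le> s" "s + d \<le> 1" using that n0 by (auto simp: s_def d_def field_simps)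
    have d: "d > 0" using n0 by (simp add: d_def)
    have Ss: "real (Suc i) / n = s + d" by (simp add: s_def d_def add_divide_distrib)
    have "P (Suc i) - P i = - d * p + a * (d * (1 - 2 * s - d))"
      unfolding P_def s_def[symmetric] Ss by (simp add: algebra_simps)
    also have "\<bar>\<dots>\<bar> \<le> \<bar>- d * p\<bar> + \<bar>a * (d * (1 - 2 * s - d))\<bar>" by (rule abs_triangle_ineq)
    also have "\<dots> = d * (\<bar>p\<bar> + \<bar>a\<bar> * \<bar>1 - 2 * s - d\<bar>)"
      using d by (simp add: abs_mult distrib_left mult.left_commute)
    also have "\<dots> \<le> d * (\<bar>p\<bar> + \<bar>a\<bar> * 1)"
      using s d by (intro mult_left_mono add_left_mono) auto
    also have "\<dots> \<le> d * A" using pa d by (intro mult_left_mono) auto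
    also have "\<dots> = t / n * (A / t)" using t by (simp add: d_def)
    also have "\<dots> \<le> t / n * C" using CA t by (intro mult_left_mono) auto
    finally show ?thesis .
  qed
  have "P 0 = p" "Q 0 = q" "P n = 0" "Q n = 0"
    using n0 s by (auto simp: P_def Q_def)
  moreover have "Q (Suc i) = Q i + t / n * P i" for i by (simp add: Q_def)
  ultimately show ?thesis using P dP CA by (intro exI[of _ P] exI[of _ Q]) (auto intro: order_trans)
qed

section \<open>The Euler scheme\<close>

lemma power2_norm_state: "(norm (x :: state))\<^sup>2 = (fst x)\<^sup>2 + (fst (snd x))\<^sup>2 + (fst (snd (snd x)))\<^sup>2 + (snd (snd (snd x)))\<^sup>2"
  by (cases x) (simp add: norm_Pair)

lemma abs_comp_le_norm:
  "\<bar>fst x\<bar> \<le> norm (x :: state)" "\<bar>fst (snd x)\<bar> \<le> norm x"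
  "\<bar>fst (snd (snd x))\<bar> \<le> norm x" "\<bar>snd (snd (snd x))\<bar> \<le> norm x"
  by (rule abs_le_square_iff[THEN iffD2, of _ "norm x", simplified], simp add: power2_norm_state)+

lemma norm_state_le: "norm (x :: state) \<le> \<bar>fst x\<bar> + \<bar>fst (snd x)\<bar> + \<bar>fst (snd (snd x))\<bar> + \<bar>snd (snd (snd x))\<bar>"
proof (rule power2_le_imp_le)
  show "(norm x)\<^sup>2 \<le> (\<bar>fst x\<bar> + \<bar>fst (snd x)\<bar> + \<bar>fst (snd (snd x))\<bar> + \<bar>snd (snd (snd x))\<bar>)\<^sup>2"
    unfolding power2_norm_state by (simp add: power2_eq_square algebra_simps)
qed auto

text \<open>Collects what the coupling argument uses of the equation: a Lipschitz drift, noise of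
  positive strength in both momenta, and positions that are integrals of the momenta.\<close>

locale kinetic =
  fixes b :: "state \<Rightarrow> state" and L s0 s1 :: real
  assumes L: "L \<ge> 0" and b_lipschitz: "norm (b x - b y) \<le> L * norm (x - y)"
    and s_pos: "s0 > 0" "s1 > 0"
    and kinetic: "fst (snd (b x)) = fst x" "snd (snd (snd (b x))) = fst (snd (snd x))"
begin

definition noise :: "real \<Rightarrow> real \<times> real \<Rightarrow> state" where
  "noise h z = (s0 * sqrt h * fst z, 0, s1 * sqrt h * snd z, 0)"

definition euler :: "real \<Rightarrow> (state \<Rightarrow> real) \<Rightarrow> state \<Rightarrow> real" where
  "euler h f x = (\<integral>z. f (x + h *\<^sub>R b x + noise h z) \<partial>gauss2)"

text \<open>The head of the list is the earliest step, so its operator is applied last to the test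
  function. Steps of different lengths are needed for the Markov property.\<close>

definition eulers :: "real list \<Rightarrow> (state \<Rightarrow> real) \<Rightarrow> state \<Rightarrow> real" where
  "eulers hs f = foldr euler hs f"

lemma eulers_Nil[simp]: "eulers [] f = f" and eulers_Cons[simp]: "eulers (h # hs) f = euler h (eulers hs f)"
  and eulers_append: "eulers (hs @ hs') f = eulers hs (eulers hs' f)"
  by (simp_all add: eulers_def)

lemma continuous_b: "continuous_on UNIV b"
  using L b_lipschitz by (intro lipschitz_on_continuous_on[of L] lipschitz_onI) (auto simp: dist_norm)

lemma b_measurable[measurable]: "b \<in> borel_measurable borel"
  by (intro borel_measurable_continuous_onI continuous_b)

lemma noise_measurable[measurable]: "noise h \<in> borel_measurable borel"
  unfolding noise_def by (intro borel_measurable_continuous_onI continuous_intros)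

definition bmeas :: "(state \<Rightarrow> real) \<Rightarrow> real \<Rightarrow> bool" where
  "bmeas f B \<longleftrightarrow> f \<in> borel_measurable borel \<and> (\<forall>x. 0 \<le> f x \<and> f x \<le> B)"

lemma bmeasD:
  assumes "bmeas f B"
  shows "f \<in> borel_measurable borel" "0 \<le> f x" "f x \<le> B" "\<bar>f x\<bar> \<le> B"
  using assms unfolding bmeas_def by (blast, blast, blast, metis abs_of_nonneg)

lemma bmeas_step:
  assumes "bmeas f B"
  shows "integrable gauss2 (\<lambda>z. f (y + noise h z))" "(\<lambda>z. f (y + noise h z)) \<in> borel_measurable borel"
proof -
  have [measurable]: "f \<in> borel_measurable borel" using assms by (simp add: bmeas_def)
  show "(\<lambda>z. f (y + noise h z)) \<in> borel_measurable borel" by measurable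
  then show "integrable gauss2 (\<lambda>z. f (y + noise h z))"
    by (intro integrable_gauss2[where B=B] bmeasD(4)[OF assms]) simp
qed

lemma bmeas_euler:
  assumes "bmeas f B"
  shows "bmeas (euler h f) B"
proof -
  interpret prob_space gauss2 by (rule prob_gauss2)
  have f[measurable]: "f \<in> borel_measurable borel" and B: "\<And>x. 0 \<le> f x" "\<And>x. f x \<le> B"
    using assms by (auto simp: bmeas_def)
  have "(\<lambda>p. f (fst p + h *\<^sub>R b (fst p) + noise h (snd p))) \<in> borel_measurable (borel \<Otimes>\<^sub>M gauss2)"
  proof (rule measurable_compose[OF _ f])
    have 1: "(\<lambda>p. noise h (snd p)) \<in> borel_measurable (borel \<Otimes>\<^sub>M gauss2)"
      by (rule measurable_compose[OF measurable_snd]) simp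
    have 2: "(\<lambda>p. fst p) \<in> borel_measurable (borel \<Otimes>\<^sub>M gauss2)"
      by (rule measurable_fst)
    show "(\<lambda>p. fst p + h *\<^sub>R b (fst p) + noise h (snd p)) \<in> borel_measurable (borel \<Otimes>\<^sub>M gauss2)"
      using 1 2 by (intro borel_measurable_add borel_measurable_scaleR measurable_compose[OF 2 b_measurable]) auto
  qed
  then have "euler h f \<in> borel_measurable borel"
    unfolding euler_def[abs_def] by (intro borel_measurable_lebesgue_integral) (simp add: split_beta')
  moreover have "0 \<le> euler h f x" for x unfolding euler_def using B by simp
  moreover have "euler h f x \<le> B" for x
  proof -
    have "euler h f x \<le> (\<integral>z. B \<partial>gauss2)"
      unfolding euler_def using B bmeas_step(1)[OF assms] by (intro integral_mono) auto
    then show ?thesis using prob_space by simp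
  qed
  ultimately show ?thesis by (simp add: bmeas_def)
qed

lemma bmeas_eulers: "bmeas f B \<Longrightarrow> bmeas (eulers hs f) B"
  by (induction hs) (auto intro: bmeas_euler)

lemma bmeas_square: "bmeas f B \<Longrightarrow> bmeas (\<lambda>x. (f x)\<^sup>2) (B\<^sup>2)"
  by (auto simp: bmeas_def intro!: power_mono)

section \<open>Dependence of the scheme on its starting point\<close>

lemma euler_step_lipschitz:
  assumes "h \<ge> 0"
  shows "norm ((x + h *\<^sub>R b x) - (y + h *\<^sub>R b y)) \<le> exp (L * h) * norm (x - y)"
proof -
  have "norm ((x + h *\<^sub>R b x) - (y + h *\<^sub>R b y)) = norm ((x - y) + h *\<^sub>R (b x - b y))"
    by (simp add: algebra_simps)
  also have "\<dots> \<le> norm (x - y) + h * norm (b x - b y)"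
    using norm_triangle_ineq[of "x - y" "h *\<^sub>R (b x - b y)"] assms by simp
  also have "\<dots> \<le> norm (x - y) + h * (L * norm (x - y))"
    using assms b_lipschitz by (intro add_left_mono mult_left_mono) auto
  also have "\<dots> = (1 + L * h) * norm (x - y)" by (simp add: algebra_simps)
  also have "\<dots> \<le> exp (L * h) * norm (x - y)"
    by (intro mult_right_mono exp_ge_add_one_self) auto
  finally show ?thesis .
qed

lemma euler_lipschitz:
  assumes f: "bmeas f B" and lip: "\<And>x y. \<bar>f x - f y\<bar> \<le> D * norm (x - y)" and "D \<ge> 0" "h \<ge> 0"
  shows "\<bar>euler h f x - euler h f y\<bar> \<le> D * exp (L * h) * norm (x - y)"
proof -
  interpret prob_space gauss2 by (rule prob_gauss2)
  let ?x = "x + h *\<^sub>R b x" and ?y = "y + h *\<^sub>R b y"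
  have "\<bar>euler h f x - euler h f y\<bar> = \<bar>\<integral>z. f (?x + noise h z) - f (?y + noise h z) \<partial>gauss2\<bar>"
    unfolding euler_def using bmeas_step(1)[OF f] by simp
  also have "\<dots> \<le> (\<integral>z. \<bar>f (?x + noise h z) - f (?y + noise h z)\<bar> \<partial>gauss2)"
    by (rule integral_abs_bound)
  also have "\<dots> \<le> (\<integral>z. D * norm (?x - ?y) \<partial>gauss2)"
  proof (intro integral_mono)
    show "\<bar>f (?x + noise h z) - f (?y + noise h z)\<bar> \<le> D * norm (?x - ?y)" for z
      using lip[of "?x + noise h z" "?y + noise h z"] by (simp only: add_diff_cancel_right)
  qed (use bmeas_step(1)[OF f] in auto)
  also have "\<dots> = D * norm (?x - ?y)" using prob_space by simp
  also have "\<dots> \<le> D * (exp (L * h) * norm (x - y))"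
    using assms by (intro mult_left_mono euler_step_lipschitz) auto
  finally show ?thesis by (simp add: mult.assoc)
qed

text \<open>The growth factors of the single steps multiply to exp of L times the elapsed time, so
  the constant does not see how finely that time is divided.\<close>

lemma eulers_lipschitz:
  assumes f: "bmeas f B" and lip: "\<And>x y. \<bar>f x - f y\<bar> \<le> D * norm (x - y)" and D: "D \<ge> 0" 
    and hs: "\<And>h. h \<in> set hs \<Longrightarrow> h \<ge> 0"
  shows "\<bar>eulers hs f x - eulers hs f y\<bar> \<le> D * exp (L * sum_list hs) * norm (x - y)"
  using hs
proof (induction hs arbitrary: x y)
  case Nil
  then show ?case using lip by simp
next
  case (Cons h hs)
  have "\<bar>euler h (eulers hs f) x - euler h (eulers hs f) y\<bar>
      \<le> (D * exp (L * sum_list hs)) * exp (L * h) * norm (x - y)"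
    using Cons D by (intro euler_lipschitz[OF bmeas_eulers[OF f]]) auto
  then show ?case by (simp add: exp_add distrib_left mult.assoc mult.left_commute mult.commute)
qed

section \<open>Coupling of two Euler schemes and the discrete Harnack inequality\<close>

text \<open>At fixed y the Gaussian shift is a constant, so \<open>integral_gauss2_shift_le\<close>
  applies although the shift varies with y. E is the cost already collected by the later steps; the
  present step multiplies it by exp of order h.\<close>

lemma euler_shift:
  assumes F: "bmeas F B" and h: "h > 0"
    and G: "bmeas G B'" and FG: "\<And>y. (F (y + d'))\<^sup>2 \<le> E * G y" and E: "E \<ge> 0"
    and q: "fst (snd d') = fst (snd d) + h * fst d" "snd (snd (snd d')) = snd (snd (snd d)) + h * fst (snd (snd d))"
    and p: "\<bar>fst d' - fst d\<bar> \<le> h * C" "\<bar>fst (snd (snd d')) - fst (snd (snd d))\<bar> \<le> h * C"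
    and dC: "norm d \<le> C'"
  shows "(euler h F (y + d))\<^sup>2 \<le> exp (h * (((C + L * C') / s0)\<^sup>2 + ((C + L * C') / s1)\<^sup>2)) * E * euler h G y"
proof -
  \<comment> \<open>What the noise has to supply: with noise e added to it, the step from y
    displaced by \<open>d'\<close> becomes the step from \<open>y + d\<close>.\<close>
  define e where "e = h *\<^sub>R (b (y + d) - b y) + d - d'"
  define v where "v = (fst e / (s0 * sqrt h), fst (snd (snd e)) / (s1 * sqrt h))"
  have en: "norm (b (y + d) - b y) \<le> L * C'"
    using b_lipschitz[of "y + d" y] L dC by (auto intro: order_trans mult_left_mono)
  have e0: "\<bar>fst e\<bar> \<le> h * (C + L * C')"
  proof -
    have "\<bar>fst e\<bar> \<le> h * \<bar>fst (b (y + d) - b y)\<bar> + \<bar>fst d' - fst d\<bar>"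
      using h abs_mult[of h] by (simp add: e_def abs_le_iff) (smt (verit) mult_minus_right mult_left_mono)
    also have "\<dots> \<le> h * (L * C') + h * C"
      using en h p abs_comp_le_norm(1)[of "b (y + d) - b y"] by (intro add_mono mult_left_mono) auto
    finally show ?thesis by (simp add: algebra_simps)
  qed
  have e1: "\<bar>fst (snd (snd e))\<bar> \<le> h * (C + L * C')"
  proof -
    have "\<bar>fst (snd (snd e))\<bar> \<le> h * \<bar>fst (snd (snd (b (y + d) - b y)))\<bar> + \<bar>fst (snd (snd d')) - fst (snd (snd d))\<bar>"
      using h abs_mult[of h] by (simp add: e_def abs_le_iff) (smt (verit) mult_minus_right mult_left_mono)
    also have "\<dots> \<le> h * (L * C') + h * C"
      using en h p abs_comp_le_norm(3)[of "b (y + d) - b y"] by (intro add_mono mult_left_mono) auto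
    finally show ?thesis by (simp add: algebra_simps)
  qed
  \<comment> \<open>The shift is e divided by a multiple of sqrt h, and e is of order h, so the
    squared shift is of order h and can be summed over t / h steps.\<close>
  have sq: "(u / (s * sqrt h))\<^sup>2 \<le> h * ((C + L * C') / s)\<^sup>2" if "\<bar>u\<bar> \<le> h * (C + L * C')" for u s
  proof -
    have "u\<^sup>2 \<le> (h * (C + L * C'))\<^sup>2" using that by (rule abs_le_square_iff[THEN iffD1, OF order_trans]) simp
    then have "u\<^sup>2 / (s\<^sup>2 * h) \<le> (h * (C + L * C'))\<^sup>2 / (s\<^sup>2 * h)" using h by (intro divide_right_mono) auto
    also have "\<dots> = h * ((C + L * C') / s)\<^sup>2" using h by (simp add: power_divide power_mult_distrib power2_eq_square)
    finally show ?thesis using h by (simp add: power_divide power_mult_distrib)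
  qed
  have vb: "(fst v)\<^sup>2 + (snd v)\<^sup>2 \<le> h * (((C + L * C') / s0)\<^sup>2 + ((C + L * C') / s1)\<^sup>2)"
    using sq[OF e0, of s0] sq[OF e1, of s1] by (simp add: v_def algebra_simps)
  have "noise h v = e"
  proof -
    \<comment> \<open>Noise cannot move positions. The position equations of the displacement are
      made to cancel against dq = p dt in the drift, so e lies in the range of
      \<open>noise\<close>.\<close>
    have "fst (snd e) = 0" "snd (snd (snd e)) = 0"
      using q kinetic[of "y + d"] kinetic[of y] by (auto simp: e_def algebra_simps)
    then show ?thesis using h s_pos by (cases e) (auto simp: noise_def v_def)
  qed
  then have shift: "y + d + h *\<^sub>R b (y + d) + noise h z = (y + h *\<^sub>R b y + noise h (z + v)) + d'" for z
  proof -
    have "noise h (z + v) = noise h z + noise h v" by (simp add: noise_def algebra_simps)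
    with \<open>noise h v = e\<close> show ?thesis by (simp add: e_def algebra_simps)
  qed
  let ?g = "\<lambda>z. F ((y + h *\<^sub>R b y + noise h z) + d')"
  have Fm[measurable]: "F \<in> borel_measurable borel" and FB: "\<And>x. 0 \<le> F x" "\<And>x. F x \<le> B"
    using F by (auto simp: bmeas_def)
  have [measurable]: "?g \<in> borel_measurable borel" by measurable
  have gB: "(?g z)\<^sup>2 \<le> B\<^sup>2" for z using FB by (intro power_mono) auto
  have "(euler h F (y + d))\<^sup>2 = (\<integral>z. ?g (z + v) \<partial>gauss2)\<^sup>2"
    unfolding euler_def shift by simp
  also have "\<dots> \<le> exp ((fst v)\<^sup>2 + (snd v)\<^sup>2) * (\<integral>z. (?g z)\<^sup>2 \<partial>gauss2)"
    using FB by (intro integral_gauss2_shift_le[where B=B]) auto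
  also have "\<dots> \<le> exp (h * (((C + L * C') / s0)\<^sup>2 + ((C + L * C') / s1)\<^sup>2)) * (\<integral>z. E * G (y + h *\<^sub>R b y + noise h z) \<partial>gauss2)"
  proof (intro mult_mono)
    show "(\<integral>z. (?g z)\<^sup>2 \<partial>gauss2) \<le> (\<integral>z. E * G (y + h *\<^sub>R b y + noise h z) \<partial>gauss2)"
    proof (rule integral_mono)
      show "integrable gauss2 (\<lambda>z. (?g z)\<^sup>2)"
        using gB by (intro integrable_gauss2[where B="B\<^sup>2"]) auto
      show "integrable gauss2 (\<lambda>z. E * G (y + h *\<^sub>R b y + noise h z))"
        using bmeas_step(1)[OF G] by simp
    qed (rule FG)
  qed (use vb in auto)
  also have "\<dots> = exp (h * (((C + L * C') / s0)\<^sup>2 + ((C + L * C') / s1)\<^sup>2)) * E * euler h G y"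
    by (simp add: euler_def)
  finally show ?thesis .
qed

text \<open>The Euler scheme started from \<open>x\<close>, displaced by a deterministic path \<open>d\<close>, is an Euler scheme
  started from \<open>x + d 0\<close> whose Gaussian increments are shifted by a bounded adapted amount.\<close>

lemma eulers_shift:
  assumes f: "bmeas f B" and h: "h > 0"
    and q: "\<And>i. i < n \<Longrightarrow> fst (snd (d (Suc i))) = fst (snd (d i)) + h * fst (d i)"
      "\<And>i. i < n \<Longrightarrow> snd (snd (snd (d (Suc i)))) = snd (snd (snd (d i))) + h * fst (snd (snd (d i)))"
    and p: "\<And>i. i < n \<Longrightarrow> \<bar>fst (d (Suc i)) - fst (d i)\<bar> \<le> h * C"
      "\<And>i. i < n \<Longrightarrow> \<bar>fst (snd (snd (d (Suc i)))) - fst (snd (snd (d i)))\<bar> \<le> h * C"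
    and dC: "\<And>i. i < n \<Longrightarrow> norm (d i) \<le> C'" and dn: "d n = 0"
  shows "(eulers (replicate n h) f (y + d 0))\<^sup>2
    \<le> exp (n * (h * (((C + L * C') / s0)\<^sup>2 + ((C + L * C') / s1)\<^sup>2))) * eulers (replicate n h) (\<lambda>x. (f x)\<^sup>2) y"
proof -
  let ?c = "h * (((C + L * C') / s0)\<^sup>2 + ((C + L * C') / s1)\<^sup>2)"
  have "(eulers (replicate k h) f (y + d (n - k)))\<^sup>2 \<le> exp (k * ?c) * eulers (replicate k h) (\<lambda>x. (f x)\<^sup>2) y"
    if "k \<le> n" for k y
    using that
  proof (induction k arbitrary: y)
    case 0
    then show ?case by (simp add: dn)
  next
    case (Suc k)
    define i where "i = n - Suc k"
    have i: "i < n" "n - k = Suc i" "n - Suc k = i" using Suc.prems by (auto simp: i_def)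
    have "(euler h (eulers (replicate k h) f) (y + d i))\<^sup>2
      \<le> exp ?c * exp (k * ?c) * euler h (eulers (replicate k h) (\<lambda>x. (f x)\<^sup>2)) y"
      using Suc i q[OF i(1)] p[OF i(1)] dC[OF i(1)] h
      by (intro euler_shift[OF bmeas_eulers[OF f] _ bmeas_eulers[OF bmeas_square[OF f]], where d'="d (Suc i)"]) auto
    moreover have "exp ?c * exp (k * ?c) = exp (Suc k * ?c)" by (simp add: exp_add[symmetric] algebra_simps)
    ultimately show ?case by (simp add: i)
  qed
  from this[of n] show ?thesis by simp
qed

text \<open>The constant c is fixed before n, the function and the points; it is t times the cost
  per unit time, since n steps of length t / n are made.\<close>

lemma eulers_harnack:
  assumes t: "t > 0" and r: "r \<ge> 0"
  shows "\<exists>c. \<forall>n f B x y. n \<ge> 2 \<longrightarrow> bmeas f B \<longrightarrow> norm (x - y) \<le> r \<longrightarrow>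
    (eulers (replicate n (t / n)) f x)\<^sup>2 \<le> exp c * eulers (replicate n (t / n)) (\<lambda>x. (f x)\<^sup>2) y"
proof -
  define C where "C = (r + 8 * (r / t + r)) * (1 + t + 1 / t)"
  \<comment> \<open>Momenta of the steering path are at most \<open>C\<close> and positions at most
    r + t \<open>C\<close>; the norm is below the sum of the four components.\<close>
  define C' where "C' = 4 * (C + (r + t * C))"
  define c where "c = t * (((C + L * C') / s0)\<^sup>2 + ((C + L * C') / s1)\<^sup>2)"
  have C0: "C \<ge> 0" using t r by (simp add: C_def)
  have "(eulers (replicate n (t / n)) f x)\<^sup>2 \<le> exp c * eulers (replicate n (t / n)) (\<lambda>x. (f x)\<^sup>2) y"
    if n: "n \<ge> 2" and f: "bmeas f B" and xy: "norm (x - y) \<le> r" for n f B x y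
  proof -
    obtain p0 q0 p1 q1 where d: "x - y = (p0, q0, p1, q1)" by (cases "x - y") auto
    have b: "\<bar>p0\<bar> \<le> r" "\<bar>q0\<bar> \<le> r" "\<bar>p1\<bar> \<le> r" "\<bar>q1\<bar> \<le> r"
      using abs_comp_le_norm[of "x - y"] xy unfolding d by auto
    from discrete_path[OF n t b(1,2) C_def] obtain P0 Q0 where
      P0: "P0 0 = p0" "Q0 0 = q0" "P0 n = 0" "Q0 n = 0"
        "\<And>i. i < n \<Longrightarrow> Q0 (Suc i) = Q0 i + t / n * P0 i"
        "\<And>i. i < n \<Longrightarrow> \<bar>P0 (Suc i) - P0 i\<bar> \<le> t / n * C" "\<And>i. i < n \<Longrightarrow> \<bar>P0 i\<bar> \<le> C" by blast
    from discrete_path[OF n t b(3,4) C_def] obtain P1 Q1 where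
      P1: "P1 0 = p1" "Q1 0 = q1" "P1 n = 0" "Q1 n = 0"
        "\<And>i. i < n \<Longrightarrow> Q1 (Suc i) = Q1 i + t / n * P1 i"
        "\<And>i. i < n \<Longrightarrow> \<bar>P1 (Suc i) - P1 i\<bar> \<le> t / n * C" "\<And>i. i < n \<Longrightarrow> \<bar>P1 i\<bar> \<le> C" by blast
    have Qb: "\<bar>Q i\<bar> \<le> r + t * C"
      if Q: "\<And>i. i < n \<Longrightarrow> Q (Suc i) = Q i + t / n * P i" "\<And>i. i < n \<Longrightarrow> \<bar>P i\<bar> \<le> C" "\<bar>Q 0\<bar> \<le> r" "i < n"
      for P Q :: "nat \<Rightarrow> real" and i
    proof -
      have "\<bar>Q j\<bar> \<le> r + j * (t / n * C)" if "j \<le> n" for j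
        using that
      proof (induction j)
        case (Suc j)
        have "\<bar>t / n * P j\<bar> \<le> t / n * C"
          using Q(2)[of j] Suc.prems t by (simp add: abs_mult divide_right_mono mult_left_mono)
        moreover have "\<bar>Q j\<bar> \<le> r + j * (t / n * C)" using Suc by simp
        ultimately have "\<bar>Q j\<bar> + \<bar>t / n * P j\<bar> \<le> (r + j * (t / n * C)) + t / n * C"
          by (intro add_mono)
        moreover have "\<bar>Q (Suc j)\<bar> \<le> \<bar>Q j\<bar> + \<bar>t / n * P j\<bar>"
          using Q(1)[of j] Suc.prems by (simp only: abs_triangle_ineq)
        moreover have "(r + j * (t / n * C)) + t / n * C = r + real (Suc j) * (t / n * C)"
          by (simp only: of_nat_Suc distrib_right mult_1_left add.assoc add.commute)
        ultimately show ?case by (simp only: order_trans)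
      qed (use Q in auto)
      from this[of i] have "\<bar>Q i\<bar> \<le> r + i * (t / n * C)" using \<open>i < n\<close> by simp
      also have "i * (t / n * C) \<le> n * (t / n * C)"
        using \<open>i < n\<close> t C0 by (intro mult_right_mono) auto
      also have "n * (t / n * C) = t * C" using n by simp
      finally show ?thesis by simp
    qed
    define d where "d i = (P0 i, Q0 i, P1 i, Q1 i)" for i
    have dC: "norm (d i) \<le> C'" if i: "i < n" for i
    proof -
      have "\<bar>Q0 i\<bar> \<le> r + t * C" using Qb[of Q0 P0 i, OF P0(5,7)] b i P0(2) by simp
      moreover have "\<bar>Q1 i\<bar> \<le> r + t * C" using Qb[of Q1 P1 i, OF P1(5,7)] b i P1(2) by simp
      moreover have "t * C \<ge> 0" using t C0 by simp
      ultimately show ?thesis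
        using norm_state_le[of "d i"] P0(7)[OF i] P1(7)[OF i] C0 r by (simp add: d_def C'_def)
    qed
    have "(eulers (replicate n (t / n)) f (y + d 0))\<^sup>2
      \<le> exp (n * ((t / n) * (((C + L * C') / s0)\<^sup>2 + ((C + L * C') / s1)\<^sup>2))) *
         eulers (replicate n (t / n)) (\<lambda>x. (f x)\<^sup>2) y"
      using t n P0 P1 dC by (intro eulers_shift[OF f]) (auto simp: d_def zero_prod_def)
    moreover have "n * ((t / n) * (((C + L * C') / s0)\<^sup>2 + ((C + L * C') / s1)\<^sup>2)) = c"
      using n by (simp add: c_def)
    moreover have "y + d 0 = x" using d by (simp add: d_def P0 P1 flip: \<open>x - y = _\<close>)
    ultimately show ?thesis by simp
  qed
  then show ?thesis by blast
qed

end

section \<open>A Lyapunov form for the linear part\<close>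

text \<open>The drift for the potential x^2 / 2. It is the part that matters at infinity, because
  the derivative of the remainder of \<open>V1\<close> is bounded.\<close>

definition lin_drift :: "real \<Rightarrow> real \<Rightarrow> state \<Rightarrow> state" where
  "lin_drift \<alpha> \<gamma> x = (case x of (p, q, u, v) \<Rightarrow>
    (- ((1 + \<alpha>) * q - \<alpha> * v) - \<gamma> * p, p, \<alpha> * q - (1 + \<alpha>) * v, u))"

lemma linear_lin_drift: "linear (lin_drift \<alpha> \<gamma>)"
proof (rule linearI)
  fix x y :: state and c :: real
  obtain p q u v where x: "x = (p, q, u, v)" by (cases x) auto
  obtain p' q' u' v' where y: "y = (p', q', u', v')" by (cases y) auto
  show "lin_drift \<alpha> \<gamma> (x + y) = lin_drift \<alpha> \<gamma> x + lin_drift \<alpha> \<gamma> y"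
    by (simp add: x y lin_drift_def algebra_simps)
  show "lin_drift \<alpha> \<gamma> (c *\<^sub>R x) = c *\<^sub>R lin_drift \<alpha> \<gamma> x"
    by (simp add: x lin_drift_def algebra_simps)
qed

text \<open>With f = (1 + \<alpha>) q - \<alpha> v, the diagonal is \<open>K0\<close> times twice
  the harmonic energy plus \<open>K1\<close> p f + \<open>K2\<close> u f + u v. Along the linear
  flow the energy loses p^2, the product p f loses f^2, the product u f loses u^2, and u v loses
  v^2, each at the price of terms controlled earlier in this list or by a small part of the later
  ones. The polarized form is needed to expand an Euler step.\<close>

definition hypo_form :: "real \<Rightarrow> real \<Rightarrow> real \<Rightarrow> real \<Rightarrow> state \<Rightarrow> state \<Rightarrow> real" where
  "hypo_form \<alpha> K0 K1 K2 x y = (case x of (p, q, u, v) \<Rightarrow> case y of (p', q', u', v') \<Rightarrow>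
    K0 * (p * p' + q * q' + u * u' + v * v' + \<alpha> * (q - v) * (q' - v'))
    + K1 / 2 * (p * ((1 + \<alpha>) * q' - \<alpha> * v') + p' * ((1 + \<alpha>) * q - \<alpha> * v))
    + K2 / 2 * (u * ((1 + \<alpha>) * q' - \<alpha> * v') + u' * ((1 + \<alpha>) * q - \<alpha> * v))
    + (u * v' + u' * v) / 2)"

lemma hypo_form_add:
  "hypo_form \<alpha> K0 K1 K2 (x + y) z = hypo_form \<alpha> K0 K1 K2 x z + hypo_form \<alpha> K0 K1 K2 y z"
proof -
  obtain p q u v where x: "x = (p, q, u, v)" by (cases x) auto
  obtain p' q' u' v' where y: "y = (p', q', u', v')" by (cases y) auto
  obtain p'' q'' u'' v'' where z: "z = (p'', q'', u'', v'')" by (cases z) auto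
  show ?thesis unfolding x y z hypo_form_def add_Pair prod.case by algebra
qed

lemma hypo_form_scaleR:
  "hypo_form \<alpha> K0 K1 K2 (c *\<^sub>R x) z = c * hypo_form \<alpha> K0 K1 K2 x z"
proof -
  obtain p q u v where x: "x = (p, q, u, v)" by (cases x) auto
  obtain p'' q'' u'' v'' where z: "z = (p'', q'', u'', v'')" by (cases z) auto
  show ?thesis unfolding x z hypo_form_def scaleR_Pair real_scaleR_def prod.case by algebra
qed

lemma hypo_form_commute:
  "hypo_form \<alpha> K0 K1 K2 x z = hypo_form \<alpha> K0 K1 K2 z x"
proof -
  obtain p q u v where x: "x = (p, q, u, v)" by (cases x) auto
  obtain p'' q'' u'' v'' where z: "z = (p'', q'', u'', v'')" by (cases z) auto
  show ?thesis unfolding x z hypo_form_def prod.case by algebra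
qed

text \<open>The constants are fixed in the order \<open>K2\<close>, \<open>K1\<close>,
  \<open>K0\<close>: \<open>K2\<close> damps u^2 beyond what the product u v produces,
  \<open>K1\<close> absorbs the multiples of f^2 left by the products f g and f v, and
  \<open>K0\<close> absorbs every multiple of p^2.\<close>

lemma hypo_form_dissipation:
  fixes \<alpha> \<gamma> K0 K1 K2 p q u v :: real
  assumes \<alpha>: "\<alpha> > 0" and c: "c = (1 + 2 * \<alpha>) / (1 + \<alpha>)" and c': "c' = \<alpha> / (1 + \<alpha>)"
    and K2: "K2 = 3 / \<alpha>" and n1: "n1 = K1 * \<alpha> - K2 * (1 + \<alpha>)" and n2: "n2 = K2 * c - c'"
    and K1: "K1 = 2 * (1 + K2 * c' + n2\<^sup>2 / (2 * c))"
    and K0: "2 * K0 * \<gamma> \<ge> 1 + K1 * \<gamma>\<^sup>2 / 2 + K1 * (1 + \<alpha>) + n1\<^sup>2 / 2"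
    and x: "x = (p, q, u, v)"
  shows "- 2 * hypo_form \<alpha> K0 K1 K2 x (lin_drift \<alpha> \<gamma> x) \<ge> (norm x)\<^sup>2 / 8"
proof -
  have c1: "c \<ge> 1" using \<alpha> by (simp add: c field_simps)
  have c'0: "c' \<ge> 0" using \<alpha> by (simp add: c')
  \<comment> \<open>The conservative forces on the two oscillators are \<open>- f\<close> and
    \<open>g\<close>. Writing \<open>g\<close> through f and v exposes the damping - c v of the
    second one.\<close>
  define f where "f = (1 + \<alpha>) * q - \<alpha> * v"
  define g where "g = \<alpha> * q - (1 + \<alpha>) * v"
  have g: "g = c' * f - c * v"
    using \<alpha> by (simp add: g_def f_def c c' divide_simps) (simp add: algebra_simps)
  have K1pos: "K1 \<ge> 0" using c1 c'0 \<alpha> by (simp add: K1 K2)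
  have K2\<alpha>: "K2 * \<alpha> = 3" using \<alpha> by (simp add: K2)
  have "- 2 * hypo_form \<alpha> K0 K1 K2 x (lin_drift \<alpha> \<gamma> x)
    = 2 * K0 * \<gamma> * p\<^sup>2 + K1 * f\<^sup>2 + K1 * \<gamma> * p * f - K1 * (1 + \<alpha>) * p\<^sup>2 + K1 * \<alpha> * p * u
      + K2 * \<alpha> * u\<^sup>2 - K2 * (1 + \<alpha>) * p * u - K2 * f * g - u\<^sup>2 - g * v"
    unfolding f_def g_def by (simp add: hypo_form_def lin_drift_def x power2_eq_square field_simps)
  also have "\<dots> = 2 * K0 * \<gamma> * p\<^sup>2 + K1 * f\<^sup>2 + K1 * \<gamma> * p * f - K1 * (1 + \<alpha>) * p\<^sup>2 + n1 * p * u
      + 2 * u\<^sup>2 + n2 * f * v - K2 * c' * f\<^sup>2 + c * v\<^sup>2"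
    unfolding g K2\<alpha> n1 n2 by (simp add: power2_eq_square algebra_simps)
  \<comment> \<open>The mixed products p f, p u and f v are removed by completing squares; each
    borrows half of the available f^2, a quarter of the 2 u^2, and half of the c v^2.\<close>
  also have "\<dots> = K1 / 2 * (\<gamma> * p + f)\<^sup>2 + (u + n1 * p)\<^sup>2 / 2 + c / 2 * (v + n2 * f / c)\<^sup>2
      + (2 * K0 * \<gamma> - K1 * \<gamma>\<^sup>2 / 2 - K1 * (1 + \<alpha>) - n1\<^sup>2 / 2) * p\<^sup>2
      + (K1 / 2 - K2 * c' - n2\<^sup>2 / (2 * c)) * f\<^sup>2 + 3 / 2 * u\<^sup>2 + c / 2 * v\<^sup>2"
    using c1 by (simp add: power2_eq_square field_simps)
  also have "\<dots> \<ge> 0 + 0 + 0 + 1 * p\<^sup>2 + 1 * f\<^sup>2 + 3 / 2 * u\<^sup>2 + 1 / 2 * v\<^sup>2"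
  proof (intro add_mono)
    show "1 * p\<^sup>2 \<le> (2 * K0 * \<gamma> - K1 * \<gamma>\<^sup>2 / 2 - K1 * (1 + \<alpha>) - n1\<^sup>2 / 2) * p\<^sup>2"
      using K0 by (intro mult_right_mono) auto
    show "1 * f\<^sup>2 \<le> (K1 / 2 - K2 * c' - n2\<^sup>2 / (2 * c)) * f\<^sup>2"
    proof (intro mult_right_mono)
      have "2 * (1 + a + d) / 2 - a - d = 1" for a d :: real by (simp add: field_simps)
      then show "1 \<le> K1 / 2 - K2 * c' - n2\<^sup>2 / (2 * c)" by (simp only: K1)
    qed auto
    show "1 / 2 * v\<^sup>2 \<le> c / 2 * v\<^sup>2" using c1 by (intro mult_right_mono) auto
  qed (use K1pos c1 in auto)
  finally have 1: "- 2 * hypo_form \<alpha> K0 K1 K2 x (lin_drift \<alpha> \<gamma> x) \<ge> p\<^sup>2 + f\<^sup>2 + 3 / 2 * u\<^sup>2 + v\<^sup>2 / 2" by simp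
  \<comment> \<open>The position q is the only coordinate without a square of its own; it is
    recovered from f and v.\<close>
  have "q = (f + \<alpha> * v) / (1 + \<alpha>)" using \<alpha> by (simp add: f_def nonzero_eq_divide_eq algebra_simps)
  then have "q = (1 / (1 + \<alpha>)) * f + c' * v" by (simp add: c' add_divide_distrib)
  then have "q\<^sup>2 \<le> 2 * ((1 / (1 + \<alpha>)) * f)\<^sup>2 + 2 * (c' * v)\<^sup>2"
    using sum_squares_bound[of "(1 / (1 + \<alpha>)) * f" "c' * v"] by (simp add: power2_sum)
  also have "\<dots> \<le> 2 * f\<^sup>2 + 2 * v\<^sup>2"
  proof -
    have "(1 / (1 + \<alpha>))\<^sup>2 \<le> 1" "c'\<^sup>2 \<le> 1" using \<alpha> by (auto simp: c' intro!: power_le_one)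
    from mult_right_mono[OF this(1) zero_le_power2[of f]] mult_right_mono[OF this(2) zero_le_power2[of v]]
    show ?thesis unfolding power_mult_distrib by linarith
  qed
  finally have "q\<^sup>2 \<le> 2 * f\<^sup>2 + 2 * v\<^sup>2" .
  moreover have "(norm x)\<^sup>2 = p\<^sup>2 + q\<^sup>2 + u\<^sup>2 + v\<^sup>2" by (simp add: x norm_Pair)
  moreover have "(a + k + d + e) / 8 \<le> a + j + 3 / 2 * d + e / 2"
    if "k \<le> 2 * j + 2 * e" "a \<ge> 0" "j \<ge> 0" "d \<ge> 0" "e \<ge> 0" for a j k d e :: real
    using that by (simp add: field_simps)
  from this[OF calculation(1), of "p\<^sup>2" "u\<^sup>2"]
  have "(p\<^sup>2 + q\<^sup>2 + u\<^sup>2 + v\<^sup>2) / 8 \<le> p\<^sup>2 + f\<^sup>2 + 3 / 2 * u\<^sup>2 + v\<^sup>2 / 2" by simp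
  ultimately show ?thesis using 1 by simp
qed

text \<open>By Young's inequality all cross terms together are at most m times the squared norm, so
  a large \<open>K0\<close> makes the form equivalent to the squared norm.\<close>

lemma hypo_form_bounds:
  fixes \<alpha> K0 K1 K2 :: real
  assumes \<alpha>: "\<alpha> > 0" and K: "K0 \<ge> 0" "K1 \<ge> 0" "K2 \<ge> 0"
    and F: "F = 2 * (1 + \<alpha>)\<^sup>2 + 2 * \<alpha>\<^sup>2" and m: "m = (K1 + K2) * (1 + F) / 2 + 1 / 2"
  shows "(K0 - m) * (norm x)\<^sup>2 \<le> hypo_form \<alpha> K0 K1 K2 x x"
    and "hypo_form \<alpha> K0 K1 K2 x x \<le> (K0 * (1 + 2 * \<alpha>) + m) * (norm x)\<^sup>2"
proof -
  obtain p q u v where x: "x = (p, q, u, v)" by (cases x) auto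
  define f where "f = (1 + \<alpha>) * q - \<alpha> * v"
  define n where "n = p\<^sup>2 + q\<^sup>2 + u\<^sup>2 + v\<^sup>2"
  have n: "(norm x)\<^sup>2 = n" by (simp add: x n_def norm_Pair)
  have F0: "F \<ge> 0" by (simp add: F)
  have "f\<^sup>2 \<le> 2 * ((1 + \<alpha>) * q)\<^sup>2 + 2 * (\<alpha> * v)\<^sup>2"
    unfolding f_def using sum_squares_bound[of "(1 + \<alpha>) * q" "- (\<alpha> * v)"] by (simp add: power2_diff)
  also have "\<dots> \<le> F * (q\<^sup>2 + v\<^sup>2)" unfolding F power_mult_distrib by (simp add: distrib_left distrib_right)
  finally have f: "f\<^sup>2 \<le> F * (q\<^sup>2 + v\<^sup>2)" .
  have b: "\<bar>a * d\<bar> \<le> (a\<^sup>2 + d\<^sup>2) / 2" for a d :: real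
    using sum_squares_bound[of "\<bar>a\<bar>" "\<bar>d\<bar>"] by (simp add: abs_mult)
  have n1F: "p\<^sup>2 + F * (q\<^sup>2 + v\<^sup>2) \<le> (1 + F) * n" "u\<^sup>2 + F * (q\<^sup>2 + v\<^sup>2) \<le> (1 + F) * n"
  proof -
    have "F * p\<^sup>2 \<ge> 0" "F * u\<^sup>2 \<ge> 0" using F0 by auto
    then show "p\<^sup>2 + F * (q\<^sup>2 + v\<^sup>2) \<le> (1 + F) * n" "u\<^sup>2 + F * (q\<^sup>2 + v\<^sup>2) \<le> (1 + F) * n"
      by (auto simp: n_def algebra_simps)
  qed
  have 1: "\<bar>K1 * (p * f)\<bar> \<le> K1 * ((1 + F) * n / 2)"
  proof -
    have "\<bar>p * f\<bar> \<le> (1 + F) * n / 2" using b[of p f] f n1F(1) by simp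
    then show ?thesis unfolding abs_mult[of K1] using K by (simp only: abs_of_nonneg mult_left_mono)
  qed
  have 2: "\<bar>K2 * (u * f)\<bar> \<le> K2 * ((1 + F) * n / 2)"
  proof -
    have "\<bar>u * f\<bar> \<le> (1 + F) * n / 2" using b[of u f] f n1F(2) by simp
    then show ?thesis unfolding abs_mult[of K2] using K by (simp only: abs_of_nonneg mult_left_mono)
  qed
  have 3: "\<bar>u * v\<bar> \<le> n / 2"
  proof -
    have "(u\<^sup>2 + v\<^sup>2) / 2 \<le> n / 2" unfolding n_def by (intro divide_right_mono) auto
    then show ?thesis using b[of u v] by (rule order_trans[rotated])
  qed
  have H: "hypo_form \<alpha> K0 K1 K2 x x = K0 * (n + \<alpha> * (q - v)\<^sup>2) + K1 * (p * f) + K2 * (u * f) + u * v"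
    by (simp add: hypo_form_def x n_def f_def power2_eq_square field_simps)
  have M: "K1 * ((1 + F) * n / 2) + K2 * ((1 + F) * n / 2) + n / 2 = m * n"
    by (simp add: m field_simps)
  have "K0 * n \<le> K0 * (n + \<alpha> * (q - v)\<^sup>2)" using \<alpha> K by (intro mult_left_mono) auto
  then show "(K0 - m) * (norm x)\<^sup>2 \<le> hypo_form \<alpha> K0 K1 K2 x x"
    unfolding n H left_diff_distrib M[symmetric] using 1 2 3 by linarith
  have "(q - v)\<^sup>2 \<le> 2 * n"
  proof -
    have "(q - v)\<^sup>2 \<le> 2 * (q\<^sup>2 + v\<^sup>2)"
      using sum_squares_bound[of q "- v"] by (simp add: power2_diff)
    also have "\<dots> \<le> 2 * n" unfolding n_def by (intro mult_left_mono) auto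
    finally show ?thesis .
  qed
  then have "\<alpha> * (q - v)\<^sup>2 \<le> \<alpha> * (2 * n)" using \<alpha> by (intro mult_left_mono) auto
  then have "K0 * (n + \<alpha> * (q - v)\<^sup>2) \<le> K0 * (n + \<alpha> * (2 * n))" using K by (intro mult_left_mono) auto
  also have "\<dots> = K0 * (1 + 2 * \<alpha>) * n" by (simp add: algebra_simps)
  finally show "hypo_form \<alpha> K0 K1 K2 x x \<le> (K0 * (1 + 2 * \<alpha>) + m) * (norm x)\<^sup>2"
    unfolding n H distrib_right[of _ m] M[symmetric] using 1 2 3 by linarith
qed

lemma continuous_hypo_form: "continuous_on UNIV (\<lambda>x. hypo_form \<alpha> K0 K1 K2 x x)"
proof -
  have "hypo_form \<alpha> K0 K1 K2 x x =
    K0 * (fst x * fst x + fst (snd x) * fst (snd x) + fst (snd (snd x)) * fst (snd (snd x)) + snd (snd (snd x)) * snd (snd (snd x))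
      + \<alpha> * (fst (snd x) - snd (snd (snd x))) * (fst (snd x) - snd (snd (snd x))))
    + K1 * (fst x * ((1 + \<alpha>) * fst (snd x) - \<alpha> * snd (snd (snd x))))
    + K2 * (fst (snd (snd x)) * ((1 + \<alpha>) * fst (snd x) - \<alpha> * snd (snd (snd x))))
    + fst (snd (snd x)) * snd (snd (snd x))" for x
    by (cases x) (simp add: hypo_form_def)
  then show ?thesis by (simp only:) (intro continuous_intros)
qed

text \<open>Dissipation and positivity both ask only for a large \<open>K0\<close>, so the two
  demands can be met together.\<close>

lemma quadratic_lyapunov:
  assumes "\<alpha> > 0" "\<gamma> > 0"
  shows "\<exists>(B :: state \<Rightarrow> state \<Rightarrow> real) c2 l. c2 > 0 \<and> l > 0 \<and>
    (\<forall>x y z. B (x + y) z = B x z + B y z) \<and> (\<forall>a x y. B (a *\<^sub>R x) y = a * B x y) \<and> (\<forall>x y. B x y = B y x) \<and>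
    (\<forall>x. (norm x)\<^sup>2 \<le> B x x) \<and> (\<forall>x. B x x \<le> c2 * (norm x)\<^sup>2) \<and>
    (\<forall>x. 2 * B x (lin_drift \<alpha> \<gamma> x) \<le> - 2 * l * B x x) \<and> continuous_on UNIV (\<lambda>x. B x x)"
proof -
  define c where "c = (1 + 2 * \<alpha>) / (1 + \<alpha>)"
  define c' where "c' = \<alpha> / (1 + \<alpha>)"
  define K2 where "K2 = 3 / \<alpha>"
  define n2 where "n2 = K2 * c - c'"
  define K1 where "K1 = 2 * (1 + K2 * c' + n2\<^sup>2 / (2 * c))"
  define n1 where "n1 = K1 * \<alpha> - K2 * (1 + \<alpha>)"
  define F where "F = 2 * (1 + \<alpha>)\<^sup>2 + 2 * \<alpha>\<^sup>2"
  define m where "m = (K1 + K2) * (1 + F) / 2 + 1 / 2"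
  \<comment> \<open>The fraction is what the dissipation requires; the summand m + 1 makes the form
    dominate the squared norm.\<close>
  define K0 where "K0 = (1 + K1 * \<gamma>\<^sup>2 / 2 + K1 * (1 + \<alpha>) + n1\<^sup>2 / 2) / (2 * \<gamma>) + m + 1"
  define c2 where "c2 = K0 * (1 + 2 * \<alpha>) + m"
  have pos: "c > 0" "c' > 0" "K2 > 0" using assms by (auto simp: c_def c'_def K2_def)
  then have K1: "K1 > 0" by (simp add: K1_def add_pos_nonneg)
  have F: "F \<ge> 0" by (simp add: F_def)
  have m: "m > 0" using K1 pos F by (simp add: m_def add_nonneg_pos)
  have "(1 + K1 * \<gamma>\<^sup>2 / 2 + K1 * (1 + \<alpha>) + n1\<^sup>2 / 2) / (2 * \<gamma>) \<ge> 0" using K1 assms by simp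
  then have K0m: "K0 \<ge> m + 1" by (simp add: K0_def)
  have c2: "c2 > 0" using K0m m assms by (simp add: c2_def add_nonneg_pos)
  have "2 * K0 * \<gamma> = (1 + K1 * \<gamma>\<^sup>2 / 2 + K1 * (1 + \<alpha>) + n1\<^sup>2 / 2) + 2 * (m + 1) * \<gamma>"
    using assms by (simp add: K0_def field_simps)
  then have K0: "2 * K0 * \<gamma> \<ge> 1 + K1 * \<gamma>\<^sup>2 / 2 + K1 * (1 + \<alpha>) + n1\<^sup>2 / 2" using m assms by simp
  let ?B = "hypo_form \<alpha> K0 K1 K2"
  have bnd: "(K0 - m) * (norm x)\<^sup>2 \<le> ?B x x" "?B x x \<le> c2 * (norm x)\<^sup>2" for x
    unfolding c2_def using hypo_form_bounds[OF assms(1) _ _ _ F_def m_def, of K0 x] K0m m K1 pos by auto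
  have lo: "(norm x)\<^sup>2 \<le> ?B x x" for x
  proof -
    have "1 * (norm x)\<^sup>2 \<le> (K0 - m) * (norm x)\<^sup>2" using K0m by (intro mult_right_mono) auto
    then show ?thesis using bnd(1)[of x] by simp
  qed
  have diss: "2 * ?B x (lin_drift \<alpha> \<gamma> x) \<le> - 2 * (1 / (16 * c2)) * ?B x x" for x
  proof -
    obtain p q u v where x: "x = (p, q, u, v)" by (cases x) auto
    \<comment> \<open>The form is at most c2 times the squared norm, which turns the dissipation
      constant 1/8 into the rate 1 / (16 c2).\<close>
    have "?B x x / c2 \<le> (norm x)\<^sup>2" using bnd(2)[of x] c2 by (simp add: divide_le_eq mult.commute)
    moreover have "(norm x)\<^sup>2 / 8 \<le> - 2 * ?B x (lin_drift \<alpha> \<gamma> x)"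
      by (rule hypo_form_dissipation[OF assms(1) c_def c'_def K2_def n1_def n2_def K1_def K0 x])
    ultimately have "2 * ?B x (lin_drift \<alpha> \<gamma> x) \<le> - ((?B x x / c2) / 8)" by simp
    also have "\<dots> = - 2 * (1 / (16 * c2)) * ?B x x" by simp
    finally show ?thesis .
  qed
  show ?thesis
  proof (rule exI[of _ ?B], rule exI[of _ c2], rule exI[of _ "1 / (16 * c2)"], intro conjI allI)
    show "1 / (16 * c2) > 0" using c2 by simp
  qed (rule c2 lo bnd(2) diss hypo_form_add hypo_form_scaleR hypo_form_commute continuous_hypo_form)+
qed


section \<open>One Euler step under the Lyapunov form\<close>

text \<open>Here z is the solution with the noise subtracted and v the noise. Since b differs from A
  by a bounded term, \<open>b (z + v)\<close> is A z plus an error of order 1 + |v|, so the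
  contraction of the linear part carries over with a noise-dependent constant. The first claim is
  used to add the noise back at the end.\<close>

lemma euler_step_lyapunov:
  fixes B :: "state \<Rightarrow> state \<Rightarrow> real" and A b :: "state \<Rightarrow> state"
  assumes c2: "c2 > 0" and l: "l > 0"
    and add: "\<And>x y z. B (x + y) z = B x z + B y z" and scale: "\<And>a x y. B (a *\<^sub>R x) y = a * B x y"
    and sym: "\<And>x y. B x y = B y x"
    and lo: "\<And>x. (norm x)\<^sup>2 \<le> B x x" and hi: "\<And>x. B x x \<le> c2 * (norm x)\<^sup>2"
    and diss: "\<And>x. 2 * B x (A x) \<le> - 2 * l * B x x" and A: "linear A"
    and b: "\<And>x. norm (b x - A x) \<le> r"
  shows "\<And>\<eta> x y. \<eta> > 0 \<Longrightarrow> B (x + y) (x + y) \<le> (1 + \<eta>) * B x x + (1 + 1 / \<eta>) * B y y"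
    and "\<exists>C h0. C \<ge> 0 \<and> h0 > 0 \<and> l * h0 \<le> 1 \<and> (\<forall>h z v. 0 \<le> h \<longrightarrow> h \<le> h0 \<longrightarrow>
      B (z + h *\<^sub>R b (z + v)) (z + h *\<^sub>R b (z + v)) \<le> (1 - l * h) * B z z + C * h * (1 + (norm v)\<^sup>2))"
proof -
  let ?N = "\<lambda>x. B x x"
  have N0: "?N x \<ge> 0" for x using lo[of x] zero_le_power2[of "norm x"] by linarith
  have add': "B z (x + y) = B z x + B z y" for x y z using add sym by metis
  have scale': "B z (a *\<^sub>R x) = a * B z x" for a x z using scale sym by metis
  have expand: "?N (x + a *\<^sub>R y) = ?N x + 2 * a * B x y + a\<^sup>2 * ?N y" for x y a
    by (simp add: add add' scale scale' sym[of y x] power2_eq_square algebra_simps)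
  \<comment> \<open>Young's inequality, read off from the form being nonnegative at x - y /
    e.\<close>
  have young: "2 * B x y \<le> e * ?N x + ?N y / e" if "e > 0" for x y e
  proof -
    have "0 \<le> ?N (x + (- (1 / e)) *\<^sub>R y)" by (rule N0)
    also have "\<dots> = ?N x - 2 * B x y / e + ?N y / e\<^sup>2"
      unfolding expand by (simp add: power_divide)
    finally have "0 \<le> e * (?N x - 2 * B x y / e + ?N y / e\<^sup>2)" using that by simp
    then show ?thesis using that by (simp add: algebra_simps power2_eq_square)
  qed
  show Nadd: "?N (x + y) \<le> (1 + \<eta>) * ?N x + (1 + 1 / \<eta>) * ?N y" if "\<eta> > 0" for \<eta> x y
    using young[OF that, of x y] expand[of x 1 y] by (simp add: algebra_simps)
  obtain Ka where Ka: "Ka > 0" "\<And>x. norm (A x) \<le> norm x * Ka"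
    using A linear_conv_bounded_linear bounded_linear.pos_bounded by metis
  have r: "r \<ge> 0" using b[of 0] norm_ge_zero order_trans by blast
  define a where "a = c2 * Ka\<^sup>2"
  have a: "a > 0" using c2 Ka by (simp add: a_def)
  have NA: "?N (A x) \<le> a * (norm x)\<^sup>2" for x
  proof -
    have "(norm (A x))\<^sup>2 \<le> (norm x * Ka)\<^sup>2" using Ka by (intro power_mono) auto
    then have "c2 * (norm (A x))\<^sup>2 \<le> c2 * (norm x * Ka)\<^sup>2" using c2 by (intro mult_left_mono) auto
    then show ?thesis using hi[of "A x"] by (simp add: a_def power_mult_distrib algebra_simps)
  qed
  define E where "E = 2 * a + 2 * c2 * r\<^sup>2"
  have E: "E \<ge> 0" using a c2 by (simp add: E_def)
  have Ne: "?N (b (z + v) - A z) \<le> E * (1 + (norm v)\<^sup>2)" for z v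
  proof -
    have eq: "b (z + v) - A z = A v + (b (z + v) - A (z + v))" by (simp add: linear_add[OF A])
    have "?N (b (z + v) - A z) \<le> 2 * ?N (A v) + 2 * ?N (b (z + v) - A (z + v))"
      unfolding eq using Nadd[of 1 "A v" "b (z + v) - A (z + v)"] by simp
    also have "?N (b (z + v) - A (z + v)) \<le> c2 * r\<^sup>2"
    proof (rule order_trans[OF hi])
      have "(norm (b (z + v) - A (z + v)))\<^sup>2 \<le> r\<^sup>2" by (intro power_mono b norm_ge_zero)
      then show "c2 * (norm (b (z + v) - A (z + v)))\<^sup>2 \<le> c2 * r\<^sup>2" using c2 by (intro mult_left_mono) auto
    qed
    also have "2 * ?N (A v) + 2 * (c2 * r\<^sup>2) \<le> E * (1 + (norm v)\<^sup>2)"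
    proof -
      have "c2 * r\<^sup>2 * (norm v)\<^sup>2 \<ge> 0" using c2 by simp
      then show ?thesis using NA[of v] a by (simp add: E_def algebra_simps)
    qed
    finally show ?thesis by simp
  qed
  \<comment> \<open>The first bound keeps 1 - l h nonnegative; the second makes the term of second
    order in h cost at most l / 2.\<close>
  define h0 where "h0 = min (1 / l) (l / (4 * a))"
  have h0: "h0 > 0" "l * h0 \<le> 1" "4 * a * h0 \<le> l" using l a by (auto simp: h0_def min_def field_simps)
  define C where "C = (2 / l + 2 * h0) * E"
  have C: "C \<ge> 0" using l h0 E by (simp add: C_def)
  have "?N (z + h *\<^sub>R b (z + v)) \<le> (1 - l * h) * ?N z + C * h * (1 + (norm v)\<^sup>2)"
    if h: "0 \<le> h" "h \<le> h0" for h z v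
  proof -
    define e where "e = b (z + v) - A z"
    have be: "b (z + v) = A z + e" by (simp add: e_def)
    have 1: "2 * B z e \<le> l / 2 * ?N z + 2 / l * ?N e" using young[of "l / 2" z e] l by simp
    have 2: "?N (A z + e) \<le> 2 * (a * ?N z) + 2 * ?N e"
    proof -
      have "a * (norm z)\<^sup>2 \<le> a * ?N z" using lo a by (intro mult_left_mono) auto
      then show ?thesis using Nadd[of 1 "A z" e] NA[of z] by simp
    qed
    have "?N (z + h *\<^sub>R b (z + v)) = ?N z + h * (2 * B z (A z)) + h * (2 * B z e) + h * (h * ?N (A z + e))"
      unfolding be expand by (simp add: add' power2_eq_square algebra_simps)
    also have "\<dots> \<le> ?N z + h * (- 2 * l * ?N z) + h * (l / 2 * ?N z + 2 / l * ?N e) + h * (h0 * (2 * (a * ?N z) + 2 * ?N e))"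
    proof (intro add_mono order_refl)
      show "h * (2 * B z (A z)) \<le> h * (- 2 * l * ?N z)" by (rule mult_left_mono[OF diss h(1)])
      show "h * (2 * B z e) \<le> h * (l / 2 * ?N z + 2 / l * ?N e)" by (rule mult_left_mono[OF 1 h(1)])
      show "h * (h * ?N (A z + e)) \<le> h * (h0 * (2 * (a * ?N z) + 2 * ?N e))"
        by (rule mult_left_mono[OF mult_mono[OF h(2) 2 _ N0] h(1)]) (use h0 in simp)
    qed
    also have "\<dots> = ?N z + h * (- 2 * l + l / 2 + 2 * a * h0) * ?N z + h * ((2 / l + 2 * h0) * ?N e)"
      by (simp add: algebra_simps)
    also have "\<dots> \<le> ?N z + h * (- l) * ?N z + h * ((2 / l + 2 * h0) * (E * (1 + (norm v)\<^sup>2)))"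
    proof (intro add_mono order_refl)
      \<comment> \<open>Of the rate 2 l, the product with the error uses l / 2 and the second-order
        term another l / 2; the rate l remains.\<close>
      have "- 2 * l + l / 2 + 2 * a * h0 \<le> - l" using h0(3) by linarith
      then show "h * (- 2 * l + l / 2 + 2 * a * h0) * ?N z \<le> h * (- l) * ?N z"
        by (intro mult_right_mono mult_left_mono h(1) N0)
      have "2 / l + 2 * h0 \<ge> 0" using l h0 by simp
      then show "h * ((2 / l + 2 * h0) * ?N e) \<le> h * ((2 / l + 2 * h0) * (E * (1 + (norm v)\<^sup>2)))"
        unfolding e_def by (intro mult_left_mono Ne h(1))
    qed
    also have "\<dots> = (1 - l * h) * ?N z + C * h * (1 + (norm v)\<^sup>2)"
      by (simp add: C_def add_divide_distrib algebra_simps)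
    finally show ?thesis .
  qed
  then have "\<forall>h z v. 0 \<le> h \<longrightarrow> h \<le> h0 \<longrightarrow>
      B (z + h *\<^sub>R b (z + v)) (z + h *\<^sub>R b (z + v)) \<le> (1 - l * h) * B z z + C * h * (1 + (norm v)\<^sup>2)" by iprover
  with C h0(1,2) show "\<exists>C h0. C \<ge> 0 \<and> h0 > 0 \<and> l * h0 \<le> 1 \<and> (\<forall>h z v. 0 \<le> h \<longrightarrow> h \<le> h0 \<longrightarrow>
      B (z + h *\<^sub>R b (z + v)) (z + h *\<^sub>R b (z + v)) \<le> (1 - l * h) * B z z + C * h * (1 + (norm v)\<^sup>2))" by iprover
qed

section \<open>Harris' theorem\<close>

text \<open>Otherwise the simplifier turns the kernel \<open>Q 1\<close> into \<open>Q (Suc 0)\<close>.\<close>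

declare One_nat_def [simp del]

section \<open>From a bound on events to a bound on integrals\<close>

text \<open>Layer-cake argument: a function with values in the unit interval is nearly an average of
  indicators of its superlevel sets, and an average of errors at most \<eta> is at most
  \<eta>.\<close>

lemma integral_le_of_measure_le:
  assumes "prob_space \<mu>" "prob_space \<nu>" and sets_eq: "sets \<mu> = sets \<nu>"
    and le: "\<And>A. A \<in> sets \<nu> \<Longrightarrow> measure \<mu> A \<le> measure \<nu> A + \<eta>"
    and f[measurable]: "f \<in> borel_measurable \<nu>" and f01: "\<And>x. 0 \<le> f x" "\<And>x. f x \<le> (1::real)"
  shows "(\<integral>x. f x \<partial>\<mu>) \<le> (\<integral>x. f x \<partial>\<nu>) + \<eta>"
proof -
  interpret mu: prob_space \<mu> by fact
  interpret nu: prob_space \<nu> by fact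
  have fm[measurable]: "f \<in> borel_measurable \<mu>"
    using f measurable_cong_sets[OF sets_eq refl] by blast
  have if_mu: "integrable \<mu> f" and if_nu: "integrable \<nu> f"
    using f01 by (auto intro!: mu.integrable_const_bound[where B=1] nu.integrable_const_bound[where B=1])
  have step: "(\<integral>x. f x \<partial>\<mu>) \<le> (\<integral>x. f x \<partial>\<nu>) + 1 / real (Suc m) + \<eta>" for m
  proof -
    define k where "k = Suc m"
    have k0: "k > 0" by (simp add: k_def)
    \<comment> \<open>This is f rounded up to a multiple of 1 / k: the number of j below k with j <
      f k is the ceiling of f k.\<close>
    define g where "g x = (\<Sum>j<k. indicator {x. real j / real k < f x} x) / real k" for x
    have cnt: "(\<Sum>j<k. indicator {x. real j / real k < f x} x) = real (card {j. j < k \<and> real j < f x * real k})" for x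
    proof -
      have "(\<Sum>j<k. indicator {x. real j / real k < f x} x :: real)
          = (\<Sum>j<k. if real j < f x * real k then 1 else 0)"
        using k0 by (intro sum.cong) (auto simp: field_simps)
      also have "\<dots> = real (card ({..<k} \<inter> {j. real j < f x * real k}))"
        by (simp add: sum.If_cases)
      also have "{..<k} \<inter> {j. real j < f x * real k} = {j. j < k \<and> real j < f x * real k}" by auto
      finally show ?thesis .
    qed
    have eqc: "{j. j < k \<and> real j < f x * real k} = {..<nat \<lceil>f x * real k\<rceil>}" for x
    proof -
      have "f x * real k \<le> real k" using f01(2)[of x] k0 by simp
      hence "nat \<lceil>f x * real k\<rceil> \<le> k" by linarith
      moreover have "real j < f x * real k \<longleftrightarrow> j < nat \<lceil>f x * real k\<rceil>" for j by linarith
      ultimately show ?thesis unfolding lessThan_def using order_less_le_trans by blast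
    qed
    have g_eq: "g x = real (nat \<lceil>f x * real k\<rceil>) / real k" for x
      using cnt[of x] by (simp add: g_def eqc)
    have glo: "f x \<le> g x" for x
      using k0 real_nat_ceiling_ge[of "f x * real k"] by (simp add: g_eq le_divide_eq)
    have ghi: "g x \<le> f x + 1 / real k" for x
    proof -
      have "0 \<le> f x * real k" using f01(1)[of x] by simp
      hence "real (nat \<lceil>f x * real k\<rceil>) \<le> f x * real k + 1" by linarith
      thus ?thesis using k0 by (simp add: g_eq field_simps)
    qed
    have A: "{x \<in> space \<nu>. real j / real k < f x} \<in> sets \<nu>" for j by measurable
    have sp: "space \<mu> = space \<nu>" using sets_eq sets_eq_imp_space_eq by blast
    have int: "(\<integral>x. g x \<partial>N) = (\<Sum>j<k. measure N {x \<in> space \<nu>. real j / real k < f x}) / real k" 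
      and intg: "integrable N g"
      if "prob_space N" "sets N = sets \<nu>" for N
    proof -
      interpret N: prob_space N by fact
      have spN: "space N = space \<nu>" using that sets_eq_imp_space_eq by blast
      have *: "integrable N (\<lambda>x. indicator {x \<in> space \<nu>. real j / real k < f x} x :: real)" for j
        using A[of j] that by (intro integrable_real_indicator) (auto simp: N.emeasure_eq_measure)
      have **: "integrable N g \<longleftrightarrow> integrable N (\<lambda>x. (\<Sum>j<k. indicator {x \<in> space \<nu>. real j / real k < f x} x) / real k)"
        "(\<integral>x. g x \<partial>N) = (\<integral>x. (\<Sum>j<k. indicator {x \<in> space \<nu>. real j / real k < f x} x) / real k \<partial>N)"
        unfolding g_def
        by (intro Bochner_Integration.integrable_cong Bochner_Integration.integral_cong refl; 
            auto simp: spN indicator_def)+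
      show "integrable N g" unfolding ** using * by simp
      show "(\<integral>x. g x \<partial>N) = (\<Sum>j<k. measure N {x \<in> space \<nu>. real j / real k < f x}) / real k"
        unfolding ** using * A that by (simp add: Bochner_Integration.integral_sum spN[symmetric])
    qed
    have "(\<integral>x. f x \<partial>\<mu>) \<le> (\<integral>x. g x \<partial>\<mu>)"
      by (intro integral_mono if_mu intg glo) (use sets_eq in \<open>auto intro: mu.prob_space_axioms\<close>)
    also have "\<dots> = (\<Sum>j<k. measure \<mu> {x \<in> space \<nu>. real j / real k < f x}) / real k"
      by (intro int) (use sets_eq in \<open>auto intro: mu.prob_space_axioms\<close>)
    also have "\<dots> \<le> (\<Sum>j<k. measure \<nu> {x \<in> space \<nu>. real j / real k < f x} + \<eta>) / real k"
      by (intro divide_right_mono sum_mono le A) auto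
    also have "\<dots> = (\<integral>x. g x \<partial>\<nu>) + \<eta>"
      using k0 by (subst int) (auto simp: sum.distrib add_divide_distrib intro: nu.prob_space_axioms)
    also have "(\<integral>x. g x \<partial>\<nu>) \<le> (\<integral>x. f x + 1 / real k \<partial>\<nu>)"
      by (intro integral_mono intg ghi) (use if_nu in \<open>auto intro: nu.prob_space_axioms\<close>)
    also have "\<dots> = (\<integral>x. f x \<partial>\<nu>) + 1 / real k" using if_nu by (simp add: nu.prob_space)
    finally show ?thesis by (simp add: k_def)
  qed
  have lim: "(\<lambda>m. (\<integral>x. f x \<partial>\<nu>) + 1 / real (Suc m) + \<eta>) \<longlonglongrightarrow> (\<integral>x. f x \<partial>\<nu>) + 0 + \<eta>"
    using LIMSEQ_inverse_real_of_nat by (intro tendsto_intros) (simp add: inverse_eq_divide)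
  show ?thesis using LIMSEQ_le_const[OF lim] step by auto
qed

text \<open>The map (f + c) / (2 c) brings f into the unit interval; undoing it multiplies the error
  by 2 c.\<close>

lemma integral_diff_le_of_measure_le:
  assumes "prob_space \<mu>" "prob_space \<nu>" and sets_eq: "sets \<mu> = sets \<nu>"
    and le: "\<And>A. A \<in> sets \<nu> \<Longrightarrow> measure \<mu> A \<le> measure \<nu> A + \<eta>"
    and f[measurable]: "f \<in> borel_measurable \<nu>" and fc: "\<And>x. \<bar>f x\<bar> \<le> (c::real)" and c: "c \<ge> 0"
  shows "(\<integral>x. f x \<partial>\<mu>) \<le> (\<integral>x. f x \<partial>\<nu>) + 2 * c * \<eta>"
proof (cases "c = 0")
  case True
  then have "f = (\<lambda>x. 0)" using fc by auto
  with True show ?thesis by simp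
next
  case False
  with c have c: "c > 0" by simp
  interpret mu: prob_space \<mu> by fact
  interpret nu: prob_space \<nu> by fact
  have fm[measurable]: "f \<in> borel_measurable \<mu>"
    using f measurable_cong_sets[OF sets_eq refl] by blast
  have if_mu: "integrable \<mu> f" and if_nu: "integrable \<nu> f"
    using fc by (auto intro!: mu.integrable_const_bound[where B=c] nu.integrable_const_bound[where B=c])
  have "(\<integral>x. (f x + c) / (2 * c) \<partial>\<mu>) \<le> (\<integral>x. (f x + c) / (2 * c) \<partial>\<nu>) + \<eta>"
  proof (rule integral_le_of_measure_le[OF assms(1-3) le])
    show "0 \<le> (f x + c) / (2 * c)" "(f x + c) / (2 * c) \<le> 1" for x
      using fc[of x] c by (auto simp: abs_le_iff field_simps)
  qed auto
  then have "((\<integral>x. f x \<partial>\<mu>) + c) / (2*c) \<le> ((\<integral>x. f x \<partial>\<nu>) + c) / (2*c) + \<eta>"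
    using if_mu if_nu by (simp add: mu.prob_space nu.prob_space)
  also have "\<dots> = ((\<integral>x. f x \<partial>\<nu>) + 2 * c * \<eta> + c) / (2*c)" using c by (simp add: field_simps)
  finally show ?thesis using c by (simp add: divide_le_cancel)
qed


text \<open>The minorization is stated as a total variation bound between two starting points in the
  sublevel set, the form in which the Harnack inequality delivers it, instead of through a common
  lower bound measure. The threshold for R makes the drift contract V x + V y as soon as one point
  leaves that set.\<close>

locale harris =
  fixes Q :: "nat \<Rightarrow> 'a::topological_space \<Rightarrow> 'a measure" and V :: "'a \<Rightarrow> real"
    and \<kappa> K R \<epsilon> :: real
  assumes Q_measurable: "Q n \<in> borel \<rightarrow>\<^sub>M prob_algebra borel"
    and Q_0: "Q 0 x = return borel x"
    and Q_add: "Q (m + n) x = Q m x \<bind> Q n"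
    and V_measurable[measurable]: "V \<in> borel_measurable borel" and V_nonneg: "V x \<ge> 0"
    and \<kappa>: "0 \<le> \<kappa>" "\<kappa> < 1" and K: "K \<ge> 0"
    and drift: "(\<integral>\<^sup>+ y. V y \<partial>Q 1 x) \<le> ennreal (\<kappa> * V x + K)"
    and R: "R > 2 * K / (1 - \<kappa>)"
    and \<epsilon>: "0 < \<epsilon>" "\<epsilon> < 1"
    and minor: "V x \<le> R \<Longrightarrow> V y \<le> R \<Longrightarrow> A \<in> sets borel \<Longrightarrow>
        measure (Q 1 x) A \<le> measure (Q 1 y) A + (1 - \<epsilon>)"
begin

lemma prob_Q: "prob_space (Q n x)" and sets_Q[measurable_cong]: "sets (Q n x) = sets borel"
  and space_Q: "space (Q n x) = UNIV"
  using measurable_space[OF Q_measurable, of x n]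
  by (auto simp: space_prob_algebra dest: sets_eq_imp_space_eq)

lemma Q_subprob[measurable]: "Q n \<in> borel \<rightarrow>\<^sub>M subprob_algebra borel"
  using Q_measurable by (rule measurable_prob_algebraD)

section \<open>Contraction of a weighted oscillation seminorm\<close>

text \<open>The weight is small enough that the additive drift constant K consumes at most half of
  the gain \<epsilon> from the minorization.\<close>

definition \<beta> where "\<beta> = \<epsilon> / (2 * (K + 1))"

lemma \<beta>: "\<beta> > 0" "\<beta> * K \<le> \<epsilon> / 2"
  using \<epsilon> K by (auto simp: \<beta>_def field_simps)

text \<open>The Lipschitz property with constant c for the distance 2 + \<beta> V x + \<beta> V y
  between distinct points, the dual of a weighted total variation distance. It ignores additive
  constants.\<close>

definition osc where "osc \<phi> c \<longleftrightarrow> (\<forall>x y. \<bar>\<phi> x - \<phi> y\<bar> \<le> c * (2 + \<beta> * V x + \<beta> * V y))" for \<phi> :: "'a \<Rightarrow> real"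

text \<open>The entries \<kappa> and 1 - \<epsilon> / 2 serve pairs inside the sublevel set; the
  quotient, together with \<kappa>, serves the other pairs, where V x + V y is at least R.\<close>

definition \<rho> where "\<rho> = max (max \<kappa> (1 - \<epsilon> / 2)) ((2 + 2 * \<beta> * K + \<beta> * \<kappa> * R) / (2 + \<beta> * R))"

lemma R_pos: "R > 0" "2 * K + \<kappa> * R < R"
proof -
  have "2 * K / (1 - \<kappa>) \<ge> 0" using K \<kappa> by simp
  then show "R > 0" using R by simp
  show "2 * K + \<kappa> * R < R" using R \<kappa> by (simp add: field_simps)
qed

lemma \<rho>: "0 < \<rho>" "\<rho> < 1" "\<kappa> \<le> \<rho>" "1 - \<epsilon> / 2 \<le> \<rho>"
    "2 + 2 * \<beta> * K + \<beta> * \<kappa> * R \<le> \<rho> * (2 + \<beta> * R)"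
proof -
  have pos: "2 + \<beta> * R > 0" using \<beta> R_pos by (simp add: add_pos_pos)
  have "\<beta> * (2 * K + \<kappa> * R) < \<beta> * R" using \<beta> R_pos by (intro mult_strict_left_mono) auto
  then have "(2 + 2 * \<beta> * K + \<beta> * \<kappa> * R) / (2 + \<beta> * R) < 1"
    using pos by (simp add: field_simps)
  then show "\<rho> < 1" using \<epsilon> \<kappa> by (simp add: \<rho>_def)
  show r: "1 - \<epsilon> / 2 \<le> \<rho>" "\<kappa> \<le> \<rho>" by (auto simp: \<rho>_def)
  then show "0 < \<rho>" using \<epsilon> by auto
  have "(2 + 2 * \<beta> * K + \<beta> * \<kappa> * R) / (2 + \<beta> * R) \<le> \<rho>" by (simp add: \<rho>_def)
  then show "2 + 2 * \<beta> * K + \<beta> * \<kappa> * R \<le> \<rho> * (2 + \<beta> * R)"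
    using pos by (simp add: pos_divide_le_eq)
qed

lemma integrable_V: "integrable (Q 1 x) V" and integral_V: "(\<integral>y. V y \<partial>Q 1 x) \<le> \<kappa> * V x + K"
proof -
  have nn: "\<kappa> * V x + K \<ge> 0" using \<kappa> K V_nonneg[of x] by simp
  have "(\<integral>\<^sup>+ y. V y \<partial>Q 1 x) < \<infinity>" using drift[of x] by (simp add: le_less_trans)
  then show i: "integrable (Q 1 x) V"
    using V_nonneg by (intro integrableI_nonneg) auto
  show "(\<integral>y. V y \<partial>Q 1 x) \<le> \<kappa> * V x + K"
    using drift[of x] nn nn_integral_eq_integral[OF i] V_nonneg by auto
qed

lemma integrable_bounded:
  assumes "\<phi> \<in> borel_measurable borel" "\<And>y. \<bar>\<phi> y\<bar> \<le> (B::real)"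
  shows "integrable (Q n x) \<phi>"
proof -
  interpret prob_space "Q n x" by (rule prob_Q)
  show ?thesis using assms by (intro integrable_const_bound[where B=B]) auto
qed

lemma integral_Q_add:
  assumes "\<phi> \<in> borel_measurable borel" "\<And>y. \<bar>\<phi> y\<bar> \<le> (B::real)"
  shows "(\<integral>z. \<phi> z \<partial>Q (m + n) x) = (\<integral>y. (\<integral>z. \<phi> z \<partial>Q n y) \<partial>Q m x)"
proof -
  interpret prob_space "Q m x" by (rule prob_Q)
  show ?thesis unfolding Q_add
    using assms by (intro integral_bind[where K=borel and B'=1 and B=B])
      (auto simp: prob_space.emeasure_space_1[OF prob_Q] emeasure_space_1 intro!: measurable_prob_algebraD[OF Q_measurable])
qed

lemma integral_Q_measurable:
  assumes "\<phi> \<in> borel_measurable borel"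
  shows "(\<lambda>x. \<integral>z. \<phi> z \<partial>Q n x :: real) \<in> borel_measurable borel"
  using measurable_compose[OF Q_subprob integral_measurable_subprob_algebra[OF assms]] by simp

lemma integral_Q_bounded:
  assumes "\<phi> \<in> borel_measurable borel" "\<And>y. \<bar>\<phi> y\<bar> \<le> (B::real)"
  shows "\<bar>\<integral>z. \<phi> z \<partial>Q n x\<bar> \<le> B"
proof -
  interpret prob_space "Q n x" by (rule prob_Q)
  have "\<bar>\<integral>z. \<phi> z \<partial>Q n x\<bar> \<le> (\<integral>z. \<bar>\<phi> z\<bar> \<partial>Q n x)" by (rule integral_abs_bound)
  also have "\<dots> \<le> (\<integral>z. B \<partial>Q n x)"
    using assms integrable_bounded[OF assms] by (intro integral_mono) auto
  finally show ?thesis by (simp add: prob_space)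
qed

text \<open>The oscillation bound says that every value of \<phi> - w is below every value of \<phi>
  + w, so the supremum of the former is a centre m.\<close>

lemma osc_center:
  assumes o: "osc \<phi> c" and c: "c \<ge> 0"
  shows "\<exists>m. \<forall>x. \<bar>\<phi> x - m\<bar> \<le> c * (1 + \<beta> * V x)"
proof -
  let ?w = "\<lambda>x. c * (1 + \<beta> * V x)"
  have le: "\<phi> x - ?w x \<le> \<phi> y + ?w y" for x y
    using o unfolding osc_def by (auto simp: algebra_simps abs_le_iff dest!: spec[of _ x] spec[of _ y])
  define m where "m = (SUP x. \<phi> x - ?w x)"
  have bdd: "bdd_above (range (\<lambda>x. \<phi> x - ?w x))" using le by (auto intro!: bdd_aboveI2)
  have "\<phi> x - ?w x \<le> m" for x unfolding m_def by (intro cSUP_upper bdd) auto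
  moreover have "m \<le> \<phi> y + ?w y" for y unfolding m_def by (intro cSUP_least le) auto
  ultimately have "\<bar>\<phi> x - m\<bar> \<le> ?w x" for x by (simp add: abs_le_iff algebra_simps)
  then show ?thesis by blast
qed

text \<open>Far pairs are contracted by the drift alone. For pairs in the sublevel set the centred
  function is cut into a bounded part, contracted by the minorization, and a part controlled by V,
  contracted by the drift.\<close>

lemma contraction1:
  assumes [measurable]: "\<phi> \<in> borel_measurable borel" and B: "\<And>y. \<bar>\<phi> y\<bar> \<le> (B::real)"
    and o: "osc \<phi> c" and c: "c \<ge> 0"
  shows "(\<integral>z. \<phi> z \<partial>Q 1 x) - (\<integral>z. \<phi> z \<partial>Q 1 y) \<le> \<rho> * c * (2 + \<beta> * V x + \<beta> * V y)"
proof -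
  interpret x: prob_space "Q 1 x" by (rule prob_Q)
  interpret y: prob_space "Q 1 y" by (rule prob_Q)
  from osc_center[OF o c] obtain m where m: "\<And>x. \<bar>\<phi> x - m\<bar> \<le> c * (1 + \<beta> * V x)" by blast
  note i = integrable_bounded[OF assms(1) B]
  have sx: "sets (Q 1 x) = sets (Q 1 y)" by (simp add: sets_Q)
  show ?thesis
  proof (cases "V x \<le> R \<and> V y \<le> R")
    case False
    then have S: "R \<le> V x + V y" using V_nonneg[of x] V_nonneg[of y] by auto
    have bound: "\<bar>(\<integral>z. \<phi> z \<partial>Q 1 u) - m\<bar> \<le> c * (1 + \<beta> * (\<kappa> * V u + K))" for u
    proof -
      interpret prob_space "Q 1 u" by (rule prob_Q)
      have "\<bar>(\<integral>z. \<phi> z \<partial>Q 1 u) - m\<bar> = \<bar>\<integral>z. \<phi> z - m \<partial>Q 1 u\<bar>" using i by (simp add: prob_space)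
      also have "\<dots> \<le> (\<integral>z. \<bar>\<phi> z - m\<bar> \<partial>Q 1 u)" by (rule integral_abs_bound)
      also have "\<dots> \<le> (\<integral>z. c * (1 + \<beta> * V z) \<partial>Q 1 u)"
        using i integrable_V m by (intro integral_mono) auto
      also have "\<dots> = c * (1 + \<beta> * (\<integral>z. V z \<partial>Q 1 u))" using integrable_V by (simp add: prob_space)
      also have "\<dots> \<le> c * (1 + \<beta> * (\<kappa> * V u + K))"
        using c \<beta> integral_V by (intro mult_left_mono add_left_mono) auto
      finally show ?thesis .
    qed
    \<comment> \<open>The constant \<rho> was made for V x + V y = R; the excess over R is
      multiplied by \<kappa>, which is at most \<rho>.\<close>
    have "(2 + 2 * \<beta> * K + \<beta> * \<kappa> * R) + \<beta> * \<kappa> * (V x + V y - R)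
        \<le> \<rho> * (2 + \<beta> * R) + \<beta> * \<rho> * (V x + V y - R)"
      using \<rho> \<beta> S by (intro add_mono mult_right_mono mult_left_mono) auto
    then have "2 + 2 * \<beta> * K + \<beta> * \<kappa> * (V x + V y) \<le> \<rho> * (2 + \<beta> * V x + \<beta> * V y)"
      by (simp add: algebra_simps)
    then have "c * (2 + 2 * \<beta> * K + \<beta> * \<kappa> * (V x + V y)) \<le> c * (\<rho> * (2 + \<beta> * V x + \<beta> * V y))"
      using c by (intro mult_left_mono)
    with bound[of x] bound[of y] show ?thesis by (auto simp: abs_le_iff algebra_simps)
  next
    case True
    \<comment> \<open>Truncation at the level c: the centred function is at most c (1 + \<beta> V),
      so whatever is cut off is at most c \<beta> V.\<close>
    define f1 where "f1 z = max (- c) (min c (\<phi> z - m))" for z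
    define f2 where "f2 z = \<phi> z - m - f1 z" for z
    have [measurable]: "f1 \<in> borel_measurable borel" "f2 \<in> borel_measurable borel"
      unfolding f1_def[abs_def] f2_def[abs_def] by measurable
    have f1: "\<bar>f1 z\<bar> \<le> c" for z using c by (auto simp: f1_def)
    have f2: "\<bar>f2 z\<bar> \<le> c * \<beta> * V z" for z
    proof -
      have "c * \<beta> * V z \<ge> 0" using c \<beta> V_nonneg[of z] by simp
      then show ?thesis using m[of z] c unfolding f1_def f2_def by (auto simp: algebra_simps)
    qed
    have i1: "integrable (Q 1 u) f1" for u using f1 by (intro integrable_bounded) auto
    have i2: "integrable (Q 1 u) f2" for u unfolding f2_def using i i1 
      by (intro Bochner_Integration.integrable_diff finite_measure.integrable_const)
         (auto simp: prob_space.finite_measure prob_Q)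
    have split: "(\<integral>z. \<phi> z \<partial>Q 1 u) = m + (\<integral>z. f1 z \<partial>Q 1 u) + (\<integral>z. f2 z \<partial>Q 1 u)" for u
    proof -
      interpret prob_space "Q 1 u" by (rule prob_Q)
      have "(\<integral>z. \<phi> z \<partial>Q 1 u) = (\<integral>z. (m + f1 z) + f2 z \<partial>Q 1 u)" by (simp add: f2_def)
      then show ?thesis using i1 i2 by (simp add: prob_space)
    qed
    have b2: "\<bar>\<integral>z. f2 z \<partial>Q 1 u\<bar> \<le> c * \<beta> * (\<kappa> * V u + K)" for u
    proof -
      have "\<bar>\<integral>z. f2 z \<partial>Q 1 u\<bar> \<le> (\<integral>z. \<bar>f2 z\<bar> \<partial>Q 1 u)" by (rule integral_abs_bound)
      also have "\<dots> \<le> (\<integral>z. c * \<beta> * V z \<partial>Q 1 u)"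
        using i2 integrable_V f2 by (intro integral_mono) auto
      also have "\<dots> = c * \<beta> * (\<integral>z. V z \<partial>Q 1 u)" by simp
      also have "\<dots> \<le> c * \<beta> * (\<kappa> * V u + K)" using c \<beta> integral_V by (intro mult_left_mono) auto
      finally show ?thesis .
    qed
    have b1: "(\<integral>z. f1 z \<partial>Q 1 x) \<le> (\<integral>z. f1 z \<partial>Q 1 y) + 2 * c * (1 - \<epsilon>)"
      using True f1 c minor[of x y]
      by (intro integral_diff_le_of_measure_le) (auto simp: x.prob_space_axioms y.prob_space_axioms sets_Q)
    have "(\<integral>z. \<phi> z \<partial>Q 1 x) - (\<integral>z. \<phi> z \<partial>Q 1 y) \<le> c * (2 * (1 - \<epsilon>) + 2 * (\<beta> * K) + \<beta> * \<kappa> * (V x + V y))"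
      using split[of x] split[of y] b1 b2[of x] b2[of y] by (simp add: abs_le_iff algebra_simps)
    also have "\<dots> \<le> c * (2 * \<rho> + \<beta> * \<rho> * (V x + V y))"
    proof (rule mult_left_mono)
      show "2 * (1 - \<epsilon>) + 2 * (\<beta> * K) + \<beta> * \<kappa> * (V x + V y) \<le> 2 * \<rho> + \<beta> * \<rho> * (V x + V y)"
      proof (rule add_mono)
        have "2 * (\<beta> * K) \<le> \<epsilon>" using \<beta>(2) by linarith
        moreover have "2 - \<epsilon> \<le> 2 * \<rho>" using \<rho>(4) by linarith
        ultimately show "2 * (1 - \<epsilon>) + 2 * (\<beta> * K) \<le> 2 * \<rho>" by (simp add: algebra_simps)
        show "\<beta> * \<kappa> * (V x + V y) \<le> \<beta> * \<rho> * (V x + V y)"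
          using \<beta> \<rho> V_nonneg by (intro mult_right_mono mult_left_mono) auto
      qed
    qed (use c in auto)
    finally show ?thesis by (simp add: algebra_simps)
  qed
qed

text \<open>The one-step bound is applied to the averaged function under \<open>Q n\<close>, which
  is again bounded and measurable, with the constant gained so far.\<close>

lemma contraction:
  assumes [measurable]: "\<phi> \<in> borel_measurable borel" and B: "\<And>y. \<bar>\<phi> y\<bar> \<le> (B::real)"
    and o: "osc \<phi> c" and c: "c \<ge> 0"
  shows "osc (\<lambda>x. \<integral>z. \<phi> z \<partial>Q n x) (\<rho> ^ n * c)"
proof (induction n)
  case 0
  have "(\<integral>z. \<phi> z \<partial>Q 0 x) = \<phi> x" for x unfolding Q_0 by (rule integral_return) auto
  with o show ?case by simp
next
  case (Suc n)
  have "osc (\<lambda>x. \<integral>y. (\<integral>z. \<phi> z \<partial>Q n y) \<partial>Q 1 x) (\<rho> * (\<rho> ^ n * c))"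
    unfolding osc_def
  proof (intro allI)
    fix x y
    note * = contraction1[OF integral_Q_measurable[OF assms(1)] integral_Q_bounded[OF assms(1) B] Suc]
    have "\<rho> ^ n * c \<ge> 0" using \<rho> c by simp
    from *[OF this, of x y] *[OF this, of y x]
    show "\<bar>(\<integral>y. (\<integral>z. \<phi> z \<partial>Q n y) \<partial>Q 1 x) - (\<integral>y. (\<integral>z. \<phi> z \<partial>Q n y) \<partial>Q 1 y)\<bar>
      \<le> \<rho> * (\<rho> ^ n * c) * (2 + \<beta> * V x + \<beta> * V y)"
      by (simp add: abs_le_iff algebra_simps)
  qed
  then show ?case using integral_Q_add[OF assms(1) B, of 1 n] by (simp add: mult.assoc Suc_eq_plus1_left power_add del: plus_1_eq_Suc)
qed


section \<open>Moments along the chain and the Cauchy property\<close>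

text \<open>The fixed point of the affine recursion K' = \<kappa> K' + K satisfied by the moments of
  V.\<close>

definition K' where "K' = K / (1 - \<kappa>)"

lemma K': "K' \<ge> 0" "\<kappa> * K' + K = K'"
  using \<kappa> K by (auto simp: K'_def field_simps)

lemma nn_integral_V_Q: "(\<integral>\<^sup>+ y. V y \<partial>Q n x) \<le> ennreal (\<kappa> ^ n * V x + K')"
proof (induction n)
  case 0
  show ?case unfolding Q_0 using K' by (subst nn_integral_return) (auto intro!: ennreal_leI)
next
  case (Suc n)
  interpret prob_space "Q n x" by (rule prob_Q)
  have "(\<integral>\<^sup>+ y. V y \<partial>Q (n + 1) x) = (\<integral>\<^sup>+ y. (\<integral>\<^sup>+ z. V z \<partial>Q 1 y) \<partial>Q n x)"
    unfolding Q_add by (rule nn_integral_bind[where B=borel]) auto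
  also have "\<dots> \<le> (\<integral>\<^sup>+ y. ennreal \<kappa> * ennreal (V y) + ennreal K \<partial>Q n x)"
    using drift \<kappa> K V_nonneg
    by (intro nn_integral_mono) (simp add: ennreal_mult[symmetric] ennreal_plus[symmetric] del: ennreal_plus)
  also have "\<dots> = ennreal \<kappa> * (\<integral>\<^sup>+ y. V y \<partial>Q n x) + ennreal K"
    by (subst nn_integral_add) (auto simp: nn_integral_cmult emeasure_space_1)
  also have "\<dots> \<le> ennreal \<kappa> * ennreal (\<kappa> ^ n * V x + K') + ennreal K"
    by (intro add_right_mono mult_left_mono Suc) auto
  also have "\<dots> = ennreal (\<kappa> * (\<kappa> ^ n * V x + K') + K)"
    using \<kappa> K K' V_nonneg by (simp add: ennreal_mult[symmetric] ennreal_plus[symmetric] del: ennreal_plus)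
  also have "\<kappa> * (\<kappa> ^ n * V x + K') + K = \<kappa> ^ (Suc n) * V x + K'"
    using K'(2) by (simp add: algebra_simps)
  finally show ?case by (simp only: Suc_eq_plus1)
qed

lemma integrable_V_Q: "integrable (Q n x) V" and integral_V_Q: "(\<integral>y. V y \<partial>Q n x) \<le> V x + K'"
proof -
  have nn: "\<kappa> ^ n * V x + K' \<ge> 0" using \<kappa> K' V_nonneg[of x] by simp
  have "(\<integral>\<^sup>+ y. V y \<partial>Q n x) < \<infinity>" using nn_integral_V_Q[of n x] by (simp add: le_less_trans)
  then show i: "integrable (Q n x) V"
    using V_nonneg by (intro integrableI_nonneg) auto
  have "(\<integral>y. V y \<partial>Q n x) \<le> \<kappa> ^ n * V x + K'"
    using nn_integral_V_Q[of n x] nn nn_integral_eq_integral[OF i] V_nonneg by auto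
  moreover have "\<kappa> ^ n * V x \<le> 1 * V x"
    using \<kappa> V_nonneg by (intro mult_right_mono power_le_one) auto
  ultimately show "(\<integral>y. V y \<partial>Q n x) \<le> V x + K'" by simp
qed

definition C0 where "C0 = 2 + 2 * \<beta> + \<beta> * K'"

lemma C0: "C0 > 0" "2 + \<beta> * V x + \<beta> * (V x + K') \<le> C0 * (1 + V x)"
proof -
  have "\<beta> * K' \<ge> 0" using \<beta> K' by simp
  then show "C0 > 0" using \<beta> by (simp add: C0_def)
  have "\<beta> * K' * V x \<ge> 0" using \<beta> K' V_nonneg by simp
  then show "2 + \<beta> * V x + \<beta> * (V x + K') \<le> C0 * (1 + V x)"
    using \<beta> V_nonneg[of x] by (simp add: C0_def algebra_simps)
qed

text \<open>By the semigroup property the difference is the mean, under \<open>Q m x\<close>, of the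
  oscillation of the function averaged by \<open>Q n\<close>. The oscillation decays in n, and the
  moments of V are bounded uniformly in m.\<close>

lemma cauchy_bound:
  assumes [measurable]: "\<phi> \<in> borel_measurable borel" and B: "\<And>y. \<bar>\<phi> y\<bar> \<le> (B::real)"
    and o: "osc \<phi> c" and c: "c \<ge> 0"
  shows "\<bar>(\<integral>z. \<phi> z \<partial>Q (m + n) x) - (\<integral>z. \<phi> z \<partial>Q n x)\<bar> \<le> \<rho> ^ n * (c * C0 * (1 + V x))"
proof -
  interpret prob_space "Q m x" by (rule prob_Q)
  let ?a = "\<lambda>y. \<integral>z. \<phi> z \<partial>Q n y"
  have ia: "integrable (Q m x) ?a"
    by (rule integrable_bounded[OF integral_Q_measurable integral_Q_bounded[OF _ B]]) auto
  have "\<bar>(\<integral>z. \<phi> z \<partial>Q (m + n) x) - ?a x\<bar> = \<bar>\<integral>y. ?a y - ?a x \<partial>Q m x\<bar>"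
    using ia by (simp add: integral_Q_add[OF assms(1) B] prob_space)
  also have "\<dots> \<le> (\<integral>y. \<bar>?a y - ?a x\<bar> \<partial>Q m x)" by (rule integral_abs_bound)
  also have "\<dots> \<le> (\<integral>y. \<rho> ^ n * c * (2 + \<beta> * V y + \<beta> * V x) \<partial>Q m x)"
    using ia integrable_V_Q contraction[OF assms(1) B o c, of n]
    by (intro integral_mono) (auto simp: osc_def)
  also have "\<dots> = \<rho> ^ n * c * (2 + \<beta> * (\<integral>y. V y \<partial>Q m x) + \<beta> * V x)"
    using integrable_V_Q by (simp add: prob_space)
  also have "\<dots> \<le> \<rho> ^ n * c * (C0 * (1 + V x))"
  proof (intro mult_left_mono)
    have "\<beta> * (\<integral>y. V y \<partial>Q m x) \<le> \<beta> * (V x + K')"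
      using \<beta> integral_V_Q by (intro mult_left_mono) auto
    then show "2 + \<beta> * (\<integral>y. V y \<partial>Q m x) + \<beta> * V x \<le> C0 * (1 + V x)" using C0(2)[of x] by simp
  qed (use \<rho> c in auto)
  finally show ?thesis by (simp add: mult.assoc Suc_eq_plus1_left)
qed

end

lemma geometric_cauchy_limit:
  fixes a :: "nat \<Rightarrow> real"
  assumes "0 \<le> r" "r < 1" and a: "\<And>m n. \<bar>a (m + n) - a n\<bar> \<le> r ^ n * D"
  obtains l where "a \<longlonglongrightarrow> l" "\<And>n. \<bar>a n - l\<bar> \<le> r ^ n * D"
proof -
  have lim0: "(\<lambda>n. r ^ n * D) \<longlonglongrightarrow> 0"
    using assms by (auto intro!: tendsto_mult_left_zero LIMSEQ_realpow_zero)
  have "Cauchy a"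
  proof (rule CauchyI')
    fix e :: real assume "e > 0"
    then have "eventually (\<lambda>n. r ^ n * D < e) sequentially"
      using order_tendstoD(2)[OF lim0] by auto
    then obtain N where N: "\<And>n. n \<ge> N \<Longrightarrow> r ^ n * D < e" by (auto simp: eventually_sequentially)
    have "dist (a m) (a n) < e" if "m \<ge> N" "n > m" for m n
      using a[of "n - m" m] N[of m] that by (simp add: dist_real_def abs_minus_commute)
    then show "\<exists>M. \<forall>m\<ge>M. \<forall>n>m. dist (a m) (a n) < e" by auto
  qed
  then obtain l where l: "a \<longlonglongrightarrow> l" by (auto simp: Cauchy_convergent_iff convergent_def)
  have "\<bar>a n - l\<bar> \<le> r ^ n * D" for n
  proof -
    have "(\<lambda>m. \<bar>a (m + n) - a n\<bar>) \<longlonglongrightarrow> \<bar>l - a n\<bar>"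
      by (intro tendsto_intros LIMSEQ_ignore_initial_segment l)
    from LIMSEQ_le_const2[OF this] a show ?thesis by (auto simp: abs_minus_commute)
  qed
  with l that show ?thesis by blast
qed

context harris
begin

section \<open>The limiting probability measure\<close>

text \<open>An arbitrary base point; \<open>integral_\<mu>_bound\<close> shows that every other
  start leads to the same limit.\<close>

definition x0 :: 'a where "x0 = undefined"

definition l where "l A = lim (\<lambda>n. measure (Q n x0) A)"

lemma l_bound:
  assumes [measurable]: "A \<in> sets borel"
  shows "(\<lambda>n. measure (Q n x0) A) \<longlonglongrightarrow> l A" "\<bar>measure (Q n x0) A - l A\<bar> \<le> \<rho> ^ n * (C0 * (1 + V x0))"
proof -
  have meas: "(\<integral>z. indicator A z \<partial>Q n x) = measure (Q n x) A" for n x by (simp add: space_Q)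
  have "osc (indicator A) 1" unfolding osc_def
  proof (intro allI)
    fix x y
    have "\<beta> * V x \<ge> 0" "\<beta> * V y \<ge> 0" using \<beta> V_nonneg by auto
    then show "\<bar>indicator A x - indicator A y\<bar> \<le> 1 * (2 + \<beta> * V x + \<beta> * V y)"
      by (auto simp: indicator_def)
  qed
  then have b: "\<bar>measure (Q (m + n) x0) A - measure (Q n x0) A\<bar> \<le> \<rho> ^ n * (C0 * (1 + V x0))" for m n
    using cauchy_bound[of "indicator A" 1 1 m n x0] by (simp add: meas)
  from geometric_cauchy_limit[of \<rho> "\<lambda>n. measure (Q n x0) A", OF _ _ b] \<rho>
  obtain l' where l': "(\<lambda>n. measure (Q n x0) A) \<longlonglongrightarrow> l'"
    "\<And>n. \<bar>measure (Q n x0) A - l'\<bar> \<le> \<rho> ^ n * (C0 * (1 + V x0))" by auto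
  then have "l A = l'" by (simp add: l_def limI)
  with l' show "(\<lambda>n. measure (Q n x0) A) \<longlonglongrightarrow> l A"
    "\<bar>measure (Q n x0) A - l A\<bar> \<le> \<rho> ^ n * (C0 * (1 + V x0))" by auto
qed

lemma l_nonneg: "A \<in> sets borel \<Longrightarrow> l A \<ge> 0"
  using LIMSEQ_le_const[OF l_bound(1), of A 0] by auto

lemma l_Un:
  assumes "A \<in> sets borel" "B \<in> sets borel" "A \<inter> B = {}"
  shows "l (A \<union> B) = l A + l B"
proof -
  have "measure (Q n x0) (A \<union> B) = measure (Q n x0) A + measure (Q n x0) B" for n
  proof -
    interpret prob_space "Q n x0" by (rule prob_Q)
    show ?thesis using assms by (intro finite_measure_Union) (auto simp: sets_Q)
  qed
  then have "(\<lambda>n. measure (Q n x0) (A \<union> B)) \<longlonglongrightarrow> l A + l B"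
    using assms by (auto intro!: tendsto_add l_bound)
  with l_bound(1)[of "A \<union> B"] assms show ?thesis by (auto intro: LIMSEQ_unique)
qed

text \<open>The convergence to \<open>l\<close> is uniform over all Borel sets. So for a sequence
  decreasing to the empty set one can fix n first and then use continuity of the single measure
  \<open>Q n x0\<close>.\<close>

lemma l_countably_additive: "countably_additive (sets (borel :: 'a measure)) (\<lambda>A. ennreal (l A))"
proof (rule sets.empty_continuous_imp_countably_additive)
  have "l {} = 0" using l_Un[of "{}" "{}"] by simp
  then show "positive (sets borel) (\<lambda>A. ennreal (l A))" by (simp add: positive_def)
  show "additive (sets borel) (\<lambda>A. ennreal (l A))"
    by (auto simp: additive_def l_Un ennreal_plus l_nonneg)
next
  fix A :: "nat \<Rightarrow> 'a set"
  assume A: "range A \<subseteq> sets borel" "decseq A" "(\<Inter>i. A i) = {}"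
  then have Am: "A i \<in> sets borel" for i by auto
  have "(\<lambda>i. l (A i)) \<longlonglongrightarrow> 0"
  proof (rule LIMSEQ_I)
    fix e :: real assume e: "e > 0"
    have "(\<lambda>n. \<rho> ^ n * (C0 * (1 + V x0))) \<longlonglongrightarrow> 0"
      using \<rho> by (auto intro!: tendsto_mult_left_zero LIMSEQ_realpow_zero)
    from order_tendstoD(2)[OF this, of "e/2"] e
    obtain n where n: "\<rho> ^ n * (C0 * (1 + V x0)) < e / 2" by (auto simp: eventually_sequentially)
    interpret prob_space "Q n x0" by (rule prob_Q)
    have "(\<lambda>i. measure (Q n x0) (A i)) \<longlonglongrightarrow> measure (Q n x0) (\<Inter>i. A i)"
      using A by (intro finite_Lim_measure_decseq) (auto simp: sets_Q)
    then have "(\<lambda>i. measure (Q n x0) (A i)) \<longlonglongrightarrow> 0" using A by simp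
    from order_tendstoD(2)[OF this, of "e/2"] e
    obtain N where N: "\<And>i. i \<ge> N \<Longrightarrow> measure (Q n x0) (A i) < e / 2" by (auto simp: eventually_sequentially)
    have "norm (l (A i) - 0) < e" if "i \<ge> N" for i
      using N[OF that] n l_bound(2)[OF Am, of n i] l_nonneg[OF Am[of i]] by (auto simp: abs_le_iff)
    then show "\<exists>N. \<forall>i\<ge>N. norm (l (A i) - 0) < e" by blast
  qed
  then have "(\<lambda>i. ennreal (l (A i))) \<longlonglongrightarrow> ennreal 0" by (intro tendsto_ennrealI)
  then show "(\<lambda>i. ennreal (l (A i))) \<longlonglongrightarrow> 0" by simp
qed auto

definition \<mu> where "\<mu> = measure_of UNIV (sets borel) (\<lambda>A. ennreal (l A))"

lemma sets_\<mu>[simp, measurable_cong]: "sets \<mu> = sets borel"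
  unfolding \<mu>_def using sets.sigma_sets_eq[of borel] by (subst sets_measure_of) auto

lemma emeasure_\<mu>: "A \<in> sets borel \<Longrightarrow> emeasure \<mu> A = ennreal (l A)"
proof -
  have "l {} = 0" using l_Un[of "{}" "{}"] by simp
  moreover assume "A \<in> sets borel"
  ultimately show ?thesis
    using l_countably_additive
    by (intro emeasure_measure_of[OF \<mu>_def]) (auto simp: positive_def)
qed

lemma measure_\<mu>: "A \<in> sets borel \<Longrightarrow> measure \<mu> A = l A"
  by (simp add: measure_def emeasure_\<mu> l_nonneg)

lemma prob_\<mu>: "prob_space \<mu>"
proof
  have sp: "space \<mu> = UNIV" using sets_eq_imp_space_eq[OF sets_\<mu>] by simp
  have "measure (Q n x0) UNIV = 1" for n
    using prob_space.prob_space[OF prob_Q, of n x0] by (simp add: space_Q)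
  then have "l UNIV = 1" using l_bound(1)[of UNIV] by (simp add: LIMSEQ_const_iff)
  then show "emeasure \<mu> (space \<mu>) = 1" by (simp add: sp emeasure_\<mu>)
qed

lemma integral_\<mu>_diff:
  assumes [measurable]: "\<phi> \<in> borel_measurable borel" and B: "\<And>y. \<bar>\<phi> y\<bar> \<le> (B::real)" and "B \<ge> 0"
  shows "\<bar>(\<integral>z. \<phi> z \<partial>Q n x0) - (\<integral>z. \<phi> z \<partial>\<mu>)\<bar> \<le> 2 * B * (\<rho> ^ n * (C0 * (1 + V x0)))"
proof -
  let ?e = "\<rho> ^ n * (C0 * (1 + V x0))"
  have "(\<integral>z. \<phi> z \<partial>Q n x0) \<le> (\<integral>z. \<phi> z \<partial>\<mu>) + 2 * B * ?e"
  proof (rule integral_diff_le_of_measure_le[OF prob_Q prob_\<mu>])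
    show "measure (Q n x0) A \<le> measure \<mu> A + ?e" if "A \<in> sets \<mu>" for A
      using l_bound(2)[of A n] that measure_\<mu>[of A] by (simp add: abs_le_iff)
  qed (use assms in \<open>auto simp: sets_Q\<close>)
  moreover have "(\<integral>z. \<phi> z \<partial>\<mu>) \<le> (\<integral>z. \<phi> z \<partial>Q n x0) + 2 * B * ?e"
  proof (rule integral_diff_le_of_measure_le[OF prob_\<mu> prob_Q])
    show "measure \<mu> A \<le> measure (Q n x0) A + ?e" if "A \<in> sets (Q n x0)" for A
      using l_bound(2)[of A n] that measure_\<mu>[of A] by (simp add: abs_le_iff sets_Q)
  qed (use assms in \<open>auto simp: sets_Q\<close>)
  ultimately show ?thesis by (simp add: abs_le_iff)
qed

lemma integral_\<mu>_lim:
  assumes [measurable]: "\<phi> \<in> borel_measurable borel" and B: "\<And>y. \<bar>\<phi> y\<bar> \<le> (B::real)"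
  shows "(\<lambda>n. \<integral>z. \<phi> z \<partial>Q n x0) \<longlonglongrightarrow> (\<integral>z. \<phi> z \<partial>\<mu>)"
proof -
  have "B \<ge> 0" using B[of x0] by linarith
  have "(\<lambda>n. 2 * B * (\<rho> ^ n * (C0 * (1 + V x0)))) \<longlonglongrightarrow> 0"
    using \<rho> by (intro tendsto_mult_right_zero tendsto_mult_left_zero LIMSEQ_realpow_zero) auto
  then have "(\<lambda>n. (\<integral>z. \<phi> z \<partial>Q n x0) - (\<integral>z. \<phi> z \<partial>\<mu>)) \<longlonglongrightarrow> 0"
    by (rule Lim_null_comparison[rotated])
       (use integral_\<mu>_diff[OF assms \<open>B \<ge> 0\<close>] in auto)
  then show ?thesis by (simp add: LIM_zero_iff)
qed

text \<open>The contraction makes the integrals from x and from \<open>x0\<close> merge, so both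
  tend to the integral under the limit measure. The rate results from letting m tend to infinity in
  \<open>cauchy_bound\<close>.\<close>

lemma integral_\<mu>_bound:
  assumes [measurable]: "\<phi> \<in> borel_measurable borel" and B: "\<And>y. \<bar>\<phi> y\<bar> \<le> (B::real)"
    and o: "osc \<phi> c" and c: "c \<ge> 0"
  shows "\<bar>(\<integral>z. \<phi> z \<partial>Q n x) - (\<integral>z. \<phi> z \<partial>\<mu>)\<bar> \<le> \<rho> ^ n * (c * C0 * (1 + V x))"
proof -
  have "(\<lambda>m. \<rho> ^ m * c * (2 + \<beta> * V x + \<beta> * V x0)) \<longlonglongrightarrow> 0"
    using \<rho> by (intro tendsto_mult_left_zero LIMSEQ_realpow_zero) auto
  then have "(\<lambda>m. (\<integral>z. \<phi> z \<partial>Q m x) - (\<integral>z. \<phi> z \<partial>Q m x0)) \<longlonglongrightarrow> 0"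
    by (rule Lim_null_comparison[rotated])
      (use contraction[OF assms] in \<open>auto simp: osc_def\<close>)
  from tendsto_add[OF this integral_\<mu>_lim[OF assms(1) B]]
  have "(\<lambda>m. \<integral>z. \<phi> z \<partial>Q m x) \<longlonglongrightarrow> (\<integral>z. \<phi> z \<partial>\<mu>)" by simp
  then have "(\<lambda>m. \<integral>z. \<phi> z \<partial>Q (m + n) x) \<longlonglongrightarrow> (\<integral>z. \<phi> z \<partial>\<mu>)"
    by (rule LIMSEQ_ignore_initial_segment)
  then have "(\<lambda>m. \<bar>(\<integral>z. \<phi> z \<partial>Q (m + n) x) - (\<integral>z. \<phi> z \<partial>Q n x)\<bar>)
      \<longlonglongrightarrow> \<bar>(\<integral>z. \<phi> z \<partial>\<mu>) - (\<integral>z. \<phi> z \<partial>Q n x)\<bar>"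
    by (intro tendsto_intros)
  from LIMSEQ_le_const2[OF this] cauchy_bound[OF assms] show ?thesis
    by (auto simp: abs_minus_commute)
qed

text \<open>V is unbounded, so the convergence is applied to its truncations, whose integrals are
  bounded by the uniform moment bound; monotone convergence removes the truncation.\<close>

lemma integrable_\<mu>_V: "integrable \<mu> V"
proof -
  interpret prob_space \<mu> by (rule prob_\<mu>)
  have le: "(\<integral>z. min (V z) (real N) \<partial>\<mu>) \<le> V x0 + K'" for N
  proof -
    have "(\<lambda>n. \<integral>z. min (V z) (real N) \<partial>Q n x0) \<longlonglongrightarrow> (\<integral>z. min (V z) (real N) \<partial>\<mu>)"
      using V_nonneg by (intro integral_\<mu>_lim[where B="real N"]) (auto simp: abs_le_iff min_def intro: order_trans)
    moreover have "(\<integral>z. min (V z) (real N) \<partial>Q n x0) \<le> V x0 + K'" for n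
    proof -
      have "(\<integral>z. min (V z) (real N) \<partial>Q n x0) \<le> (\<integral>z. V z \<partial>Q n x0)"
        using V_nonneg integrable_V_Q
        by (intro integral_mono Bochner_Integration.integrable_bound[OF integrable_V_Q]) (auto simp: min_def)
      then show ?thesis using integral_V_Q[of n x0] by linarith
    qed
    ultimately show ?thesis by (auto intro: LIMSEQ_le_const2)
  qed
  have int: "integrable \<mu> (\<lambda>z. min (V z) (real N))" for N
    using V_nonneg by (intro integrable_const_bound[where B="real N"]) (auto simp: abs_le_iff min_def intro: order_trans)
  have "(\<integral>\<^sup>+z. V z \<partial>\<mu>) = (\<integral>\<^sup>+z. (SUP N. ennreal (min (V z) (real N))) \<partial>\<mu>)"
  proof (intro nn_integral_cong antisym)
    fix z
    obtain N where "V z \<le> real N" using real_arch_simple by blast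
    then show "ennreal (V z) \<le> (SUP N. ennreal (min (V z) (real N)))"
      by (intro SUP_upper2[of N]) auto
    show "(SUP N. ennreal (min (V z) (real N))) \<le> ennreal (V z)"
      by (intro SUP_least ennreal_leI) auto
  qed
  also have "\<dots> = (SUP N. \<integral>\<^sup>+z. ennreal (min (V z) (real N)) \<partial>\<mu>)"
    by (intro nn_integral_monotone_convergence_SUP)
       (auto simp: incseq_def le_fun_def intro!: ennreal_leI)
  also have "\<dots> \<le> ennreal (V x0 + K')"
    using le int V_nonneg by (intro SUP_least) (auto simp: nn_integral_eq_integral intro!: ennreal_leI)
  finally have "(\<integral>\<^sup>+z. V z \<partial>\<mu>) < \<infinity>" by (simp add: le_less_trans)
  then show ?thesis using V_nonneg by (intro integrableI_nonneg) auto
qed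

text \<open>The bound B enters only as a hypothesis and C does not depend on it, which later allows
  truncation of unbounded functions. The factor b in the proof trades the weight 1 + \<beta> V for 1
  + V.\<close>

theorem harris_bounded:
  "\<exists>C > 0. \<forall>n \<phi> B m c x. \<phi> \<in> borel_measurable borel \<longrightarrow> (\<forall>y. \<bar>\<phi> y\<bar> \<le> B) \<longrightarrow>
     c \<ge> 0 \<longrightarrow> (\<forall>y. \<bar>\<phi> y - m\<bar> \<le> c * (1 + V y)) \<longrightarrow>
     \<bar>(\<integral>z. \<phi> z \<partial>Q n x) - (\<integral>z. \<phi> z \<partial>\<mu>)\<bar> \<le> C * \<rho> ^ n * c * (1 + V x)"
proof -
  define b where "b = max 1 (1 / \<beta>)"
  have b: "b \<ge> 1" "b * \<beta> \<ge> 1" using \<beta> by (auto simp: b_def max_def field_simps)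
  show ?thesis
  proof (intro exI[of _ "b * C0"] conjI allI impI)
    show "0 < b * C0" using b C0 by simp
  next
    fix n \<phi> B m c x
    assume \<phi>: "\<phi> \<in> borel_measurable borel" "\<forall>y. \<bar>\<phi> y\<bar> \<le> B" and c: "c \<ge> 0"
      and m: "\<forall>y. \<bar>\<phi> y - m\<bar> \<le> c * (1 + V y)"
    have "osc \<phi> (c * b)" unfolding osc_def
    proof (intro allI)
      fix x y
      have "\<bar>\<phi> x - \<phi> y\<bar> \<le> c * (2 + V x + V y)"
        using m[rule_format, of x] m[rule_format, of y] by (simp add: abs_le_iff algebra_simps)
      also have "\<dots> \<le> c * (b * (2 + \<beta> * V x + \<beta> * V y))"
      proof (intro mult_left_mono)
        have "1 * V z \<le> b * \<beta> * V z" for z using b V_nonneg by (intro mult_right_mono) auto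
        from this[of x] this[of y] b(1) show "2 + V x + V y \<le> b * (2 + \<beta> * V x + \<beta> * V y)"
          by (simp add: algebra_simps)
      qed (use c in auto)
      finally show "\<bar>\<phi> x - \<phi> y\<bar> \<le> c * b * (2 + \<beta> * V x + \<beta> * V y)" by (simp add: mult.assoc)
    qed
    from integral_\<mu>_bound[OF \<phi>(1) _ this, of B n x] \<phi>(2) c b
    show "\<bar>(\<integral>z. \<phi> z \<partial>Q n x) - (\<integral>z. \<phi> z \<partial>\<mu>)\<bar> \<le> b * C0 * \<rho> ^ n * c * (1 + V x)"
      by (simp add: algebra_simps)
  qed
qed

end

section \<open>Convergence of the Euler scheme\<close>

lemma normal_scaled_gauss:
  assumes "s > 0"
  shows "density lborel (\<lambda>y. ennreal (normal_density 0 s y)) = distr gauss borel (\<lambda>z. s * z)"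
proof -
  interpret prob_space gauss by (rule prob_gauss)
  have "distributed gauss lborel (\<lambda>z. z) (\<lambda>z. ennreal (normal_density 0 1 z))"
    unfolding distributed_def by (auto intro!: measure_eqI simp: emeasure_distr)
  from normal_density_affine[OF this, of s 0] assms
  have "distributed gauss lborel (\<lambda>z. s * z) (\<lambda>z. ennreal (normal_density 0 s z))" by simp
  then have "distr gauss lborel (\<lambda>z. s * z) = density lborel (\<lambda>y. ennreal (normal_density 0 s y))"
    by (rule distributed_distr_eq_density)
  moreover have "distr gauss lborel (\<lambda>z. s * z) = distr gauss borel (\<lambda>z. s * z)"
    by (rule distr_cong) auto
  ultimately show ?thesis by simp
qed

lemma gauss2_scaled:
  "distr gauss borel (\<lambda>z. s * z) \<Otimes>\<^sub>M distr gauss borel (\<lambda>z. s * z) = distr gauss2 borel (\<lambda>z::real \<times> real. s *\<^sub>R z)"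
proof -
  interpret g: prob_space gauss by (rule prob_gauss)
  have "prob_space (distr gauss borel (\<lambda>z. s * z))" by (rule g.prob_space_distr) auto
  then interpret d: prob_space "distr gauss borel (\<lambda>z. s * z)" .
  have "distr gauss borel (\<lambda>z. s * z) \<Otimes>\<^sub>M distr gauss borel (\<lambda>z. s * z)
      = distr (gauss \<Otimes>\<^sub>M gauss) (borel \<Otimes>\<^sub>M borel) (\<lambda>(x, y). (s * x, s * y))"
    by (rule pair_measure_distr) (auto simp: d.sigma_finite_measure_axioms)
  also have "\<dots> = distr gauss2 borel (\<lambda>z::real \<times> real. s *\<^sub>R z)"
    unfolding gauss2_def borel_prod by (intro distr_cong) (auto simp: scaleR_prod_def)
  finally show ?thesis .
qed

text \<open>Freezing of an independent variable: the joint law is a product, and Fubini integrates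
  the second variable with the first one held fixed.\<close>

lemma (in prob_space) indep_var_integral:
  assumes ind: "indep_var S U T Z"
    and g[measurable]: "g \<in> borel_measurable (S \<Otimes>\<^sub>M T)" and B: "\<And>u. \<bar>g u\<bar> \<le> (B::real)"
  shows "(\<integral>\<omega>. g (U \<omega>, Z \<omega>) \<partial>M) = (\<integral>\<omega>. (\<integral>\<omega>'. g (U \<omega>, Z \<omega>') \<partial>M) \<partial>M)"
proof -
  have rv[measurable]: "random_variable S U" "random_variable T Z"
    and eq: "distr M S U \<Otimes>\<^sub>M distr M T Z = distr M (S \<Otimes>\<^sub>M T) (\<lambda>x. (U x, Z x))"
    using ind unfolding indep_var_distribution_eq by auto
  interpret U: prob_space "distr M S U" by (rule prob_space_distr) measurable
  interpret Z: prob_space "distr M T Z" by (rule prob_space_distr) measurable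
  interpret UZ: pair_prob_space "distr M S U" "distr M T Z" ..
  have gm: "g \<in> borel_measurable (distr M S U \<Otimes>\<^sub>M distr M T Z)"
    using g by simp
  have i: "integrable (distr M S U \<Otimes>\<^sub>M distr M T Z) g"
    using B gm by (intro UZ.integrable_const_bound[where B=B]) auto
  have "(\<integral>\<omega>. g (U \<omega>, Z \<omega>) \<partial>M) = (\<integral>p. g p \<partial>(distr M S U \<Otimes>\<^sub>M distr M T Z))"
    unfolding eq by (subst integral_distr) auto
  also have "\<dots> = (\<integral>u. (\<integral>z. g (u, z) \<partial>distr M T Z) \<partial>distr M S U)"
    using UZ.integral_fst'[OF i] by simp
  also have "\<dots> = (\<integral>\<omega>. (\<integral>z. g (U \<omega>, z) \<partial>distr M T Z) \<partial>M)"
    by (rule integral_distr) measurable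
  also have "\<dots> = (\<integral>\<omega>. (\<integral>\<omega>'. g (U \<omega>, Z \<omega>') \<partial>M) \<partial>M)"
  proof (intro Bochner_Integration.integral_cong refl integral_distr)
    fix \<omega> assume "\<omega> \<in> space M"
    then have "U \<omega> \<in> space S" using rv(1) by (rule measurable_space[rotated])
    then show "(\<lambda>z. g (U \<omega>, z)) \<in> borel_measurable T" by measurable
  qed (rule rv(2))
  finally show ?thesis .
qed

definition increment :: "(real \<Rightarrow> real) \<Rightarrow> (real \<Rightarrow> real) \<Rightarrow> (nat \<Rightarrow> real) \<Rightarrow> nat \<times> nat \<Rightarrow> real" where
  "increment v0 v1 s = (\<lambda>(j, i). (if j = 0 then v0 else v1) (s (Suc i)) - (if j = 0 then v0 else v1) (s i))"

text \<open>Restates the definition, which speaks of strictly sorted lists of times, for grids given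
  by a function, the form in which the Euler scheme uses them.\<close>

lemma brownian2_increments:
  assumes bm: "brownian2 M w0 w1" and s0: "s 0 \<ge> 0" and s: "\<And>i. i < n \<Longrightarrow> s i < s (Suc i)"
  defines "inc \<equiv> \<lambda>p \<omega>. increment (\<lambda>t. w0 t \<omega>) (\<lambda>t. w1 t \<omega>) s p"
  shows "prob_space.indep_vars M (\<lambda>_. borel) inc ({0, 1} \<times> {..<n})"
    and "\<And>j i. j \<in> {0, 1} \<Longrightarrow> i < n \<Longrightarrow> distr M borel (inc (j, i)) = distr gauss borel (\<lambda>z. sqrt (s (Suc i) - s i) * z)"
    and "\<And>p. inc p \<in> borel_measurable M"
proof -
  interpret prob_space M using bm by (simp add: brownian2_def)
  have [measurable]: "w0 t \<in> borel_measurable M" "w1 t \<in> borel_measurable M" for t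
    using bm by (auto simp: brownian2_def)
  show meas: "inc p \<in> borel_measurable M" for p
    unfolding inc_def increment_def by (cases p, cases "fst p = 0") auto
  \<comment> \<open>The list has n + 1 times and therefore n increments.\<close>
  define ts where "ts = map s [0..<Suc n]"
  have mono: "s i < s j" if "i < j" "j \<le> n" for i j
    using that
  proof (induction j)
    case (Suc j)
    then show ?case using s[of j] by (cases "i = j") auto
  qed simp
  have "sorted_wrt (<) ts" unfolding ts_def sorted_wrt_iff_nth_less
    using mono by (auto simp del: upt_Suc)
  moreover have "0 \<le> s i" if "i \<le> n" for i
    using mono[of 0 i] that s0 by (cases "i = 0") auto
  then have "\<forall>t\<in>set ts. 0 \<le> t" by (auto simp: ts_def simp del: upt_Suc)
  ultimately have *: "let W = (\<lambda>j::nat. if j = 0 then w0 else w1);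
             inc = (\<lambda>(j, i) \<omega>. W j (ts ! Suc i) \<omega> - W j (ts ! i) \<omega>)
         in indep_vars (\<lambda>_. borel) inc ({0, 1} \<times> {..<length ts - 1}) \<and>
            (\<forall>j\<in>{0::nat, 1}. \<forall>i < length ts - 1.
               distributed M lborel (inc (j, i))
                 (\<lambda>y. ennreal (normal_density 0 (sqrt (ts ! Suc i - ts ! i)) y)))"
    using bm unfolding brownian2_def by blast
  have len: "length ts - 1 = n" by (simp add: ts_def)
  have nth: "ts ! i = s i" if "i \<le> n" for i using that by (simp add: ts_def del: upt_Suc)
  have eq: "(\<lambda>(j, i) \<omega>. (if j = 0 then w0 else w1) (ts ! Suc i) \<omega> - (if j = 0 then w0 else w1) (ts ! i) \<omega>) (j, i) = inc (j, i)"
    if "i < n" for j :: nat and i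
    using that by (auto simp: inc_def increment_def nth)
  from * have i: "indep_vars (\<lambda>_. borel) (\<lambda>(j::nat, i) \<omega>. (if j = 0 then w0 else w1) (ts ! Suc i) \<omega> - (if j = 0 then w0 else w1) (ts ! i) \<omega>)
      ({0, 1} \<times> {..<n})" unfolding Let_def len by blast
  show "indep_vars (\<lambda>_. borel) inc ({0, 1} \<times> {..<n})"
    by (rule indep_vars_cong[THEN iffD1, OF refl _ refl i]) (use eq in auto)
  fix j i :: nat assume ji: "j \<in> {0, 1}" "i < n"
  from * ji have "distributed M lborel (inc (j, i)) (\<lambda>y. ennreal (normal_density 0 (sqrt (s (Suc i) - s i)) y))"
    unfolding Let_def len using eq[of i j] nth[of i] nth[of "Suc i"] by auto
  then have "distr M lborel (inc (j, i)) = density lborel (\<lambda>y. ennreal (normal_density 0 (sqrt (s (Suc i) - s i)) y))"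
    by (rule distributed_distr_eq_density)
  also have "\<dots> = distr gauss borel (\<lambda>z. sqrt (s (Suc i) - s i) * z)"
    using s[OF ji(2)] by (intro normal_scaled_gauss) auto
  also have "distr M lborel (inc (j, i)) = distr M borel (inc (j, i))"
    by (rule distr_cong) auto
  finally show "distr M borel (inc (j, i)) = distr gauss borel (\<lambda>z. sqrt (s (Suc i) - s i) * z)" .
qed

text \<open>Joint independence over all indices contains the independence of the two coordinates
  over the same time interval; restriction to two singletons extracts it.\<close>

lemma brownian2_increment_pair:
  assumes bm: "brownian2 M w0 w1" and s0: "s 0 \<ge> 0" and s: "\<And>i. i < n \<Longrightarrow> s i < s (Suc i)" and i: "i < n"
  defines "inc \<equiv> \<lambda>p \<omega>. increment (\<lambda>t. w0 t \<omega>) (\<lambda>t. w1 t \<omega>) s p"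
  shows "distr M borel (\<lambda>\<omega>. (inc (0, i) \<omega>, inc (1, i) \<omega>)) = distr gauss2 borel (\<lambda>z. sqrt (s (Suc i) - s i) *\<^sub>R z)"
proof -
  interpret prob_space M using bm by (simp add: brownian2_def)
  note inc = brownian2_increments[of M w0 w1 s n, OF bm s0 s, folded inc_def]
  have "indep_var (PiM {(0, i)} (\<lambda>_. borel)) (\<lambda>\<omega>. restrict (\<lambda>p. inc p \<omega>) {(0, i)})
     (PiM {(1, i)} (\<lambda>_. borel)) (\<lambda>\<omega>. restrict (\<lambda>p. inc p \<omega>) {(1, i)})"
    using i by (intro indep_var_restrict[OF inc(1)]) auto
  then have "indep_var borel ((\<lambda>f. f (0, i)) \<circ> (\<lambda>\<omega>. restrict (\<lambda>p. inc p \<omega>) {(0, i)}))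
      borel ((\<lambda>f. f (1, i)) \<circ> (\<lambda>\<omega>. restrict (\<lambda>p. inc p \<omega>) {(1, i)}))"
    by (rule indep_var_compose) (auto intro!: measurable_component_singleton)
  then have "indep_var borel (inc (0, i)) borel (inc (1, i))" by (simp add: comp_def)
  then have "distr M (borel \<Otimes>\<^sub>M borel) (\<lambda>\<omega>. (inc (0, i) \<omega>, inc (1, i) \<omega>))
     = distr M borel (inc (0, i)) \<Otimes>\<^sub>M distr M borel (inc (1, i))"
    unfolding indep_var_distribution_eq by simp
  also have "\<dots> = distr gauss2 borel (\<lambda>z. sqrt (s (Suc i) - s i) *\<^sub>R z)"
    using inc(2)[of 0 i] inc(2)[of 1 i] i by (simp add: inc_def gauss2_scaled)
  finally show ?thesis unfolding borel_prod .
qed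

context kinetic
begin

section \<open>The Euler scheme path by path\<close>

text \<open>A deterministic function of the increments d. The same recursion can thus be compared
  with a solution for one path and integrated over all paths.\<close>

primrec epath :: "(nat \<Rightarrow> real) \<Rightarrow> (nat \<times> nat \<Rightarrow> real) \<Rightarrow> state \<Rightarrow> nat \<Rightarrow> state" where
  "epath h d x 0 = x"
| "epath h d x (Suc i) = epath h d x i + h i *\<^sub>R b (epath h d x i) + (s0 * d (0, i), 0, s1 * d (1, i), 0)"

lemma epath_cong: "(\<And>j i. j \<in> {0, 1} \<Longrightarrow> i < n \<Longrightarrow> d (j, i) = d' (j, i)) \<Longrightarrow> epath h d x n = epath h d' x n"
  by (induction n) auto

lemma epath_measurable_gen:
  assumes "\<And>j i. j \<in> {0, 1} \<Longrightarrow> i < n \<Longrightarrow> (\<lambda>\<omega>. d \<omega> (j, i)) \<in> borel_measurable M"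
  shows "(\<lambda>\<omega>. epath h (d \<omega>) x n) \<in> borel_measurable M"
  using assms
proof (induction n)
  case (Suc n)
  then have IH[measurable]: "(\<lambda>\<omega>. epath h (d \<omega>) x n) \<in> borel_measurable M" by simp
  have [measurable]: "(\<lambda>\<omega>. d \<omega> (0, n)) \<in> borel_measurable M" "(\<lambda>\<omega>. d \<omega> (1, n)) \<in> borel_measurable M"
    using Suc.prems by auto
  have "(\<lambda>\<omega>. (d \<omega> (0, n), d \<omega> (1, n))) \<in> borel_measurable M" by (rule borel_measurable_Pair) auto
  then have "(\<lambda>\<omega>. (\<lambda>z. (s0 * fst z, 0::real, s1 * snd z, 0::real)) (d \<omega> (0, n), d \<omega> (1, n))) \<in> borel_measurable M"
    by (rule measurable_compose) (intro borel_measurable_continuous_onI continuous_intros)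
  then have [measurable]: "(\<lambda>\<omega>. (s0 * d \<omega> (0, n), 0::real, s1 * d \<omega> (1, n), 0::real)) \<in> borel_measurable M" by simp
  show ?case by simp
qed simp

text \<open>The induction splits off the last step: its two increments are independent of the
  earlier ones, so freezing the position reached before it turns f into \<open>euler\<close> of
  f.\<close>

lemma expectation_epath:
  assumes bm: "brownian2 M w0 w1" and s0: "s 0 \<ge> 0" and s: "\<And>i. i < n \<Longrightarrow> s i < s (Suc i)"
    and f: "bmeas f B"
  shows "(\<integral>\<omega>. f (epath (\<lambda>i. s (Suc i) - s i) (increment (\<lambda>t. w0 t \<omega>) (\<lambda>t. w1 t \<omega>) s) x n) \<partial>M)
    = eulers (map (\<lambda>i. s (Suc i) - s i) [0..<n]) f x"
  using s f
proof (induction n arbitrary: f)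
  case 0
  interpret prob_space M using bm by (simp add: brownian2_def)
  show ?case using prob_space by simp
next
  case (Suc n)
  interpret prob_space M using bm by (simp add: brownian2_def)
  let ?h = "\<lambda>i. s (Suc i) - s i"
  let ?inc = "\<lambda>p \<omega>. increment (\<lambda>t. w0 t \<omega>) (\<lambda>t. w1 t \<omega>) s p"
  note inc = brownian2_increments[of M w0 w1 s "Suc n", OF bm s0 Suc.prems(1)]
  \<comment> \<open>The indices of the earlier increments and of the last pair; independence is used
    for the two restricted families as wholes.\<close>
  let ?A = "{0, 1::nat} \<times> {..<n}" and ?B = "{0, 1::nat} \<times> {n}"
  let ?U = "\<lambda>\<omega>. epath ?h (\<lambda>p. ?inc p \<omega>) x n" and ?Z = "\<lambda>\<omega>. (?inc (0, n) \<omega>, ?inc (1, n) \<omega>)"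
  let ?RA = "\<lambda>\<omega>. restrict (\<lambda>p. ?inc p \<omega>) ?A" and ?RB = "\<lambda>\<omega>. restrict (\<lambda>p. ?inc p \<omega>) ?B"
  have ind: "indep_var (PiM ?A (\<lambda>_. borel)) ?RA (PiM ?B (\<lambda>_. borel)) ?RB"
    by (intro indep_var_restrict[OF inc(1)]) auto
  let ?g = "\<lambda>p :: state \<times> real \<times> real. f (fst p + ?h n *\<^sub>R b (fst p) + (s0 * fst (snd p), 0, s1 * snd (snd p), 0))"
  have fm[measurable]: "f \<in> borel_measurable borel" by (rule bmeasD[OF Suc.prems(2)])
  have gm: "?g \<in> borel_measurable (borel \<Otimes>\<^sub>M borel)"
    unfolding borel_prod
    by (rule measurable_compose[OF _ fm])
       (intro borel_measurable_continuous_onI continuous_intros continuous_on_compose2[OF continuous_b], auto)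
  have dZ: "distr M borel ?Z = distr gauss2 borel (\<lambda>z. sqrt (?h n) *\<^sub>R z)"
    by (rule brownian2_increment_pair[OF bm s0 Suc.prems(1)]) auto
  have Zm[measurable]: "?Z \<in> borel_measurable M"
    by (intro borel_measurable_Pair inc(3))
  let ?G = "\<lambda>p. ?g (epath ?h (fst p) x n, snd p (0, n), snd p (1, n))"
  have Gm: "?G \<in> borel_measurable (PiM ?A (\<lambda>_. borel) \<Otimes>\<^sub>M PiM ?B (\<lambda>_. borel))"
  proof (rule measurable_compose[OF measurable_Pair gm])
    have "(\<lambda>d. epath ?h d x n) \<in> borel_measurable (PiM ?A (\<lambda>_. borel))"
      by (rule epath_measurable_gen) (auto intro!: measurable_component_singleton)
    then show "(\<lambda>p. epath ?h (fst p) x n)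
        \<in> borel_measurable (PiM ?A (\<lambda>_. borel) \<Otimes>\<^sub>M PiM ?B (\<lambda>_. borel :: real measure))"
      by (rule measurable_compose[OF measurable_fst])
    have dB: "(\<lambda>d. (d (0, n), d (1, n))) \<in> borel_measurable (PiM ?B (\<lambda>_. borel :: real measure))"
      by (rule borel_measurable_Pair) (auto intro!: measurable_component_singleton)
    show "(\<lambda>p. (snd p (0, n), snd p (1, n)))
        \<in> borel_measurable (PiM ?A (\<lambda>_. borel :: real measure) \<Otimes>\<^sub>M PiM ?B (\<lambda>_. borel :: real measure))"
      using measurable_compose[OF measurable_snd dB] .
  qed
  have GU: "?G (?RA \<omega>, ?RB \<omega>') = ?g (?U \<omega>, ?Z \<omega>')" for \<omega> \<omega>'
    using epath_cong[of n "?RA \<omega>" "\<lambda>p. ?inc p \<omega>"] by simp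
  have "(\<integral>\<omega>. f (epath ?h (\<lambda>p. ?inc p \<omega>) x (Suc n)) \<partial>M) = (\<integral>\<omega>. ?G (?RA \<omega>, ?RB \<omega>) \<partial>M)"
    unfolding GU by simp
  also have "\<dots> = (\<integral>\<omega>. (\<integral>\<omega>'. ?G (?RA \<omega>, ?RB \<omega>') \<partial>M) \<partial>M)"
    by (rule indep_var_integral[OF ind Gm]) (rule bmeasD(4)[OF Suc.prems(2)])
  also have "\<dots> = (\<integral>\<omega>. (\<integral>\<omega>'. ?g (?U \<omega>, ?Z \<omega>') \<partial>M) \<partial>M)" unfolding GU ..
  also have "\<dots> = (\<integral>\<omega>. euler (?h n) f (?U \<omega>) \<partial>M)"
  proof (intro Bochner_Integration.integral_cong refl)
    fix \<omega>
    have "(\<lambda>z. ?g (?U \<omega>, z)) \<in> borel_measurable borel"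
      by (rule measurable_compose[OF _ fm]) (simp, intro borel_measurable_continuous_onI continuous_intros)
    note gU = this
    have "(\<integral>\<omega>'. ?g (?U \<omega>, ?Z \<omega>') \<partial>M) = (\<integral>z. ?g (?U \<omega>, z) \<partial>distr M borel ?Z)"
      by (rule integral_distr[OF Zm gU, symmetric])
    also have "\<dots> = (\<integral>z. ?g (?U \<omega>, sqrt (?h n) *\<^sub>R z) \<partial>gauss2)"
      unfolding dZ by (rule integral_distr[OF _ gU]) simp
    also have "\<dots> = euler (?h n) f (?U \<omega>)"
      by (simp add: euler_def noise_def mult.assoc)
    finally show "(\<integral>\<omega>'. ?g (?U \<omega>, ?Z \<omega>') \<partial>M) = euler (?h n) f (?U \<omega>)" .
  qed
  also have "\<dots> = eulers (map ?h [0..<n]) (euler (?h n) f) x"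
    using Suc.IH[OF Suc.prems(1) bmeas_euler[OF Suc.prems(2)]] by simp
  also have "\<dots> = eulers (map ?h [0..<Suc n]) f x" by (simp add: eulers_append)
  finally show ?case .
qed

text \<open>The integral equation for a single path of the noise. With additive noise it makes sense
  without a stochastic integral.\<close>

definition drives :: "(real \<Rightarrow> real) \<Rightarrow> (real \<Rightarrow> real) \<Rightarrow> state \<Rightarrow> (real \<Rightarrow> state) \<Rightarrow> bool" where
  "drives v0 v1 x X \<longleftrightarrow> v0 0 = 0 \<and> v1 0 = 0 \<and> continuous_on {0..} X \<and>
    (\<forall>t\<ge>0. X t = x + integral {0..t} (\<lambda>s. b (X s)) + (s0 * v0 t, 0, s1 * v1 t, 0))"

lemma drives_0: "drives v0 v1 x X \<Longrightarrow> X 0 = x"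
  unfolding drives_def by (auto simp: zero_prod_def)

lemma drives_step:
  assumes "drives v0 v1 x X" "0 \<le> t" "t \<le> t'"
  shows "X t' = X t + integral {t..t'} (\<lambda>s. b (X s)) + (s0 * (v0 t' - v0 t), 0, s1 * (v1 t' - v1 t), 0)"
    and "continuous_on {t..t'} (\<lambda>s. b (X s))"
proof -
  have X: "continuous_on {0..} X" using assms by (simp add: drives_def)
  then have c: "continuous_on {u..v} (\<lambda>s. b (X s))" if "u \<ge> 0" for u v
    using that by (intro continuous_on_compose2[OF continuous_b] continuous_on_subset[OF X]) auto
  from c[OF assms(2)] show "continuous_on {t..t'} (\<lambda>s. b (X s))" .
  have "integral {0..t} (\<lambda>s. b (X s)) + integral {t..t'} (\<lambda>s. b (X s)) = integral {0..t'} (\<lambda>s. b (X s))"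
    using assms c[of 0 t'] by (intro Henstock_Kurzweil_Integration.integral_combine integrable_continuous_real) auto
  moreover have "X t = x + integral {0..t} (\<lambda>s. b (X s)) + (s0 * v0 t, 0, s1 * v1 t, 0)"
    "X t' = x + integral {0..t'} (\<lambda>s. b (X s)) + (s0 * v0 t', 0, s1 * v1 t', 0)"
    using assms by (auto simp: drives_def)
  moreover have "(s0 * v0 t', 0::real, s1 * v1 t', 0::real) = (s0 * v0 t, 0, s1 * v1 t, 0) + (s0 * (v0 t' - v0 t), 0, s1 * (v1 t' - v1 t), 0)"
    by (simp add: algebra_simps)
  ultimately show "X t' = X t + integral {t..t'} (\<lambda>s. b (X s)) + (s0 * (v0 t' - v0 t), 0, s1 * (v1 t' - v1 t), 0)"
    by (simp add: add.assoc del: add_Pair)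
qed

text \<open>Discrete Gronwall argument. Solution and scheme receive identical noise increments, so
  only the drifts differ, and within a cell the solution moves by at most \<epsilon>.\<close>

lemma epath_error:
  assumes X: "drives v0 v1 x X" and s: "s 0 = 0" "\<And>i. i < n \<Longrightarrow> s i \<le> s (Suc i)"
    and osc: "\<And>i u. i < n \<Longrightarrow> s i \<le> u \<Longrightarrow> u \<le> s (Suc i) \<Longrightarrow> norm (X u - X (s i)) \<le> \<epsilon>"
    and e: "\<epsilon> \<ge> 0" and i: "i \<le> n"
  shows "s i \<ge> 0 \<and> norm (X (s i) - epath (\<lambda>i. s (Suc i) - s i) (increment v0 v1 s) x i) \<le> \<epsilon> * (exp (L * s i) - 1)"
  using i
proof (induction i)
  case 0
  then show ?case using drives_0[OF X] s by simp
next
  case (Suc i)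
  let ?Y = "epath (\<lambda>i. s (Suc i) - s i) (increment v0 v1 s) x"
  define h where "h = s (Suc i) - s i"
  define d where "d = (s0 * (v0 (s (Suc i)) - v0 (s i)), 0::real, s1 * (v1 (s (Suc i)) - v1 (s i)), 0::real)"
  have h: "h \<ge> 0" using s(2)[of i] Suc.prems by (simp add: h_def)
  have si: "s i \<ge> 0" and IH: "norm (X (s i) - ?Y i) \<le> \<epsilon> * (exp (L * s i) - 1)" using Suc by auto
  have le: "s i \<le> s (Suc i)" using h by (simp add: h_def)
  note st = drives_step[OF X si le]
  let ?I = "integral {s i..s (Suc i)} (\<lambda>u. b (X u) - b (?Y i))"
  have I: "?I = integral {s i..s (Suc i)} (\<lambda>u. b (X u)) - h *\<^sub>R b (?Y i)"
    using st(2) le by (subst Henstock_Kurzweil_Integration.integral_diff) (auto intro!: integrable_continuous_real simp: h_def)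
  have "norm ?I \<le> (L * (\<epsilon> + \<epsilon> * (exp (L * s i) - 1))) * (s (Suc i) - s i)"
  proof (rule integral_bound[OF le])
    show "continuous_on {s i..s (Suc i)} (\<lambda>u. b (X u) - b (?Y i))" using st(2) by (intro continuous_intros)
    fix u assume u: "u \<in> {s i..s (Suc i)}"
    have "norm (b (X u) - b (?Y i)) \<le> L * norm (X u - ?Y i)" by (rule b_lipschitz)
    also have "norm (X u - ?Y i) \<le> norm (X u - X (s i)) + norm (X (s i) - ?Y i)"
      using norm_triangle_ineq[of "X u - X (s i)" "X (s i) - ?Y i"] by simp
    also have "\<dots> \<le> \<epsilon> + \<epsilon> * (exp (L * s i) - 1)"
      using osc[of i u] u Suc.prems IH by (intro add_mono) auto
    finally show "norm (b (X u) - b (?Y i)) \<le> L * (\<epsilon> + \<epsilon> * (exp (L * s i) - 1))"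
      using L by (simp add: mult_left_mono)
  qed
  then have nI: "norm ?I \<le> L * h * (\<epsilon> * exp (L * s i))" by (simp add: h_def algebra_simps)
  \<comment> \<open>The noise increments cancel here.\<close>
  have "X (s (Suc i)) - ?Y (Suc i) = (X (s i) - ?Y i) + ?I"
    unfolding I st(1) by (simp add: increment_def h_def algebra_simps del: add_Pair diff_Pair)
  then have "norm (X (s (Suc i)) - ?Y (Suc i)) \<le> norm (X (s i) - ?Y i) + norm ?I"
    by (simp only: norm_triangle_ineq)
  also have "\<dots> \<le> \<epsilon> * (exp (L * s i) - 1) + L * h * (\<epsilon> * exp (L * s i))"
    by (rule add_mono[OF IH nI])
  also have "\<dots> = \<epsilon> * (exp (L * s i) * (1 + L * h) - 1)" by (simp add: algebra_simps)
  also have "\<dots> \<le> \<epsilon> * (exp (L * s i) * exp (L * h) - 1)"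
    using e by (intro mult_left_mono diff_right_mono exp_ge_add_one_self) auto
  also have "exp (L * s i) * exp (L * h) = exp (L * s (Suc i))"
    by (simp add: h_def exp_add[symmetric] algebra_simps)
  finally show ?case using si le by simp
qed

text \<open>Uniform continuity of the one path on the compact interval bounds its movement in a cell
  of small mesh. The convergence is pathwise and carries no rate.\<close>

lemma epath_converges:
  assumes X: "drives v0 v1 x X" and t: "t \<ge> 0"
    and s: "\<And>k. s k 0 = 0" "\<And>k. s k (N k) = t" "\<And>k i. i < N k \<Longrightarrow> s k i \<le> s k (Suc i)"
    and mesh: "\<And>k i. i < N k \<Longrightarrow> s k (Suc i) - s k i \<le> \<eta> k" "\<eta> \<longlonglongrightarrow> 0"
  shows "(\<lambda>k. epath (\<lambda>i. s k (Suc i) - s k i) (increment v0 v1 (s k)) x (N k)) \<longlonglongrightarrow> X t"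
proof (rule LIMSEQ_I)
  fix e :: real assume e: "e > 0"
  \<comment> \<open>Half of the tolerance after multiplication by the Gronwall factor.\<close>
  define \<epsilon> where "\<epsilon> = e / (2 * exp (L * t))"
  have \<epsilon>: "\<epsilon> > 0" using e by (simp add: \<epsilon>_def)
  have "continuous_on {0..t} X" using X by (auto simp: drives_def intro: continuous_on_subset)
  then have "uniformly_continuous_on {0..t} X" by (intro compact_uniformly_continuous) auto
  from this[unfolded uniformly_continuous_on_def, rule_format, OF \<epsilon>] obtain d where
    d: "d > 0" "\<And>u v. u \<in> {0..t} \<Longrightarrow> v \<in> {0..t} \<Longrightarrow> dist u v < d \<Longrightarrow> dist (X u) (X v) < \<epsilon>" by metis
  from order_tendstoD(2)[OF mesh(2) d(1)] obtain K where K: "\<And>k. k \<ge> K \<Longrightarrow> \<eta> k < d"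
    by (auto simp: eventually_sequentially)
  have "norm (epath (\<lambda>i. s k (Suc i) - s k i) (increment v0 v1 (s k)) x (N k) - X t) < e" if k: "k \<ge> K" for k
  proof -
    have mono: "s k i \<le> s k j" if "i \<le> j" "j \<le> N k" for i j
      using that
    proof (induction j)
      case (Suc j)
      then show ?case using s(3)[of j k] by (cases "i = Suc j") auto
    qed simp
    have "s k (N k) \<ge> 0 \<and> norm (X (s k (N k)) - epath (\<lambda>i. s k (Suc i) - s k i) (increment v0 v1 (s k)) x (N k))
        \<le> \<epsilon> * (exp (L * s k (N k)) - 1)"
    proof (rule epath_error[OF X s(1) s(3)])
      fix i u assume iu: "i < N k" "s k i \<le> u" "u \<le> s k (Suc i)"
      have "0 \<le> s k i" "s k (Suc i) \<le> t" using mono[of 0 i] mono[of "Suc i" "N k"] iu s(1,2)[of k] by auto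
      moreover have "dist u (s k i) < d" using iu mesh(1)[of i k] K[OF k] by (auto simp: dist_real_def)
      ultimately have "dist (X u) (X (s k i)) < \<epsilon>" using iu by (intro d(2)) auto
      then show "norm (X u - X (s k i)) \<le> \<epsilon>" by (simp add: dist_norm)
    qed (use \<epsilon> in auto)
    then have "norm (X t - epath (\<lambda>i. s k (Suc i) - s k i) (increment v0 v1 (s k)) x (N k)) \<le> \<epsilon> * (exp (L * t) - 1)"
      by (simp add: s)
    also have "\<dots> < \<epsilon> * exp (L * t) + e / 2" using \<epsilon> e by (simp add: algebra_simps)
    also have "\<dots> = e" by (simp add: \<epsilon>_def)
    finally show ?thesis by (simp add: norm_minus_commute)
  qed
  then show "\<exists>K. \<forall>k\<ge>K. norm (epath (\<lambda>i. s k (Suc i) - s k i) (increment v0 v1 (s k)) x (N k) - X t) < e" by blast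
qed

end

section \<open>The transition semigroup\<close>

text \<open>Lipschitz functions decreasing to the indicator of a closed set as k grows. They let
  statements about Lipschitz functions, where the Euler limit is available, reach closed
  sets.\<close>

definition cutoff :: "'a::metric_space set \<Rightarrow> nat \<Rightarrow> 'a \<Rightarrow> real" where
  "cutoff F k y = max 0 (1 - real k * infdist y F)"

lemma continuous_cutoff: "continuous_on UNIV (cutoff F k)"
  unfolding cutoff_def by (intro continuous_intros)

lemma cutoff_measurable[measurable]: "cutoff F k \<in> borel_measurable borel"
  by (intro borel_measurable_continuous_onI continuous_cutoff)

lemma cutoff:
  assumes "closed F" "F \<noteq> {}"
  shows "0 \<le> cutoff F k y" "cutoff F k y \<le> 1" "\<bar>cutoff F k y\<bar> \<le> 1"
    and "\<bar>cutoff F k x - cutoff F k y\<bar> \<le> real k * dist x y"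
    and "(\<lambda>k. cutoff F k y) \<longlonglongrightarrow> indicator F y"
proof -
  show "0 \<le> cutoff F k y" "cutoff F k y \<le> 1" "\<bar>cutoff F k y\<bar> \<le> 1"
    using infdist_nonneg[of y F] by (auto simp: cutoff_def)
  show "\<bar>cutoff F k x - cutoff F k y\<bar> \<le> real k * dist x y"
  proof -
    have "\<bar>cutoff F k x - cutoff F k y\<bar> \<le> \<bar>real k * infdist x F - real k * infdist y F\<bar>"
      by (auto simp: cutoff_def)
    also have "\<dots> = real k * \<bar>infdist x F - infdist y F\<bar>"
      by (simp add: right_diff_distrib[symmetric] abs_mult)
    also have "\<dots> \<le> real k * dist x y"
      using infdist_triangle_abs[of x F y] by (intro mult_left_mono) auto
    finally show ?thesis .
  qed
  show "(\<lambda>k. cutoff F k y) \<longlonglongrightarrow> indicator F y"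
  proof (cases "y \<in> F")
    case True
    then show ?thesis by (simp add: cutoff_def)
  next
    case False
    then have pos: "infdist y F > 0"
      using assms in_closed_iff_infdist_zero[of F y] infdist_nonneg[of y F] by fastforce
    obtain N :: nat where N: "1 / infdist y F \<le> real N" using real_arch_simple by blast
    have "cutoff F k y = 0" if "k \<ge> N" for k
    proof -
      have "1 / infdist y F \<le> real k" using N that by (meson of_nat_mono order_trans)
      then show ?thesis using pos by (simp add: cutoff_def field_simps)
    qed
    then have "eventually (\<lambda>k. cutoff F k y = 0) sequentially" by (auto simp: eventually_sequentially)
    then show ?thesis using False by (simp add: tendsto_eventually)
  qed
qed

text \<open>Closed sets are stable under intersection and generate the Borel sets, and their
  measures are limits of integrals of cutoffs.\<close>

lemma measure_eqI_lipschitz: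
  fixes \<mu> \<nu> :: "'a::metric_space measure"
  assumes "prob_space \<mu>" "prob_space \<nu>" and sets: "sets \<mu> = sets borel" "sets \<nu> = sets borel"
    and eq: "\<And>f D. f \<in> borel_measurable borel \<Longrightarrow> (\<And>x. 0 \<le> f x) \<Longrightarrow> (\<And>x. f x \<le> (1::real)) \<Longrightarrow> D \<ge> 0 \<Longrightarrow>
       (\<And>x y. \<bar>f x - f y\<bar> \<le> D * dist x y) \<Longrightarrow> (\<integral>x. f x \<partial>\<mu>) = (\<integral>x. f x \<partial>\<nu>)"
  shows "\<mu> = \<nu>"
proof (rule measure_eqI_generator_eq[where E="Collect closed" and \<Omega>=UNIV and A="\<lambda>_. UNIV"])
  interpret mu: prob_space \<mu> by fact
  interpret nu: prob_space \<nu> by fact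
  show "Int_stable (Collect closed)" by (auto simp: Int_stable_def)
  show "sets \<mu> = sigma_sets UNIV (Collect closed)" "sets \<nu> = sigma_sets UNIV (Collect closed)"
    unfolding sets by (simp_all add: borel_eq_closed)
  fix F :: "'a set" assume "F \<in> Collect closed"
  then have F: "closed F" by simp
  show "emeasure \<mu> F = emeasure \<nu> F"
  proof (cases "F = {}")
    case False
    define \<phi> where "\<phi> = cutoff F"
    note cut = cutoff[OF F False, folded \<phi>_def]
    have [measurable]: "F \<in> sets borel" using F by (rule borel_closed)
    have m[measurable]: "\<phi> k \<in> borel_measurable borel" for k
      unfolding \<phi>_def by (rule cutoff_measurable)
    have lim: "(\<lambda>k. \<integral>y. \<phi> k y \<partial>N) \<longlonglongrightarrow> measure N F" if "prob_space N" "sets N = sets borel" for N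
    proof -
      interpret prob_space N by fact
      have [measurable_cong]: "sets N = sets borel" by fact
      have sp: "space N = UNIV" using sets_eq_imp_space_eq[OF that(2)] by simp
      have "(\<lambda>k. \<integral>y. \<phi> k y \<partial>N) \<longlonglongrightarrow> (\<integral>y. indicator F y \<partial>N)"
        using cut F by (intro integral_dominated_convergence[where w="\<lambda>_. 1"]) auto
      then show ?thesis using sp by simp
    qed
    have "(\<integral>y. \<phi> k y \<partial>\<mu>) = (\<integral>y. \<phi> k y \<partial>\<nu>)" for k
      using cut by (intro eq[of _ "real k"]) auto
    then have "measure \<mu> F = measure \<nu> F"
      using lim[of \<mu>] lim[of \<nu>] sets assms(1,2) by (auto intro: LIMSEQ_unique)
    then show ?thesis by (simp add: mu.emeasure_eq_measure nu.emeasure_eq_measure)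
  qed simp
qed (auto simp: prob_space.emeasure_space_1 finite_measure.emeasure_finite[OF prob_space.finite_measure[OF assms(1)]])

text \<open>All starting points share one Brownian motion. This synchronous coupling makes the
  solution Lipschitz in its starting point, path by path.\<close>

locale kinetic_flow = kinetic +
  fixes M :: "'w measure" and w0 w1 :: "real \<Rightarrow> 'w \<Rightarrow> real" and X :: "state \<Rightarrow> real \<Rightarrow> 'w \<Rightarrow> state"
  assumes bm: "brownian2 M w0 w1"
    and X_measurable: "t \<ge> 0 \<Longrightarrow> X x t \<in> borel_measurable M"
    and X_drives: "\<omega> \<in> space M \<Longrightarrow> drives (\<lambda>t. w0 t \<omega>) (\<lambda>t. w1 t \<omega>) x (\<lambda>t. X x t \<omega>)"
begin

sublocale M: prob_space M using bm by (simp add: brownian2_def)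

definition P :: "real \<Rightarrow> state \<Rightarrow> state measure" where "P t x = distr M borel (X x t)"

lemma sets_P[simp, measurable_cong]: "sets (P t x) = sets borel" by (simp add: P_def)
lemma space_P[simp]: "space (P t x) = UNIV" by (simp add: P_def)

lemma prob_P: "t \<ge> 0 \<Longrightarrow> prob_space (P t x)"
  unfolding P_def by (intro M.prob_space_distr X_measurable)

lemma integral_P: "t \<ge> 0 \<Longrightarrow> f \<in> borel_measurable borel \<Longrightarrow> (\<integral>y. f y \<partial>P t x) = (\<integral>\<omega>. f (X x t \<omega>) \<partial>M :: real)"
  unfolding P_def by (intro integral_distr X_measurable)

abbreviation path_increment :: "(nat \<Rightarrow> real) \<Rightarrow> 'w \<Rightarrow> nat \<times> nat \<Rightarrow> real" where
  "path_increment s \<omega> \<equiv> increment (\<lambda>t. w0 t \<omega>) (\<lambda>t. w1 t \<omega>) s"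

lemma epath_measurable[measurable]:
  "(\<lambda>\<omega>. epath h (path_increment s \<omega>) x n) \<in> borel_measurable M"
proof (rule epath_measurable_gen)
  have [measurable]: "w0 t \<in> borel_measurable M" "w1 t \<in> borel_measurable M" for t
    using bm by (auto simp: brownian2_def)
  show "(\<lambda>\<omega>. path_increment s \<omega> (j, i)) \<in> borel_measurable M" if "j \<in> {0, 1}" for j i
    using that by (auto simp: increment_def)
qed

section \<open>Transition probabilities as limits of Euler operators\<close>

text \<open>The test function may change with k, with continuous convergence in place of pointwise
  convergence. The Markov property needs this, since there the test function is itself an Euler
  approximation.\<close>

lemma eulers_expectation_limit:
  assumes t: "t \<ge> 0"
    and s: "\<And>k. s k 0 = 0" "\<And>k. s k (N k) = t" "\<And>k i. i < N k \<Longrightarrow> s k i < s k (Suc i)"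
    and mesh: "\<And>k i. i < N k \<Longrightarrow> s k (Suc i) - s k i \<le> \<eta> k" "\<eta> \<longlonglongrightarrow> 0"
    and g: "\<And>k. bmeas (g k) B" "g' \<in> borel_measurable borel"
    and lim: "\<And>u y. u \<longlonglongrightarrow> y \<Longrightarrow> (\<lambda>k. g k (u k)) \<longlonglongrightarrow> g' y"
  shows "(\<lambda>k. eulers (map (\<lambda>i. s k (Suc i) - s k i) [0..<N k]) (g k) x) \<longlonglongrightarrow> (\<integral>\<omega>. g' (X x t \<omega>) \<partial>M)"
proof -
  let ?Y = "\<lambda>k \<omega>. epath (\<lambda>i. s k (Suc i) - s k i) (path_increment (s k) \<omega>) x (N k)"
  have [measurable]: "X x t \<in> borel_measurable M" using t by (rule X_measurable)
  have [measurable]: "g k \<in> borel_measurable borel" for k by (rule bmeasD[OF g(1)])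
  have "(\<lambda>k. \<integral>\<omega>. g k (?Y k \<omega>) \<partial>M) \<longlonglongrightarrow> (\<integral>\<omega>. g' (X x t \<omega>) \<partial>M)"
  proof (rule integral_dominated_convergence[where w="\<lambda>_. B"])
    show "AE \<omega> in M. (\<lambda>k. g k (?Y k \<omega>)) \<longlonglongrightarrow> g' (X x t \<omega>)"
      by (intro AE_I2 lim epath_converges[OF X_drives t s(1,2) _ mesh] less_imp_le s(3)) auto
    show "AE \<omega> in M. norm (g k (?Y k \<omega>)) \<le> B" for k
      using bmeasD(4)[OF g(1)] by (intro AE_I2) simp
    show "(\<lambda>\<omega>. g' (X x t \<omega>)) \<in> borel_measurable M" using g(2) by measurable
  qed auto
  moreover have "(\<integral>\<omega>. g k (?Y k \<omega>) \<partial>M) = eulers (map (\<lambda>i. s k (Suc i) - s k i) [0..<N k]) (g k) x" for k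
    by (rule expectation_epath[OF bm]) (use s(1)[of k] s(3) g(1) in auto)
  ultimately show ?thesis by simp
qed

lemma LIMSEQ_divide_Suc: "(\<lambda>k. t / real (Suc k)) \<longlonglongrightarrow> (0::real)"
  using tendsto_mult_right[OF LIMSEQ_inverse_real_of_nat, of t] by (simp add: divide_inverse mult.commute)

lemma eulers_uniform_limit:
  assumes t: "t > 0"
    and g: "\<And>k. bmeas (g k) B" "g' \<in> borel_measurable borel"
    and lim: "\<And>u y. u \<longlonglongrightarrow> y \<Longrightarrow> (\<lambda>k. g k (u k)) \<longlonglongrightarrow> g' y"
  shows "(\<lambda>k. eulers (replicate (Suc k) (t / Suc k)) (g k) x) \<longlonglongrightarrow> (\<integral>\<omega>. g' (X x t \<omega>) \<partial>M)"
proof -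
  let ?s = "\<lambda>k i. real i * (t / real (Suc k))"
  have d: "?s k (Suc i) - ?s k i = t / real (Suc k)" for k i
    by (simp only: of_nat_Suc distrib_right)
  have pos: "t / real (Suc k) > 0" for k using t by simp
  have "(\<lambda>k. eulers (map (\<lambda>i. ?s k (Suc i) - ?s k i) [0..<Suc k]) (g k) x) \<longlonglongrightarrow> (\<integral>\<omega>. g' (X x t \<omega>) \<partial>M)"
  proof (rule eulers_expectation_limit[OF _ _ _ _ _ LIMSEQ_divide_Suc g lim])
    show "?s k i < ?s k (Suc i)" for k i using d[of i k] pos[of k] by linarith
    show "?s k (Suc i) - ?s k i \<le> t / real (Suc k)" for k i unfolding d ..
  qed (use t in auto)
  moreover have "map (\<lambda>i. ?s k (Suc i) - ?s k i) [0..<Suc k] = replicate (Suc k) (t / Suc k)" for k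
    unfolding d by (simp only: map_replicate_const length_upt diff_zero)
  ultimately show ?thesis by simp
qed

lemma continuous_lim: "continuous_on UNIV f \<Longrightarrow> u \<longlonglongrightarrow> y \<Longrightarrow> (\<lambda>k. f (u k)) \<longlonglongrightarrow> f (y::state)"
  using continuous_on_eq_continuous_at[OF open_UNIV, of f] isCont_tendsto_compose[of y f u sequentially] by blast

lemma eulers_limit:
  assumes "t > 0" "bmeas f B" "continuous_on UNIV f"
  shows "(\<lambda>k. eulers (replicate (Suc k) (t / Suc k)) f x) \<longlonglongrightarrow> (\<integral>y. f y \<partial>P t x)"
  using eulers_uniform_limit[of t "\<lambda>_. f" B f x] assms continuous_lim[OF assms(3)] bmeasD(1)[OF assms(2)]
  by (simp add: integral_P del: of_nat_Suc replicate_Suc)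

lemma P_0: "P 0 x = return borel x"
proof (rule measure_eqI)
  fix A assume "A \<in> sets (P 0 x)"
  then have A: "A \<in> sets borel" by simp
  have "X x 0 \<omega> = x" if "\<omega> \<in> space M" for \<omega> by (rule drives_0[OF X_drives[OF that]])
  then have "X x 0 -` A \<inter> space M = (if x \<in> A then space M else {})" by auto
  then show "emeasure (P 0 x) A = emeasure (return borel x) A"
    using A by (simp add: P_def emeasure_distr X_measurable M.emeasure_space_1)
qed simp

text \<open>Both laws are limits of the same \<open>eulers\<close> expressions, in which no
  probability space with a Brownian motion occurs any more.\<close>

lemma P_eq:
  assumes "kinetic_flow b L s0 s1 M' w0' w1' X'" and t: "t \<ge> 0"
  shows "P t x = kinetic_flow.P M' X' t x"
proof (cases "t = 0")
  case True
  interpret other: kinetic_flow b L s0 s1 M' w0' w1' X' by fact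
  show ?thesis using True by (simp add: P_0 other.P_0)
next
  case False
  interpret other: kinetic_flow b L s0 s1 M' w0' w1' X' by fact
  show ?thesis
  proof (rule measure_eqI_lipschitz[OF prob_P[OF t] other.prob_P[OF t]])
    fix f :: "state \<Rightarrow> real" and D
    assume f: "f \<in> borel_measurable borel" "\<And>x. 0 \<le> f x" "\<And>x. f x \<le> 1" "D \<ge> 0" "\<And>x y. \<bar>f x - f y\<bar> \<le> D * dist x y"
    then have "continuous_on UNIV f"
      by (intro lipschitz_on_continuous_on[of D] lipschitz_onI) (auto simp: dist_real_def)
    moreover have "bmeas f 1" using f by (simp add: bmeas_def)
    ultimately show "(\<integral>x. f x \<partial>P t x) = (\<integral>x. f x \<partial>other.P t x)"
      using eulers_limit[of t f 1 x] other.eulers_limit[of t f 1 x] False t by (auto intro: LIMSEQ_unique)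
  qed auto
qed

section \<open>Dependence on the starting point and the Markov property\<close>

lemma epath_lipschitz:
  assumes "\<And>i. i < n \<Longrightarrow> h i \<ge> 0"
  shows "norm (epath h d x n - epath h d y n) \<le> exp (L * (\<Sum>i<n. h i)) * norm (x - y)"
  using assms
proof (induction n)
  case (Suc n)
  have "norm (epath h d x (Suc n) - epath h d y (Suc n))
      = norm ((epath h d x n + h n *\<^sub>R b (epath h d x n)) - (epath h d y n + h n *\<^sub>R b (epath h d y n)))"
    by (simp only: epath.simps add_diff_cancel_right)
  also have "\<dots> \<le> exp (L * h n) * norm (epath h d x n - epath h d y n)"
    by (rule euler_step_lipschitz) (use Suc in auto)
  also have "\<dots> \<le> exp (L * h n) * (exp (L * (\<Sum>i<n. h i)) * norm (x - y))"
    using Suc by (intro mult_left_mono) auto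
  finally show ?case by (simp add: distrib_left exp_add mult_ac)
qed simp

text \<open>Two schemes with the same increments differ only through their drift, uniformly in the
  mesh; the bound passes to the limit.\<close>

lemma X_lipschitz:
  assumes t: "t \<ge> 0" and \<omega>: "\<omega> \<in> space M"
  shows "norm (X x t \<omega> - X y t \<omega>) \<le> exp (L * t) * norm (x - y)"
proof -
  let ?s = "\<lambda>k i. real i * (t / real (Suc k))"
  let ?Y = "\<lambda>k x. epath (\<lambda>i. ?s k (Suc i) - ?s k i) (path_increment (?s k) \<omega>) x (Suc k)"
  have d: "?s k (Suc i) - ?s k i = t / real (Suc k)" for k i
    by (simp only: of_nat_Suc distrib_right)
  have pos: "t / real (Suc k) \<ge> 0" for k using t by simp
  have lim: "(\<lambda>k. ?Y k x) \<longlonglongrightarrow> X x t \<omega>" for x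
  proof (rule epath_converges[OF X_drives[OF \<omega>] t _ _ _ _ LIMSEQ_divide_Suc])
    show "?s k i \<le> ?s k (Suc i)" for k i using d[of i k] pos[of k] by linarith
    show "?s k (Suc i) - ?s k i \<le> t / real (Suc k)" for k i unfolding d ..
  qed auto
  have l: "(\<lambda>k. norm (?Y k x - ?Y k y)) \<longlonglongrightarrow> norm (X x t \<omega> - X y t \<omega>)"
    by (intro tendsto_intros lim)
  have bd: "norm (?Y k x - ?Y k y) \<le> exp (L * t) * norm (x - y)" for k
  proof -
    have "norm (?Y k x - ?Y k y) \<le> exp (L * (\<Sum>i<Suc k. ?s k (Suc i) - ?s k i)) * norm (x - y)"
      by (rule epath_lipschitz) (use d pos in simp)
    also have "(\<Sum>i<Suc k. ?s k (Suc i) - ?s k i) = t"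
      unfolding d by (simp only: sum_constant card_lessThan) simp
    finally show ?thesis .
  qed
  show ?thesis by (rule LIMSEQ_le_const2[OF l]) (use bd in blast)
qed

lemma integral_P_lipschitz:
  assumes t: "t \<ge> 0" and f: "bmeas f B" and D: "D \<ge> 0" "\<And>x y. \<bar>f x - f y\<bar> \<le> D * norm (x - y)"
  shows "\<bar>(\<integral>z. f z \<partial>P t x) - (\<integral>z. f z \<partial>P t y)\<bar> \<le> D * exp (L * t) * norm (x - y)"
proof -
  note fm = bmeasD(1)[OF f]
  have i: "integrable M (\<lambda>\<omega>. f (X x t \<omega>))" for x
    using bmeasD(4)[OF f] by (intro M.integrable_const_bound[where B=B] measurable_compose[OF X_measurable[OF t] fm]) auto
  have "\<bar>(\<integral>z. f z \<partial>P t x) - (\<integral>z. f z \<partial>P t y)\<bar> = \<bar>\<integral>\<omega>. f (X x t \<omega>) - f (X y t \<omega>) \<partial>M\<bar>"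
    using i by (simp add: integral_P[OF t fm])
  also have "\<dots> \<le> (\<integral>\<omega>. \<bar>f (X x t \<omega>) - f (X y t \<omega>)\<bar> \<partial>M)" by (rule integral_abs_bound)
  also have "\<dots> \<le> (\<integral>\<omega>. D * (exp (L * t) * norm (x - y)) \<partial>M)"
  proof (rule integral_mono)
    fix \<omega> assume "\<omega> \<in> space M"
    then have "D * norm (X x t \<omega> - X y t \<omega>) \<le> D * (exp (L * t) * norm (x - y))"
      using D X_lipschitz[OF t] by (intro mult_left_mono) auto
    then show "\<bar>f (X x t \<omega>) - f (X y t \<omega>)\<bar> \<le> D * (exp (L * t) * norm (x - y))"
      using D(2) order_trans by blast
  qed (use i in auto)
  finally show ?thesis by (simp add: M.prob_space mult.assoc)
qed

lemma lipschitz_continuous: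
  fixes f :: "state \<Rightarrow> real"
  assumes "D \<ge> 0" "\<And>x y. \<bar>f x - f y\<bar> \<le> D * norm (x - y)"
  shows "continuous_on UNIV f"
  using assms by (intro lipschitz_on_continuous_on[of D] lipschitz_onI) (auto simp: dist_norm)

text \<open>It suffices to treat closed sets, where the probability is a limit of integrals of
  cutoffs, which are Lipschitz in the starting point.\<close>

lemma P_measurable:
  assumes t: "t \<ge> 0"
  shows "P t \<in> borel \<rightarrow>\<^sub>M prob_algebra borel"
proof (rule measurable_prob_algebraI)
  show "prob_space (P t x)" for x by (rule prob_P[OF t])
  show "P t \<in> borel \<rightarrow>\<^sub>M subprob_algebra borel"
  proof (rule measurable_subprob_algebra_generated[where G="Collect closed" and \<Omega>=UNIV])
    show "subprob_space (P t x)" for x by (intro prob_space_imp_subprob_space prob_P t)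
    show "sets borel = sigma_sets UNIV (Collect (closed :: state set \<Rightarrow> bool))"
      by (simp add: borel_eq_closed)
    have "emeasure (P t x) UNIV = 1" for x
      using prob_space.emeasure_space_1[OF prob_P[OF t], of x] by simp
    then show "(\<lambda>a. emeasure (P t a) UNIV) \<in> borel_measurable borel" by simp
    fix F :: "state set" assume "F \<in> Collect closed"
    then have F: "closed F" by simp
    show "(\<lambda>a. emeasure (P t a) F) \<in> borel_measurable borel"
    proof (cases "F = {}")
      case False
      define \<phi> where "\<phi> = cutoff F"
      note cut = cutoff[OF F False, folded \<phi>_def]
      have [measurable]: "F \<in> sets borel" using F by (rule borel_closed)
      have m[measurable]: "\<phi> k \<in> borel_measurable borel" for k
        unfolding \<phi>_def by (rule cutoff_measurable)
      have bm\<phi>: "bmeas (\<phi> k) 1" for k using cut(1,2) m unfolding bmeas_def by blast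
      have lim: "(\<lambda>k. \<integral>y. \<phi> k y \<partial>P t x) \<longlonglongrightarrow> measure (P t x) F" for x
      proof -
        interpret prob_space "P t x" by (rule prob_P[OF t])
        have "(\<lambda>k. \<integral>y. \<phi> k y \<partial>P t x) \<longlonglongrightarrow> (\<integral>y. indicator F y \<partial>P t x)"
          using cut F by (intro integral_dominated_convergence[where w="\<lambda>_. 1"]) auto
        then show ?thesis by simp
      qed
      have "(\<lambda>x. \<integral>y. \<phi> k y \<partial>P t x) \<in> borel_measurable borel" for k
      proof (intro borel_measurable_continuous_onI lipschitz_continuous)
        show "\<bar>(\<integral>y. \<phi> k y \<partial>P t x) - (\<integral>y. \<phi> k y \<partial>P t z)\<bar> \<le> real k * exp (L * t) * norm (x - z)" for x z
          using cut(4) by (intro integral_P_lipschitz[OF t bm\<phi>]) (auto simp: dist_norm)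
      qed auto
      from borel_measurable_LIMSEQ_real[OF lim this]
      have "(\<lambda>x. measure (P t x) F) \<in> borel_measurable borel" by simp
      then have "(\<lambda>x. ennreal (measure (P t x) F)) \<in> borel_measurable borel" by simp
      then show ?thesis
        using finite_measure.emeasure_eq_measure[OF prob_space.finite_measure[OF prob_P[OF t]]] by simp
    qed simp
  qed (auto simp: Int_stable_def)
qed

text \<open>Step lengths of the grid that makes n steps of length h followed by m steps of length
  h'.\<close>

lemma map_two_phase:
  "map (\<lambda>i. (if Suc i \<le> n then real (Suc i) * h else n * h + real (Suc i - n) * h')
      - (if i \<le> n then real i * h else n * h + real (i - n) * h')) [0..<n + m]
   = replicate n h @ replicate m h'"
proof (rule nth_equalityI)
  fix i assume "i < length (map (\<lambda>i. (if Suc i \<le> n then real (Suc i) * h else n * h + real (Suc i - n) * h')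
      - (if i \<le> n then real i * h else n * h + real (i - n) * h')) [0..<n + m])"
  then have i: "i < n + m" by simp
  consider "i < n" | "i = n" | "i > n" by linarith
  then show "map (\<lambda>i. (if Suc i \<le> n then real (Suc i) * h else n * h + real (Suc i - n) * h')
      - (if i \<le> n then real i * h else n * h + real (i - n) * h')) [0..<n + m] ! i
     = (replicate n h @ replicate m h') ! i"
    using i by cases (auto simp: nth_append algebra_simps of_nat_diff)
qed simp

text \<open>One family of Euler operators, with equally many steps for s and then for t, is
  evaluated in two ways: as a scheme for s + t, and as a scheme for s applied to the scheme for
  t.\<close>

lemma chapman_kolmogorov:
  assumes s: "s \<ge> 0" and t: "t \<ge> 0"
  shows "P (s + t) x = P s x \<bind> P t"
proof -
  have Pt: "P t \<in> borel \<rightarrow>\<^sub>M subprob_algebra borel"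
    by (intro measurable_prob_algebraD P_measurable t)
  have Pts: "P t \<in> P s x \<rightarrow>\<^sub>M subprob_algebra borel"
    using Pt measurable_cong_sets[OF sets_P refl, of s x] by blast
  consider "s = 0" | "t = 0" | "s > 0" "t > 0" using s t by linarith
  then show ?thesis
  proof cases
    case 1
    then show ?thesis using bind_return[OF Pt, of x] by (simp add: P_0)
  next
    case 2
    have "P s x \<bind> return (P s x) = P s x" by (rule bind_return')
    moreover have "return (P s x) = return borel" by (intro return_sets_cong sets_P)
    ultimately show ?thesis using 2 by (simp add: P_0[abs_def])
  next
    case 3
    show ?thesis
    proof (rule measure_eqI_lipschitz[OF prob_P])
      show "s + t \<ge> 0" using s t by simp
      show "sets (P s x \<bind> P t) = sets borel" by (subst sets_bind[where N=borel]) auto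
      show "prob_space (P s x \<bind> P t)"
      proof (rule prob_space_bind'[where N=borel])
        show "P s x \<in> space (prob_algebra borel)"
          using prob_P[OF s] by (simp add: space_prob_algebra)
      qed (rule P_measurable[OF t])
    next
      fix f :: "state \<Rightarrow> real" and D
      assume f: "f \<in> borel_measurable borel" "\<And>x. 0 \<le> f x" "\<And>x. f x \<le> 1" "D \<ge> 0" "\<And>x y. \<bar>f x - f y\<bar> \<le> D * dist x y"
      then have lip: "\<And>x y. \<bar>f x - f y\<bar> \<le> D * norm (x - y)" by (simp add: dist_norm)
      have fb: "bmeas f 1" using f by (simp add: bmeas_def)
      have fc: "continuous_on UNIV f" by (rule lipschitz_continuous[OF f(4) lip])
      let ?g' = "\<lambda>y. \<integral>z. f z \<partial>P t y"
      let ?g = "\<lambda>k. eulers (replicate (Suc k) (t / Suc k)) f"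
      \<comment> \<open>The inner approximations share one Lipschitz constant, which upgrades their
        pointwise convergence to continuous convergence.\<close>
      have glip: "\<bar>?g k x - ?g k y\<bar> \<le> D * exp (L * t) * norm (x - y)" for k x y
      proof -
        have "sum_list (replicate (Suc k) (t / Suc k)) = t" by (simp only: sum_list_replicate) simp
        with eulers_lipschitz[OF fb lip f(4), of "replicate (Suc k) (t / Suc k)" x y] t
        show ?thesis by (auto simp del: replicate_Suc)
      qed
      have one: "(\<lambda>k. eulers (replicate (Suc k) (s / Suc k)) (?g k) x) \<longlonglongrightarrow> (\<integral>\<omega>. ?g' (X x s \<omega>) \<partial>M)"
      proof (rule eulers_uniform_limit[OF 3(1) bmeas_eulers[OF fb]])
        show g'm: "?g' \<in> borel_measurable borel"
          using measurable_compose[OF Pt integral_measurable_subprob_algebra[OF f(1)]] by simp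
        fix u y assume u: "u \<longlonglongrightarrow> (y::state)"
        have "(\<lambda>k. D * exp (L * t) * norm (u k - y)) \<longlonglongrightarrow> D * exp (L * t) * norm (y - y)"
          by (intro tendsto_intros u)
        then have "(\<lambda>k. D * exp (L * t) * norm (u k - y)) \<longlonglongrightarrow> 0" by simp
        then have "(\<lambda>k. ?g k (u k) - ?g k y) \<longlonglongrightarrow> 0"
          by (rule Lim_null_comparison[rotated]) (use glip in \<open>simp del: replicate_Suc\<close>)
        from tendsto_add[OF this eulers_limit[OF 3(2) fb fc, of y]]
        show "(\<lambda>k. ?g k (u k)) \<longlonglongrightarrow> ?g' y" by simp
      qed
      \<comment> \<open>The concatenated grid, which is uniform in each phase but not over the whole
        interval.\<close>
      let ?s = "\<lambda>k i. if i \<le> Suc k then real i * (s / Suc k) else Suc k * (s / Suc k) + real (i - Suc k) * (t / Suc k)"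
      have d: "?s k (Suc i) - ?s k i = s / Suc k \<or> ?s k (Suc i) - ?s k i = t / Suc k" for k i
      proof -
        consider "i < Suc k" | "i = Suc k" | "i > Suc k" by linarith
        then show ?thesis by cases (auto simp: algebra_simps of_nat_diff add_divide_distrib diff_divide_distrib)
      qed
      have two: "(\<lambda>k. eulers (map (\<lambda>i. ?s k (Suc i) - ?s k i) [0..<Suc k + Suc k]) f x) \<longlonglongrightarrow> (\<integral>\<omega>. f (X x (s + t) \<omega>) \<partial>M)"
      proof (rule eulers_expectation_limit[OF _ _ _ _ _ LIMSEQ_divide_Suc fb f(1) continuous_lim[OF fc]])
        show "?s k i < ?s k (Suc i)" for k i
        proof -
          have "s / Suc k > 0" "t / Suc k > 0" using 3 by auto
          with d[of i k] show ?thesis by linarith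
        qed
        show "?s k (Suc i) - ?s k i \<le> (s + t) / real (Suc k)" for k i
        proof -
          have "s / Suc k \<le> (s + t) / Suc k" "t / Suc k \<le> (s + t) / Suc k"
            using 3 by (auto intro: divide_right_mono)
          with d[of i k] show ?thesis by linarith
        qed
      qed (use s t in auto)
      have "map (\<lambda>i. ?s k (Suc i) - ?s k i) [0..<Suc k + Suc k] = replicate (Suc k) (s / Suc k) @ replicate (Suc k) (t / Suc k)" for k
        by (rule map_two_phase)
      then have "(\<integral>\<omega>. f (X x (s + t) \<omega>) \<partial>M) = (\<integral>\<omega>. ?g' (X x s \<omega>) \<partial>M)"
        using LIMSEQ_unique[OF two] one by (simp only: eulers_append)
      also have "\<dots> = (\<integral>y. ?g' y \<partial>P s x)"
        using measurable_compose[OF Pt integral_measurable_subprob_algebra[OF f(1)]]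
        by (subst integral_P[OF s]) auto
      also have "\<dots> = (\<integral>z. f z \<partial>(P s x \<bind> P t))"
        using f prob_space.emeasure_space_1[OF prob_P[OF t]]
        by (intro integral_bind[symmetric, where K=borel and B=1 and B'=1] Pts prob_space.finite_measure[OF prob_P[OF s]])
           (auto simp: abs_le_iff intro: order_trans[OF _ f(2)])
      finally show "(\<integral>x. f x \<partial>P (s + t) x) = (\<integral>x. f x \<partial>(P s x \<bind> P t))"
        using s t f(1) by (simp add: integral_P)
    qed auto
  qed
qed

section \<open>Harnack inequality and minorization for the transition probabilities\<close>

text \<open>Both sides are limits of the discrete inequality. Its constant does not depend on the
  number of steps.\<close>

lemma harnack:
  assumes t: "t > 0" and r: "r \<ge> 0"
  shows "\<exists>c. \<forall>f B x y. bmeas f B \<longrightarrow> continuous_on UNIV f \<longrightarrow> norm (x - y) \<le> r \<longrightarrow>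
    (\<integral>z. f z \<partial>P t x)\<^sup>2 \<le> exp c * (\<integral>z. (f z)\<^sup>2 \<partial>P t y)"
proof -
  from eulers_harnack[OF t r] obtain c where
    c: "\<And>n f B x y. n \<ge> 2 \<Longrightarrow> bmeas f B \<Longrightarrow> norm (x - y) \<le> r \<Longrightarrow>
      (eulers (replicate n (t / n)) f x)\<^sup>2 \<le> exp c * eulers (replicate n (t / n)) (\<lambda>x. (f x)\<^sup>2) y" by blast
  have "(\<integral>z. f z \<partial>P t x)\<^sup>2 \<le> exp c * (\<integral>z. (f z)\<^sup>2 \<partial>P t y)"
    if f: "bmeas f B" "continuous_on UNIV f" and xy: "norm (x - y) \<le> r" for f B x y
  proof (rule LIMSEQ_le)
    show "(\<lambda>k. (eulers (replicate (Suc k) (t / Suc k)) f x)\<^sup>2) \<longlonglongrightarrow> (\<integral>z. f z \<partial>P t x)\<^sup>2"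
      by (intro tendsto_intros eulers_limit[OF t f])
    show "(\<lambda>k. exp c * eulers (replicate (Suc k) (t / Suc k)) (\<lambda>x. (f x)\<^sup>2) y) \<longlonglongrightarrow> exp c * (\<integral>z. (f z)\<^sup>2 \<partial>P t y)"
      by (intro tendsto_mult_left eulers_limit[OF t bmeas_square[OF f(1)]] continuous_intros f(2))
    show "\<exists>N. \<forall>k\<ge>N. (eulers (replicate (Suc k) (t / Suc k)) f x)\<^sup>2
        \<le> exp c * eulers (replicate (Suc k) (t / Suc k)) (\<lambda>x. (f x)\<^sup>2) y"
      \<comment> \<open>The discrete inequality needs at least two steps, that is k at least
        1.\<close>
      by (intro exI[of _ 1] allI impI c[OF _ f(1) xy]) auto
  qed
  then show ?thesis by blast
qed

lemma harnack_closed: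
  assumes t: "t > 0" and H: "\<And>f B. bmeas f B \<Longrightarrow> continuous_on UNIV f \<Longrightarrow>
      (\<integral>z. f z \<partial>P t x)\<^sup>2 \<le> exp c * (\<integral>z. (f z)\<^sup>2 \<partial>P t y)" and F: "closed F"
  shows "(measure (P t x) F)\<^sup>2 \<le> exp c * measure (P t y) F"
proof (cases "F = {}")
  case False
  define \<phi> where "\<phi> = cutoff F"
  note cut = cutoff[OF F False, folded \<phi>_def]
  have [measurable]: "F \<in> sets borel" using F by (rule borel_closed)
  have cont: "continuous_on UNIV (\<phi> k)" for k
    unfolding \<phi>_def by (rule continuous_cutoff)
  have m[measurable]: "\<phi> k \<in> borel_measurable borel" for k
    by (intro borel_measurable_continuous_onI cont)
  have bm\<phi>: "bmeas (\<phi> k) 1" for k using cut(1,2) m unfolding bmeas_def by blast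
  interpret x: prob_space "P t x" using t by (intro prob_P) auto
  interpret y: prob_space "P t y" using t by (intro prob_P) auto
  have "(\<lambda>k. \<integral>z. \<phi> k z \<partial>P t x) \<longlonglongrightarrow> (\<integral>z. indicator F z \<partial>P t x)"
    using cut F by (intro integral_dominated_convergence[where w="\<lambda>_. 1"]) auto
  then have l1: "(\<lambda>k. \<integral>z. \<phi> k z \<partial>P t x) \<longlonglongrightarrow> measure (P t x) F" by simp
  have "(\<lambda>k. \<integral>z. (\<phi> k z)\<^sup>2 \<partial>P t y) \<longlonglongrightarrow> (\<integral>z. (indicator F z)\<^sup>2 \<partial>P t y)"
  proof (rule integral_dominated_convergence[where w="\<lambda>_. 1"])
    show "AE z in P t y. norm ((\<phi> k z)\<^sup>2) \<le> 1" for k using cut(1,2) by (auto intro!: power_le_one)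
    show "AE z in P t y. (\<lambda>k. (\<phi> k z)\<^sup>2) \<longlonglongrightarrow> (indicator F z)\<^sup>2"
      by (intro AE_I2 tendsto_intros cut(5))
  qed (use F in auto)
  moreover have "(\<integral>z. (indicator F z)\<^sup>2 \<partial>P t y) = measure (P t y) F"
  proof -
    have "(\<lambda>z. (indicator F z :: real)\<^sup>2) = indicator F" by (auto simp: indicator_def)
    then show ?thesis by simp
  qed
  ultimately have l2: "(\<lambda>k. \<integral>z. (\<phi> k z)\<^sup>2 \<partial>P t y) \<longlonglongrightarrow> measure (P t y) F" by simp
  show ?thesis
    by (rule LIMSEQ_le[OF tendsto_power[OF l1] tendsto_mult_left[OF l2]])
       (use H[OF bm\<phi> cont] in auto)
qed simp

text \<open>Inner regularity by compact sets extends the inequality from closed sets to Borel sets: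
  the square root of the right-hand side for A bounds the measure of every compact subset.\<close>

lemma harnack_measurable:
  assumes t: "t > 0" and H: "\<And>f B. bmeas f B \<Longrightarrow> continuous_on UNIV f \<Longrightarrow>
      (\<integral>z. f z \<partial>P t x)\<^sup>2 \<le> exp c * (\<integral>z. (f z)\<^sup>2 \<partial>P t y)" and A: "A \<in> sets borel"
  shows "(measure (P t x) A)\<^sup>2 \<le> exp c * measure (P t y) A"
proof -
  interpret x: prob_space "P t x" using t by (intro prob_P) auto
  interpret y: prob_space "P t y" using t by (intro prob_P) auto
  let ?a = "sqrt (exp c * measure (P t y) A)"
  have "measure (P t x) K \<le> ?a" if K: "compact K" "K \<subseteq> A" for K
  proof (rule real_le_rsqrt)
    have "(measure (P t x) K)\<^sup>2 \<le> exp c * measure (P t y) K"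
      by (rule harnack_closed[OF t H compact_imp_closed[OF K(1)]])
    also have "\<dots> \<le> exp c * measure (P t y) A"
      using K A by (intro mult_left_mono y.finite_measure_mono) auto
    finally show "(measure (P t x) K)\<^sup>2 \<le> exp c * measure (P t y) A" .
  qed
  then have "emeasure (P t x) K \<le> ennreal ?a" if "compact K" "K \<subseteq> A" for K
    using that by (simp add: x.emeasure_eq_measure ennreal_leI)
  moreover have "emeasure (P t x) A = (SUP K\<in>{K. K \<subseteq> A \<and> compact K}. emeasure (P t x) K)"
    using A by (intro inner_regular) (auto simp: x.emeasure_space_1)
  ultimately have "emeasure (P t x) A \<le> ennreal ?a" by (auto intro!: SUP_least)
  then have "measure (P t x) A \<le> ?a" by (simp add: x.emeasure_eq_measure)
  then have "(measure (P t x) A)\<^sup>2 \<le> ?a\<^sup>2" by (intro power_mono) auto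
  then show ?thesis by simp
qed

text \<open>Applied to indicators, the Harnack inequality says that an event likely from x cannot be
  too unlikely from y. This already bounds the total variation distance away from one, uniformly
  over pairs at distance at most r.\<close>

lemma minorization:
  assumes t: "t > 0" and r: "r \<ge> 0"
  shows "\<exists>\<epsilon>. 0 < \<epsilon> \<and> \<epsilon> < 1 \<and> (\<forall>x y A. norm (x - y) \<le> r \<longrightarrow> A \<in> sets borel \<longrightarrow>
    measure (P t x) A \<le> measure (P t y) A + (1 - \<epsilon>))"
proof -
  from harnack[OF t r] obtain c where c: "\<And>f B x y. bmeas f B \<Longrightarrow> continuous_on UNIV f \<Longrightarrow> norm (x - y) \<le> r \<Longrightarrow>
    (\<integral>z. f z \<partial>P t x)\<^sup>2 \<le> exp c * (\<integral>z. (f z)\<^sup>2 \<partial>P t y)" by blast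
  \<comment> \<open>The summand 2 makes e less than 1/2, so that a - e a^2 increases on the unit
    interval and is at most its value 1 - e at a = 1.\<close>
  define e where "e = 1 / (exp c + 2)"
  have e: "0 < e" "e < 1/2" by (auto simp: e_def field_simps add_pos_pos)
  have "measure (P t x) A \<le> measure (P t y) A + (1 - e)" if xy: "norm (x - y) \<le> r" and A: "A \<in> sets borel" for x y A
  proof -
    interpret x: prob_space "P t x" using t by (intro prob_P) auto
    let ?a = "measure (P t x) A" and ?p = "measure (P t y) A"
    have a: "0 \<le> ?a" "?a \<le> 1" by auto
    have "?a\<^sup>2 \<le> exp c * ?p" by (rule harnack_measurable[OF t c[OF _ _ xy] A])
    also have "\<dots> \<le> (exp c + 2) * ?p" by (intro mult_right_mono) auto
    finally have "e * ?a\<^sup>2 \<le> ?p" by (simp add: e_def divide_le_eq mult.commute add_pos_pos)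
    moreover have "?a - e * ?a\<^sup>2 \<le> 1 - e"
    proof -
      have "e * (1 + ?a) \<le> 1/2 * 2" using e a by (intro mult_mono) auto
      then have "(1 - ?a) * (e * (1 + ?a)) \<le> (1 - ?a) * 1" using a by (intro mult_left_mono) auto
      then show ?thesis by (simp add: algebra_simps power2_eq_square)
    qed
    ultimately show ?thesis by linarith
  qed
  with e show ?thesis by (intro exI[of _ e]) auto
qed

end

section \<open>Moments\<close>

text \<open>Jensen's inequality for weights of total mass W, which are normalized inside the
  proof.\<close>

lemma jensen_power:
  fixes q y :: "nat \<Rightarrow> real"
  assumes "finite I" "(\<Sum>i\<in>I. q i) = W" "W > 0" "\<And>i. i \<in> I \<Longrightarrow> q i \<ge> 0" "\<And>i. i \<in> I \<Longrightarrow> y i \<ge> 0"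
  shows "(\<Sum>i\<in>I. q i * y i) ^ k \<le> W ^ k * (\<Sum>i\<in>I. q i / W * y i ^ k)"
proof -
  have "I \<noteq> {}" using assms by auto
  have cv: "convex_on {0..} (\<lambda>x::real. x ^ k)"     using convex_on_subset[OF convex_power_even[of k], of "{0..}"] convex_power_odd[of k] by auto
  have "(\<Sum>i\<in>I. (q i / W) *\<^sub>R y i) ^ k \<le> (\<Sum>i\<in>I. q i / W * y i ^ k)"
    by (rule convex_on_sum[OF assms(1) \<open>I \<noteq> {}\<close> cv, of "\<lambda>i. q i / W" y])
       (use assms in \<open>auto simp: sum_divide_distrib[symmetric]\<close>)
  then have "W ^ k * (\<Sum>i\<in>I. (q i / W) * y i) ^ k \<le> W ^ k * (\<Sum>i\<in>I. q i / W * y i ^ k)"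
    using assms by (intro mult_left_mono) auto
  moreover have "W ^ k * (\<Sum>i\<in>I. (q i / W) * y i) ^ k = (\<Sum>i\<in>I. q i * y i) ^ k"
    using assms(3) by (simp add: power_mult_distrib[symmetric] sum_distrib_left)
  ultimately show ?thesis by simp
qed

text \<open>Keeps the constant in front of the main term arbitrarily close to one, for exponents
  below and above one alike. If g is small relative to a it is absorbed into a, otherwise a is
  absorbed into g.\<close>

lemma powr_add_le:
  fixes \<delta> \<theta> :: real
  assumes \<delta>: "\<delta> > 0" and \<theta>: "\<theta> > 0"
  shows "\<exists>D\<ge>0. \<forall>a\<ge>0. \<forall>g\<ge>0. (a + g) powr \<delta> \<le> (1 + \<theta>) * a powr \<delta> + D * g powr \<delta>"
proof -
  \<comment> \<open>The threshold ratio of g to a, chosen so that (1 + z) to the power \<delta> is 1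
    + \<theta>.\<close>
  define z where "z = (1 + \<theta>) powr (1 / \<delta>) - 1"
  have "(1 + \<theta>) powr (1 / \<delta>) > (1 + \<theta>) powr 0" using \<delta> \<theta> by (intro powr_less_mono) auto
  then have z: "z > 0" using \<theta> by (simp add: z_def)
  have z1: "(1 + z) powr \<delta> = 1 + \<theta>" using \<delta> \<theta> by (simp add: z_def powr_powr)
  have "(a + g) powr \<delta> \<le> (1 + \<theta>) * a powr \<delta> + (1 / z + 1) powr \<delta> * g powr \<delta>" if "a \<ge> 0" "g \<ge> 0" for a g
  proof (cases "g \<le> z * a")
    case True
    have "(a + g) powr \<delta> \<le> ((1 + z) * a) powr \<delta>"
      using True that \<delta> by (intro powr_mono2) (auto simp: algebra_simps)
    also have "\<dots> = (1 + \<theta>) * a powr \<delta>" using that z by (simp add: powr_mult z1)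
    finally show ?thesis using add_increasing2[of "(1 / z + 1) powr \<delta> * g powr \<delta>"] by simp
  next
    case False
    then have "a \<le> g / z" using z by (simp add: field_simps)
    then have "(a + g) powr \<delta> \<le> ((1 / z + 1) * g) powr \<delta>"
      using that \<delta> by (intro powr_mono2) (auto simp: algebra_simps)
    also have "\<dots> = (1 / z + 1) powr \<delta> * g powr \<delta>" using that z by (simp add: powr_mult)
    finally show ?thesis using \<theta> add_increasing[of "(1 + \<theta>) * a powr \<delta>"] by simp
  qed
  then show ?thesis by (intro exI[of _ "(1 / z + 1) powr \<delta>"]) auto
qed

text \<open>Lets an integer moment of the noise stand in for the real exponent.\<close>

lemma powr_le_1_plus_power:
  assumes "g \<ge> 0" "real k \<ge> \<delta>" "\<delta> > 0"
  shows "g powr \<delta> \<le> 1 + g ^ k"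
proof (cases "g \<le> 1")
  case True
  then have "g powr \<delta> \<le> 1 powr \<delta>" using assms by (intro powr_mono2) auto
  then show ?thesis using assms by (simp add: add_increasing2)
next
  case False
  then have "g powr \<delta> \<le> g powr real k" using assms by (intro powr_mono) auto
  then show ?thesis using False by (simp add: powr_realpow)
qed

lemma add3_power_le:
  fixes a c d :: real
  assumes "a \<ge> 0" "c \<ge> 0" "d \<ge> 0"
  shows "(a + c + d) ^ k \<le> 3 ^ k * (a ^ k + c ^ k + d ^ k)"
proof -
  define m where "m = max a (max c d)"
  have m: "m \<ge> 0" "a + c + d \<le> 3 * m" using assms by (auto simp: m_def)
  have "(a + c + d) ^ k \<le> (3 * m) ^ k" using assms m by (intro power_mono) auto
  also have "\<dots> = 3 ^ k * m ^ k" by (rule power_mult_distrib)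
  also have "m ^ k \<le> a ^ k + c ^ k + d ^ k"
    using assms zero_le_power[OF assms(1), of k] zero_le_power[OF assms(2), of k] zero_le_power[OF assms(3), of k]
    by (auto simp: m_def max_def)
  finally show ?thesis by simp
qed

section \<open>Moments of the noise\<close>

lemma nn_integral_gauss_moment: "(\<integral>\<^sup>+z. ennreal ((z\<^sup>2) ^ k) \<partial>gauss) < \<infinity>"
proof -
  have i: "integrable lborel (\<lambda>x. std_normal_density x * x ^ (2 * k))"
    using integrable_normal_moment[of 1 0 "2 * k"] by simp
  have "(\<integral>\<^sup>+z. ennreal ((z\<^sup>2) ^ k) \<partial>gauss) = (\<integral>\<^sup>+z. ennreal (std_normal_density z * z ^ (2 * k)) \<partial>lborel)"
    by (subst nn_integral_gauss) (auto simp: ennreal_mult[symmetric] power_mult)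
  also have "\<dots> < \<infinity>" using i by (subst nn_integral_eq_integral) auto
  finally show ?thesis .
qed

lemma brownian2_moment:
  assumes bm: "brownian2 M w0 w1" and u: "0 \<le> u" "u \<le> t" and k: "k > 0" and v: "v = w0 \<or> v = w1"
  shows "(\<integral>\<^sup>+\<omega>. ennreal (((v u \<omega>)\<^sup>2) ^ k) \<partial>M) \<le> ennreal (t ^ k) * (\<integral>\<^sup>+z. ennreal ((z\<^sup>2) ^ k) \<partial>gauss)"
proof -
  have v0: "v 0 \<omega> = 0" if "\<omega> \<in> space M" for \<omega> using bm v that by (auto simp: brownian2_def)
  show ?thesis
  proof (cases "u = 0")
    \<comment> \<open>A grid needs distinct times, so time 0 is treated apart; there the path
      vanishes.\<close>
    case True
    have "(\<integral>\<^sup>+\<omega>. ennreal (((v u \<omega>)\<^sup>2) ^ k) \<partial>M) = (\<integral>\<^sup>+\<omega>. 0 \<partial>M)"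
      using True v0 k by (intro nn_integral_cong) (auto simp: zero_power)
    then show ?thesis by simp
  next
    case False
    define j :: nat where "j = (if v = w0 then 0 else 1)"
    let ?inc = "\<lambda>p \<omega>. increment (\<lambda>t. w0 t \<omega>) (\<lambda>t. w1 t \<omega>) (\<lambda>i. real i * u) p"
    have "distr M borel (?inc (j, 0)) = distr gauss borel (\<lambda>z. sqrt (real (Suc 0) * u - real 0 * u) * z)"
      using False u by (intro brownian2_increments(2)[OF bm, of _ 1]) (auto simp: j_def)
    then have d: "distr M borel (?inc (j, 0)) = distr gauss borel (\<lambda>z. sqrt u * z)" by simp
    have m: "?inc (j, 0) \<in> borel_measurable M"
      using False u by (intro brownian2_increments(3)[OF bm, of _ 1]) auto
    have "(\<integral>\<^sup>+\<omega>. ennreal (((v u \<omega>)\<^sup>2) ^ k) \<partial>M) = (\<integral>\<^sup>+\<omega>. ennreal (((?inc (j, 0) \<omega>)\<^sup>2) ^ k) \<partial>M)"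
      using v v0 by (intro nn_integral_cong) (auto simp: increment_def j_def)
    also have "\<dots> = (\<integral>\<^sup>+z. ennreal ((z\<^sup>2) ^ k) \<partial>distr M borel (?inc (j, 0)))"
      by (subst nn_integral_distr[OF m]) auto
    also have "\<dots> = (\<integral>\<^sup>+z. ennreal (((sqrt u * z)\<^sup>2) ^ k) \<partial>gauss)"
      unfolding d by (subst nn_integral_distr) auto
    also have "\<dots> = (\<integral>\<^sup>+z. ennreal (u ^ k) * ennreal ((z\<^sup>2) ^ k) \<partial>gauss)"
      using u by (intro nn_integral_cong) (auto simp: power_mult_distrib ennreal_mult[symmetric])
    also have "\<dots> = ennreal (u ^ k) * (\<integral>\<^sup>+z. ennreal ((z\<^sup>2) ^ k) \<partial>gauss)"
      by (rule nn_integral_cmult) auto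
    also have "\<dots> \<le> ennreal (t ^ k) * (\<integral>\<^sup>+z. ennreal ((z\<^sup>2) ^ k) \<partial>gauss)"
      using u by (intro mult_right_mono ennreal_leI power_mono) auto
    finally show ?thesis .
  qed
qed

text \<open>In \<open>N_step\<close> the drift is evaluated at z + v while only z is updated: this
  is the recursion of the scheme with the accumulated noise v removed.\<close>

locale lyapunov_flow = kinetic_flow b L s0 s1 M w0 w1 X
  for b L s0 s1 and M :: "'w measure" and w0 w1 X +
  fixes N :: "state \<Rightarrow> real" and lam C c2 h0 :: real
  assumes N_continuous: "continuous_on UNIV N" and N_nonneg: "N x \<ge> 0"
    and N_le: "N x \<le> c2 * (norm x)\<^sup>2"
    and N_add: "\<eta> > 0 \<Longrightarrow> N (x + y) \<le> (1 + \<eta>) * N x + (1 + 1 / \<eta>) * N y"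
    and N_step: "0 \<le> h \<Longrightarrow> h \<le> h0 \<Longrightarrow> N (z + h *\<^sub>R b (z + v)) \<le> (1 - lam * h) * N z + C * h * (1 + (norm v)\<^sup>2)"
    and constants: "lam > 0" "C \<ge> 0" "c2 \<ge> 0" "h0 > 0" "lam * h0 \<le> 1"
begin

lemma N_measurable[measurable]: "N \<in> borel_measurable borel"
  by (intro borel_measurable_continuous_onI N_continuous)

definition noise_sq :: "real \<Rightarrow> 'w \<Rightarrow> real" where
  "noise_sq u \<omega> = s0\<^sup>2 * (w0 u \<omega>)\<^sup>2 + s1\<^sup>2 * (w1 u \<omega>)\<^sup>2"

lemma noise_sq_nonneg: "noise_sq u \<omega> \<ge> 0" by (simp add: noise_sq_def)

lemma noise_sq_measurable[measurable]: "noise_sq u \<in> borel_measurable M"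
proof -
  have [measurable]: "w0 t \<in> borel_measurable M" "w1 t \<in> borel_measurable M" for t
    using bm by (auto simp: brownian2_def)
  show ?thesis unfolding noise_sq_def[abs_def] by measurable
qed

lemma noise_sq_moment:
  assumes k: "k > 0" and t: "t \<ge> 0"
  shows "\<exists>m\<ge>0. \<forall>u. 0 \<le> u \<longrightarrow> u \<le> t \<longrightarrow> (\<integral>\<^sup>+\<omega>. ennreal ((1 + noise_sq u \<omega>) ^ k) \<partial>M) \<le> ennreal m"
proof -
  have [measurable]: "w0 t \<in> borel_measurable M" "w1 t \<in> borel_measurable M" for t
    using bm by (auto simp: brownian2_def)
  let ?m = "\<integral>\<^sup>+z. ennreal ((z\<^sup>2) ^ k) \<partial>gauss"
  obtain mm where mm: "?m = ennreal mm" "mm \<ge> 0"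
    using nn_integral_gauss_moment[of k] by (cases ?m) auto
  define m where "m = 3 ^ k * (1 + (s0\<^sup>2) ^ k * (t ^ k * mm) + (s1\<^sup>2) ^ k * (t ^ k * mm))"
  have "(\<integral>\<^sup>+\<omega>. ennreal ((1 + noise_sq u \<omega>) ^ k) \<partial>M) \<le> ennreal m" if u: "0 \<le> u" "u \<le> t" for u
  proof -
    have "(\<integral>\<^sup>+\<omega>. ennreal ((1 + noise_sq u \<omega>) ^ k) \<partial>M)
      \<le> (\<integral>\<^sup>+\<omega>. ennreal (3 ^ k) * (1 + ennreal ((s0\<^sup>2) ^ k) * ennreal (((w0 u \<omega>)\<^sup>2) ^ k) + ennreal ((s1\<^sup>2) ^ k) * ennreal (((w1 u \<omega>)\<^sup>2) ^ k)) \<partial>M)"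
    proof (rule nn_integral_mono)
      fix \<omega>
      have "(1 + s0\<^sup>2 * (w0 u \<omega>)\<^sup>2 + s1\<^sup>2 * (w1 u \<omega>)\<^sup>2) ^ k
        \<le> 3 ^ k * (1 ^ k + (s0\<^sup>2 * (w0 u \<omega>)\<^sup>2) ^ k + (s1\<^sup>2 * (w1 u \<omega>)\<^sup>2) ^ k)"
        by (rule add3_power_le) auto
      then show "ennreal ((1 + noise_sq u \<omega>) ^ k)
        \<le> ennreal (3 ^ k) * (1 + ennreal ((s0\<^sup>2) ^ k) * ennreal (((w0 u \<omega>)\<^sup>2) ^ k) + ennreal ((s1\<^sup>2) ^ k) * ennreal (((w1 u \<omega>)\<^sup>2) ^ k))"
        by (simp add: noise_sq_def add.assoc power_mult_distrib ennreal_mult[symmetric] ennreal_plus[symmetric]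
            ennreal_1[symmetric] ennreal_leI del: ennreal_plus ennreal_1)
    qed
    also have "\<dots> = ennreal (3 ^ k) * (1 + ennreal ((s0\<^sup>2) ^ k) * (\<integral>\<^sup>+\<omega>. ennreal (((w0 u \<omega>)\<^sup>2) ^ k) \<partial>M)
        + ennreal ((s1\<^sup>2) ^ k) * (\<integral>\<^sup>+\<omega>. ennreal (((w1 u \<omega>)\<^sup>2) ^ k) \<partial>M))"
      by (simp add: nn_integral_cmult nn_integral_add M.emeasure_space_1)
    also have "\<dots> \<le> ennreal (3 ^ k) * (1 + ennreal ((s0\<^sup>2) ^ k) * (ennreal (t ^ k) * ?m) + ennreal ((s1\<^sup>2) ^ k) * (ennreal (t ^ k) * ?m))"
      using brownian2_moment[OF bm u k] by (intro mult_left_mono add_mono order_refl) auto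
    also have "\<dots> = ennreal m"
      using mm t by (simp add: m_def ennreal_mult[symmetric] ennreal_plus[symmetric]
            ennreal_1[symmetric] del: ennreal_plus ennreal_1)
    finally show ?thesis .
  qed
  moreover have "m \<ge> 0" using mm t by (simp add: m_def)
  ultimately show ?thesis by blast
qed

section \<open>Decay of the Lyapunov function along the scheme\<close>

definition noise_vec :: "real \<Rightarrow> 'w \<Rightarrow> state" where
  "noise_vec u \<omega> = (s0 * w0 u \<omega>, 0, s1 * w1 u \<omega>, 0)"

lemma norm_noise_vec: "(norm (noise_vec u \<omega>))\<^sup>2 = noise_sq u \<omega>"
  by (simp add: noise_vec_def noise_sq_def power2_norm_state power_mult_distrib)

text \<open>Subtracting the accumulated noise from the scheme removes the increments from the
  recursion, so the one-step bound iterates for each path and no conditional expectation is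
  taken.\<close>

lemma N_epath:
  assumes \<omega>: "\<omega> \<in> space M" and h: "0 \<le> h" "h \<le> h0"
  defines "s \<equiv> \<lambda>i. real i * h"
  shows "N (epath (\<lambda>i. s (Suc i) - s i) (path_increment s \<omega>) x n - noise_vec (s n) \<omega>)
    \<le> (1 - lam * h) ^ n * N x + (\<Sum>j<n. C * h * (1 + noise_sq (s j) \<omega>))"
proof (induction n)
  case 0
  have "w0 0 \<omega> = 0" "w1 0 \<omega> = 0" using bm \<omega> by (auto simp: brownian2_def)
  then show ?case by (simp add: noise_vec_def s_def zero_prod_def[symmetric])
next
  case (Suc n)
  let ?Y = "epath (\<lambda>i. s (Suc i) - s i) (path_increment s \<omega>) x"
  let ?Z = "?Y n - noise_vec (s n) \<omega>"
  have d: "s (Suc n) - s n = h" by (simp add: s_def algebra_simps)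
  have l: "0 \<le> 1 - lam * h" "1 - lam * h \<le> 1"
  proof -
    have "lam * h \<le> lam * h0" using constants h by (intro mult_left_mono) auto
    then show "0 \<le> 1 - lam * h" using constants by linarith
    show "1 - lam * h \<le> 1" using constants h by simp
  qed
  have "noise_vec (s (Suc n)) \<omega> = noise_vec (s n) \<omega> + (s0 * path_increment s \<omega> (0, n), 0, s1 * path_increment s \<omega> (1, n), 0)"
    by (simp add: noise_vec_def increment_def algebra_simps)
  then have "?Y (Suc n) - noise_vec (s (Suc n)) \<omega> = ?Z + h *\<^sub>R b (?Z + noise_vec (s n) \<omega>)"
    using d by (simp del: add_Pair)
  then have "N (?Y (Suc n) - noise_vec (s (Suc n)) \<omega>) \<le> (1 - lam * h) * N ?Z + C * h * (1 + noise_sq (s n) \<omega>)"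
    using N_step[OF h, of ?Z "noise_vec (s n) \<omega>"] by (simp only: norm_noise_vec)
  also have "(1 - lam * h) * N ?Z \<le> (1 - lam * h) * ((1 - lam * h) ^ n * N x + (\<Sum>j<n. C * h * (1 + noise_sq (s j) \<omega>)))"
    by (intro mult_left_mono Suc l)
  also have "\<dots> = (1 - lam * h) ^ Suc n * N x + (1 - lam * h) * (\<Sum>j<n. C * h * (1 + noise_sq (s j) \<omega>))"
    by (simp add: algebra_simps)
  also have "(1 - lam * h) * (\<Sum>j<n. C * h * (1 + noise_sq (s j) \<omega>)) \<le> 1 * (\<Sum>j<n. C * h * (1 + noise_sq (s j) \<omega>))"
    using l constants h noise_sq_nonneg by (intro mult_right_mono sum_nonneg) (auto intro!: mult_nonneg_nonneg add_nonneg_nonneg)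
  finally show ?case by simp
qed

text \<open>Adding the noise back costs a factor 1 + \<eta> on the decaying term. The final noise
  joins the sum as its term j = n with weight 1 in place of t / n, so the weights add up to t +
  1.\<close>

lemma N_epath_exponential:
  assumes \<omega>: "\<omega> \<in> space M" and t: "t > 0" and n: "n > 0" "t / n \<le> h0" and \<eta>: "\<eta> > 0"
  defines "s \<equiv> \<lambda>i. real i * (t / n)"
  shows "N (epath (\<lambda>i. s (Suc i) - s i) (path_increment s \<omega>) x n)
    \<le> (1 + \<eta>) * exp (- lam * t) * N x +
       ((1 + \<eta>) * C + (1 + 1 / \<eta>) * c2) * (\<Sum>j\<le>n. (if j = n then 1 else t / n) * (1 + noise_sq (s j) \<omega>))"
proof -
  let ?Y = "epath (\<lambda>i. s (Suc i) - s i) (path_increment s \<omega>) x n"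
  let ?v = "noise_vec (s n) \<omega>"
  let ?S = "\<Sum>j<n. t / n * (1 + noise_sq (s j) \<omega>)"
  have S: "?S \<ge> 0" using t noise_sq_nonneg by (intro sum_nonneg) (auto intro!: mult_nonneg_nonneg add_nonneg_nonneg)
  have h: "0 \<le> t / n" using t by simp
  have "lam * (t / n) \<le> lam * h0" using constants n by (intro mult_left_mono) auto
  then have l: "0 \<le> 1 - lam * (t / n)" using constants by linarith
  have "1 - lam * (t / n) \<le> exp (- (lam * (t / n)))" using exp_ge_add_one_self[of "- (lam * (t / n))"] by simp
  then have "(1 - lam * (t / n)) ^ n \<le> exp (- (lam * (t / n))) ^ n" using l by (intro power_mono) auto
  also have "\<dots> = exp (- lam * t)" using n by (simp add: exp_of_nat_mult[symmetric])
  finally have e: "(1 - lam * (t / n)) ^ n * N x \<le> exp (- lam * t) * N x" by (intro mult_right_mono N_nonneg)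
  have "N (?Y - ?v) \<le> (1 - lam * (t / n)) ^ n * N x + (\<Sum>j<n. C * (t / n) * (1 + noise_sq (s j) \<omega>))"
    unfolding s_def by (rule N_epath[OF \<omega> h n(2)])
  also have "(\<Sum>j<n. C * (t / n) * (1 + noise_sq (s j) \<omega>)) = C * ?S"
    by (simp add: sum_distrib_left mult.assoc del: times_divide_eq_left times_divide_eq_right)
  finally have Z: "N (?Y - ?v) \<le> exp (- lam * t) * N x + C * ?S" using e by linarith
  have v: "N ?v \<le> c2 * noise_sq (s n) \<omega>" using N_le[of ?v] by (simp add: norm_noise_vec)
  have "N ?Y \<le> (1 + \<eta>) * N (?Y - ?v) + (1 + 1 / \<eta>) * N ?v"
    using N_add[OF \<eta>, of "?Y - ?v" ?v] by simp
  also have "\<dots> \<le> (1 + \<eta>) * (exp (- lam * t) * N x + C * ?S) + (1 + 1 / \<eta>) * (c2 * noise_sq (s n) \<omega>)"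
    using \<eta> Z v by (intro add_mono mult_left_mono) auto
  also have "\<dots> \<le> (1 + \<eta>) * exp (- lam * t) * N x + ((1 + \<eta>) * C + (1 + 1 / \<eta>) * c2) * (?S + (1 + noise_sq (s n) \<omega>))"
  proof -
    have "(1 + \<eta>) * C * (1 + noise_sq (s n) \<omega>) \<ge> 0" "(1 + 1 / \<eta>) * c2 * ?S \<ge> 0" "(1 + 1 / \<eta>) * c2 \<ge> 0"
      using \<eta> constants S noise_sq_nonneg[of "s n" \<omega>] by auto
    then show ?thesis by (simp add: algebra_simps)
  qed
  also have "?S + (1 + noise_sq (s n) \<omega>) = (\<Sum>j\<le>n. (if j = n then 1 else t / n) * (1 + noise_sq (s j) \<omega>))"
    by (simp add: lessThan_Suc_atMost[symmetric])
  finally show ?thesis .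
qed

text \<open>Jensen's inequality puts the power inside the weighted average over the grid. The total
  weight t + 1 does not depend on n, and neither does the bound.\<close>

lemma weighted_noise_moment:
  assumes t: "0 < t" "t \<le> \<tau>" and n: "n > 0" and k: "k > 0"
    and m: "m \<ge> 0" "\<And>u. 0 \<le> u \<Longrightarrow> u \<le> \<tau> \<Longrightarrow> (\<integral>\<^sup>+\<omega>. ennreal ((1 + noise_sq u \<omega>) ^ k) \<partial>M) \<le> ennreal m"
  shows "(\<integral>\<^sup>+\<omega>. ennreal ((\<Sum>j\<le>n. (if j = n then 1 else t / n) * (1 + noise_sq (real j * (t / n)) \<omega>)) ^ k) \<partial>M)
    \<le> ennreal ((\<tau> + 1) ^ k * m)"
proof -
  let ?q = "\<lambda>j. if j = n then 1 else t / real n"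
  have W: "(\<Sum>j\<le>n. ?q j) = t + 1"
    using n by (simp add: lessThan_Suc_atMost[symmetric])
  have q: "?q j \<ge> 0" for j using t by simp
  have jt: "0 \<le> real j * (t / n) \<and> real j * (t / n) \<le> \<tau>" if "j \<le> n" for j
  proof -
    have "real j * (t / n) \<le> real n * (t / n)" using that t by (intro mult_right_mono) auto
    then show ?thesis using t n by simp
  qed
  have "(\<integral>\<^sup>+\<omega>. ennreal ((\<Sum>j\<le>n. ?q j * (1 + noise_sq (real j * (t / n)) \<omega>)) ^ k) \<partial>M)
    \<le> (\<integral>\<^sup>+\<omega>. ennreal ((t + 1) ^ k) * (\<Sum>j\<le>n. ennreal (?q j / (t + 1)) * ennreal ((1 + noise_sq (real j * (t / n)) \<omega>) ^ k)) \<partial>M)"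
  proof (rule nn_integral_mono)
    fix \<omega>
    have nn: "1 + noise_sq u \<omega> \<ge> 0" for u using noise_sq_nonneg[of u \<omega>] by simp
    have nt: "?q j / (t + 1) \<ge> 0" for j using q t by simp
    have "(\<Sum>j\<le>n. ?q j * (1 + noise_sq (real j * (t / n)) \<omega>)) ^ k
      \<le> (t + 1) ^ k * (\<Sum>j\<le>n. ?q j / (t + 1) * (1 + noise_sq (real j * (t / n)) \<omega>) ^ k)"
      using t q nn by (intro jensen_power W) auto
    then have "ennreal ((\<Sum>j\<le>n. ?q j * (1 + noise_sq (real j * (t / n)) \<omega>)) ^ k)
      \<le> ennreal ((t + 1) ^ k * (\<Sum>j\<le>n. ?q j / (t + 1) * (1 + noise_sq (real j * (t / n)) \<omega>) ^ k))"
      by (rule ennreal_leI)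
    also have "\<dots> = ennreal ((t + 1) ^ k) * ennreal (\<Sum>j\<le>n. ?q j / (t + 1) * (1 + noise_sq (real j * (t / n)) \<omega>) ^ k)"
      using t nt nn by (intro ennreal_mult sum_nonneg mult_nonneg_nonneg zero_le_power) auto
    also have "ennreal (\<Sum>j\<le>n. ?q j / (t + 1) * (1 + noise_sq (real j * (t / n)) \<omega>) ^ k)
      = (\<Sum>j\<le>n. ennreal (?q j / (t + 1) * (1 + noise_sq (real j * (t / n)) \<omega>) ^ k))"
      using nt nn by (intro sum_ennreal[symmetric] mult_nonneg_nonneg zero_le_power) auto
    also have "\<dots> = (\<Sum>j\<le>n. ennreal (?q j / (t + 1)) * ennreal ((1 + noise_sq (real j * (t / n)) \<omega>) ^ k))"
      using nt nn by (intro sum.cong refl ennreal_mult zero_le_power) auto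
    finally show "ennreal ((\<Sum>j\<le>n. ?q j * (1 + noise_sq (real j * (t / n)) \<omega>)) ^ k)
      \<le> ennreal ((t + 1) ^ k) * (\<Sum>j\<le>n. ennreal (?q j / (t + 1)) * ennreal ((1 + noise_sq (real j * (t / n)) \<omega>) ^ k))" .
  qed
  also have "\<dots> = ennreal ((t + 1) ^ k) * (\<Sum>j\<le>n. ennreal (?q j / (t + 1)) * (\<integral>\<^sup>+\<omega>. ennreal ((1 + noise_sq (real j * (t / n)) \<omega>) ^ k) \<partial>M))"
    by (simp add: nn_integral_cmult nn_integral_sum)
  also have "\<dots> \<le> ennreal ((t + 1) ^ k) * (\<Sum>j\<le>n. ennreal (?q j / (t + 1)) * ennreal m)"
    using jt by (intro mult_left_mono sum_mono m) auto
  also have "(\<Sum>j\<le>n. ennreal (?q j / (t + 1)) * ennreal m) = (\<Sum>j\<le>n. ennreal (?q j / (t + 1) * m))"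
    using q t m by (intro sum.cong refl ennreal_mult[symmetric] divide_nonneg_pos) auto
  also have "\<dots> = ennreal (\<Sum>j\<le>n. ?q j / (t + 1) * m)"
    using q t m by (intro sum_ennreal mult_nonneg_nonneg divide_nonneg_pos) auto
  also have "(\<Sum>j\<le>n. ?q j / (t + 1) * m) = m"
    using W t by (simp add: sum_distrib_right[symmetric] sum_divide_distrib[symmetric])
  also have "ennreal ((t + 1) ^ k) * ennreal m = ennreal ((t + 1) ^ k * m)"
    using t m by (simp add: ennreal_mult)
  also have "\<dots> \<le> ennreal ((\<tau> + 1) ^ k * m)"
    using t m by (intro ennreal_leI mult_right_mono power_mono) auto
  finally show ?thesis .
qed

text \<open>Fatou's lemma transfers the bound from the Euler scheme to the solution, since it is
  uniform in the number of steps. One K serves all times up to \<tau>.\<close>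

lemma moment_bound:
  assumes \<delta>: "\<delta> > 0" and \<theta>: "\<theta> > 0" and \<eta>: "\<eta> > 0" and \<tau>: "\<tau> > 0"
  shows "\<exists>K\<ge>0. \<forall>t x. 0 < t \<longrightarrow> t \<le> \<tau> \<longrightarrow> (\<integral>\<^sup>+y. ennreal (N y powr \<delta>) \<partial>P t x)
    \<le> ennreal ((1 + \<theta>) * ((1 + \<eta>) * exp (- lam * t)) powr \<delta> * N x powr \<delta> + K)"
proof -
  obtain k :: nat where k0: "real k \<ge> \<delta>" using real_arch_simple by blast
  then have k: "k > 0" using \<delta> by (cases k) auto
  obtain D where D: "D \<ge> 0" "\<And>a g. a \<ge> 0 \<Longrightarrow> g \<ge> 0 \<Longrightarrow> (a + g) powr \<delta> \<le> (1 + \<theta>) * a powr \<delta> + D * g powr \<delta>"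
    using powr_add_le[OF \<delta> \<theta>] by blast
  obtain m where m: "m \<ge> 0" "\<And>u. 0 \<le> u \<Longrightarrow> u \<le> \<tau> \<Longrightarrow> (\<integral>\<^sup>+\<omega>. ennreal ((1 + noise_sq u \<omega>) ^ k) \<partial>M) \<le> ennreal m"
    using noise_sq_moment[OF k, of \<tau>] \<tau> by auto
  define E where "E = (1 + \<eta>) * C + (1 + 1 / \<eta>) * c2"
  have E: "E \<ge> 0" using constants \<eta> by (simp add: E_def)
  \<comment> \<open>Everything that does not multiply \<open>N x powr \<delta>\<close>: the moment
    of the noise sum, after the exponent \<delta> has been raised to the integer k.\<close>
  define K where "K = D * (1 + E ^ k * ((\<tau> + 1) ^ k * m))"
  have K: "K \<ge> 0" using D E m \<tau> by (simp add: K_def)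
  have "(\<integral>\<^sup>+y. ennreal (N y powr \<delta>) \<partial>P t x)
    \<le> ennreal ((1 + \<theta>) * ((1 + \<eta>) * exp (- lam * t)) powr \<delta> * N x powr \<delta> + K)" if t: "0 < t" "t \<le> \<tau>" for t x
  proof -
    define A where "A = (1 + \<eta>) * exp (- lam * t)"
    have A: "A \<ge> 0" using \<eta> by (simp add: A_def)
    have [measurable]: "X x t \<in> borel_measurable M" using t by (intro X_measurable) auto
    let ?s = "\<lambda>n i. real i * (t / real (Suc n))"
    let ?Y = "\<lambda>n \<omega>. epath (\<lambda>i. ?s n (Suc i) - ?s n i) (path_increment (?s n) \<omega>) x (Suc n)"
    let ?G = "\<lambda>n \<omega>. \<Sum>j\<le>Suc n. (if j = Suc n then 1 else t / real (Suc n)) * (1 + noise_sq (?s n j) \<omega>)"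
    have d: "?s n (Suc i) - ?s n i = t / real (Suc n)" for n i
      by (simp only: of_nat_Suc distrib_right)
    have lim: "(\<lambda>n. ?Y n \<omega>) \<longlonglongrightarrow> X x t \<omega>" if "\<omega> \<in> space M" for \<omega>
    proof (rule epath_converges[OF X_drives[OF that] _ _ _ _ _ LIMSEQ_divide_Suc])
      have "t / real (Suc k) \<ge> 0" for k using t by simp
      then show "?s k i \<le> ?s k (Suc i)" for k i using d[of i k] by (smt (verit))
      show "?s k (Suc i) - ?s k i \<le> t / real (Suc k)" for k i unfolding d ..
    qed (use t in auto)
    have "(\<lambda>n. ennreal (N (?Y n \<omega>) powr \<delta>)) \<longlonglongrightarrow> ennreal (N (X x t \<omega>) powr \<delta>)" if "\<omega> \<in> space M" for \<omega>
      by (intro tendsto_ennrealI tendsto_powr' tendsto_const continuous_lim[OF N_continuous] lim that)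
         (use \<delta> N_nonneg in auto)
    then have "(\<integral>\<^sup>+y. ennreal (N y powr \<delta>) \<partial>P t x) = (\<integral>\<^sup>+\<omega>. liminf (\<lambda>n. ennreal (N (?Y n \<omega>) powr \<delta>)) \<partial>M)"
      unfolding P_def by (subst nn_integral_distr) (auto intro!: nn_integral_cong lim_imp_Liminf[symmetric])
    \<comment> \<open>Fatou's lemma.\<close>
    also have "\<dots> \<le> liminf (\<lambda>n. \<integral>\<^sup>+\<omega>. ennreal (N (?Y n \<omega>) powr \<delta>) \<partial>M)"
      by (rule nn_integral_liminf) measurable
    also have "\<dots> \<le> ennreal ((1 + \<theta>) * A powr \<delta> * N x powr \<delta> + K)"
    proof (rule Liminf_le)
      have "eventually (\<lambda>n. t / real (Suc n) < h0) sequentially"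
        by (rule order_tendstoD(2)[OF LIMSEQ_divide_Suc]) (use constants in simp)
      then show "\<forall>\<^sub>F n in sequentially. (\<integral>\<^sup>+\<omega>. ennreal (N (?Y n \<omega>) powr \<delta>) \<partial>M)
        \<le> ennreal ((1 + \<theta>) * A powr \<delta> * N x powr \<delta> + K)"
      proof eventually_elim
        fix n assume n: "t / real (Suc n) < h0"
        have "(\<integral>\<^sup>+\<omega>. ennreal (N (?Y n \<omega>) powr \<delta>) \<partial>M)
          \<le> (\<integral>\<^sup>+\<omega>. ennreal ((1 + \<theta>) * A powr \<delta> * N x powr \<delta> + D) + ennreal (D * E ^ k) * ennreal (?G n \<omega> ^ k) \<partial>M)"
        proof (rule nn_integral_mono)
          fix \<omega> assume \<omega>: "\<omega> \<in> space M"
          have G: "?G n \<omega> \<ge> 0" using t noise_sq_nonneg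
            by (intro sum_nonneg mult_nonneg_nonneg add_nonneg_nonneg) auto
          have "N (?Y n \<omega>) \<le> A * N x + E * ?G n \<omega>"
            unfolding A_def E_def by (rule N_epath_exponential[OF \<omega> t(1) _ _ \<eta>]) (use n in auto)
          then have "N (?Y n \<omega>) powr \<delta> \<le> (A * N x + E * ?G n \<omega>) powr \<delta>"
            using \<delta> N_nonneg by (intro powr_mono2) auto
          also have "\<dots> \<le> (1 + \<theta>) * (A * N x) powr \<delta> + D * (E * ?G n \<omega>) powr \<delta>"
            using A E G N_nonneg by (intro D(2)) auto
          also have "(A * N x) powr \<delta> = A powr \<delta> * N x powr \<delta>" using A N_nonneg by (simp add: powr_mult)
          also have "D * (E * ?G n \<omega>) powr \<delta> \<le> D * (1 + (E * ?G n \<omega>) ^ k)"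
            using E G \<delta> k0 D by (intro mult_left_mono powr_le_1_plus_power) auto
          also have "D * (1 + (E * ?G n \<omega>) ^ k) = D + (D * E ^ k) * ?G n \<omega> ^ k"
            by (simp only: power_mult_distrib distrib_left mult_1_right mult.assoc)
          finally have *: "N (?Y n \<omega>) powr \<delta> \<le> ((1 + \<theta>) * A powr \<delta> * N x powr \<delta> + D) + (D * E ^ k) * ?G n \<omega> ^ k"
            by (simp only: add.assoc mult.assoc)
          have "0 \<le> (1 + \<theta>) * A powr \<delta> * N x powr \<delta> + D" "0 \<le> D * E ^ k" "0 \<le> ?G n \<omega> ^ k"
            using \<theta> D E G by auto
          then show "ennreal (N (?Y n \<omega>) powr \<delta>)
            \<le> ennreal ((1 + \<theta>) * A powr \<delta> * N x powr \<delta> + D) + ennreal (D * E ^ k) * ennreal (?G n \<omega> ^ k)"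
            using ennreal_leI[OF *] by (simp only: ennreal_plus ennreal_mult mult_nonneg_nonneg)
        qed
        also have "\<dots> = ennreal ((1 + \<theta>) * A powr \<delta> * N x powr \<delta> + D) + ennreal (D * E ^ k) * (\<integral>\<^sup>+\<omega>. ennreal (?G n \<omega> ^ k) \<partial>M)"
          by (subst nn_integral_add) (auto simp: nn_integral_cmult M.emeasure_space_1)
        also have "\<dots> \<le> ennreal ((1 + \<theta>) * A powr \<delta> * N x powr \<delta> + D) + ennreal (D * E ^ k) * ennreal ((\<tau> + 1) ^ k * m)"
          by (intro add_left_mono mult_left_mono weighted_noise_moment[OF t _ k m]) auto
        also have "\<dots> = ennreal ((1 + \<theta>) * A powr \<delta> * N x powr \<delta> + K)"
        proof -
          have "0 \<le> (1 + \<theta>) * A powr \<delta> * N x powr \<delta> + D" "0 \<le> D * E ^ k" "0 \<le> (\<tau> + 1) ^ k * m"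
            using \<theta> D E m \<tau> by auto
          then show ?thesis
            by (subst ennreal_mult[symmetric], simp, simp, subst ennreal_plus[symmetric], simp, simp)
               (simp add: K_def algebra_simps)
        qed
        finally show "(\<integral>\<^sup>+\<omega>. ennreal (N (?Y n \<omega>) powr \<delta>) \<partial>M) \<le> ennreal ((1 + \<theta>) * A powr \<delta> * N x powr \<delta> + K)" .
      qed
    qed simp
    finally show ?thesis by (simp add: A_def)
  qed
  with K show ?thesis by blast
qed

text \<open>The decay exp(- lam t \<delta>) leaves room for both losses: \<eta> uses half of the
  exponent and \<theta> another quarter, so a quarter remains and the factor is below one.\<close>

lemma moment_contraction:
  assumes \<delta>: "\<delta> > 0" and t: "t > 0"
  shows "\<exists>\<kappa> K. 0 \<le> \<kappa> \<and> \<kappa> < 1 \<and> K \<ge> 0 \<and>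
    (\<forall>x. (\<integral>\<^sup>+y. ennreal (N y powr \<delta>) \<partial>P t x) \<le> ennreal (\<kappa> * N x powr \<delta> + K))"
proof -
  define \<eta> where "\<eta> = exp (lam * t / 2) - 1"
  define \<theta> where "\<theta> = exp (lam * t * \<delta> / 4) - 1"
  have "\<eta> > 0" "\<theta> > 0" using constants t \<delta> by (auto simp: \<eta>_def \<theta>_def)
  from moment_bound[OF \<delta> this(2,1) t] obtain K where K: "K \<ge> 0"
    "\<And>x. (\<integral>\<^sup>+y. ennreal (N y powr \<delta>) \<partial>P t x)
      \<le> ennreal ((1 + \<theta>) * ((1 + \<eta>) * exp (- lam * t)) powr \<delta> * N x powr \<delta> + K)" using t by blast
  have "(1 + \<eta>) * exp (- lam * t) = exp (- lam * t / 2)"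
    by (simp add: \<eta>_def exp_add[symmetric] field_simps)
  then have "(1 + \<theta>) * ((1 + \<eta>) * exp (- lam * t)) powr \<delta> = exp (lam * t * \<delta> / 4) * exp (\<delta> * (- lam * t / 2))"
    by (simp add: \<theta>_def exp_powr_real mult.commute)
  also have "\<dots> = exp (- (lam * t * \<delta> / 4))" by (simp add: exp_add[symmetric] field_simps)
  finally have "(1 + \<theta>) * ((1 + \<eta>) * exp (- lam * t)) powr \<delta> = exp (- (lam * t * \<delta> / 4))" .
  then show ?thesis using K constants t \<delta>
    by (intro exI[of _ "exp (- (lam * t * \<delta> / 4))"] exI[of _ K]) auto
qed

text \<open>Here only finiteness on a bounded time interval matters, so \<theta> and \<eta> are
  simply taken to be one. It bridges the times between integers.\<close>

lemma moment_growth: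
  assumes \<delta>: "\<delta> > 0" and \<tau>: "\<tau> > 0"
  shows "\<exists>D>0. \<forall>t x. 0 \<le> t \<longrightarrow> t \<le> \<tau> \<longrightarrow> (\<integral>\<^sup>+y. ennreal (N y powr \<delta>) \<partial>P t x) \<le> ennreal (D * (1 + N x powr \<delta>))"
proof -
  from moment_bound[OF \<delta> zero_less_one zero_less_one \<tau>] obtain K where K: "K \<ge> 0"
    "\<And>t x. 0 < t \<Longrightarrow> t \<le> \<tau> \<Longrightarrow> (\<integral>\<^sup>+y. ennreal (N y powr \<delta>) \<partial>P t x)
      \<le> ennreal ((1 + 1) * ((1 + 1) * exp (- lam * t)) powr \<delta> * N x powr \<delta> + K)" by blast
  define D where "D = 2 * 2 powr \<delta> + K + 1"
  have D: "D \<ge> 1" using K by (simp add: D_def)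
  have "(\<integral>\<^sup>+y. ennreal (N y powr \<delta>) \<partial>P t x) \<le> ennreal (D * (1 + N x powr \<delta>))" if t: "0 \<le> t" "t \<le> \<tau>" for t x
  proof (cases "t = 0")
    case True
    have "1 * N x powr \<delta> \<le> D * (1 + N x powr \<delta>)" using D by (intro mult_mono) auto
    then show ?thesis unfolding True P_0 by (subst nn_integral_return) (auto intro!: ennreal_leI)
  next
    case False
    have "exp (- lam * t) \<le> 1" using constants t by simp
    then have "((1 + 1) * exp (- lam * t)) powr \<delta> \<le> 2 powr \<delta>" using \<delta> by (intro powr_mono2) auto
    then have "(1 + 1) * ((1 + 1) * exp (- lam * t)) powr \<delta> * N x powr \<delta> + K \<le> (2 * 2 powr \<delta>) * N x powr \<delta> + K"
      by (intro add_right_mono mult_right_mono) auto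
    also have "\<dots> \<le> D * (1 + N x powr \<delta>)" using K by (simp add: D_def algebra_simps)
    finally have "ennreal ((1 + 1) * ((1 + 1) * exp (- lam * t)) powr \<delta> * N x powr \<delta> + K) \<le> ennreal (D * (1 + N x powr \<delta>))"
      by (rule ennreal_leI)
    moreover have "t > 0" using t False by simp
    ultimately show ?thesis using order_trans[OF K(2)[OF _ t(2)]] by blast
  qed
  with D show ?thesis by (intro exI[of _ D]) auto
qed

end

section \<open>Spectral gap\<close>

text \<open>Harris' theorem is applied at integer times with the weight
  \<open>N powr \<delta>\<close>. Other times are a fraction of a unit followed by an integer, and
  unbounded functions are reached by truncation.\<close>

lemma (in lyapunov_flow) weighted_spectral_gap:
  assumes N_ge: "\<And>x. (norm x)\<^sup>2 \<le> N x" and \<delta>: "\<delta> > 0"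
  shows "\<exists>\<mu> D g. prob_space \<mu> \<and> sets \<mu> = sets borel \<and> integrable \<mu> (\<lambda>x. N x powr \<delta>) \<and> D > 0 \<and> g > 0 \<and>
    (\<forall>t \<phi> m c x. t \<ge> 0 \<longrightarrow> \<phi> \<in> borel_measurable borel \<longrightarrow> c \<ge> 0 \<longrightarrow> (\<forall>y. \<bar>\<phi> y - m\<bar> \<le> c * (1 + N y powr \<delta>)) \<longrightarrow>
      \<bar>(\<integral>y. \<phi> y \<partial>P t x) - (\<integral>y. \<phi> y \<partial>\<mu>)\<bar> \<le> D * exp (- g * t) * c * (1 + N x powr \<delta>))"
proof -
  let ?V = "\<lambda>x. N x powr \<delta>"
  have V[measurable]: "?V \<in> borel_measurable borel" by measurable
  obtain \<kappa> K where \<kappa>: "0 \<le> \<kappa>" "\<kappa> < 1" and K: "K \<ge> 0"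
    and drift: "\<And>x. (\<integral>\<^sup>+y. ennreal (?V y) \<partial>P 1 x) \<le> ennreal (\<kappa> * ?V x + K)"
    using moment_contraction[OF \<delta> zero_less_one] by blast
  \<comment> \<open>One above the threshold that Harris' theorem asks for.\<close>
  define R where "R = 2 * K / (1 - \<kappa>) + 1"
  \<comment> \<open>Since N dominates the squared norm, the sublevel set of level R lies in a ball
    of radius r, and two of its points are at distance at most 2 r.\<close>
  define r where "r = sqrt (R powr (1 / \<delta>))"
  have "2 * K / (1 - \<kappa>) \<ge> 0" using K \<kappa> by simp
  then have R1: "R \<ge> 1" by (simp add: R_def)
  have ball: "norm x \<le> r" if "?V x \<le> R" for x
  proof -
    have "N x = (?V x) powr (1 / \<delta>)" using \<delta> N_nonneg by (simp add: powr_powr)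
    also have "\<dots> \<le> R powr (1 / \<delta>)" using that \<delta> by (intro powr_mono2) auto
    finally have "(norm x)\<^sup>2 \<le> R powr (1 / \<delta>)" using N_ge[of x] by linarith
    then show ?thesis unfolding r_def by (rule real_le_rsqrt)
  qed
  have r0: "2 * r \<ge> 0" by (simp add: r_def)
  obtain \<epsilon> where \<epsilon>: "0 < \<epsilon>" "\<epsilon> < 1" and minor: "\<And>x y A. norm (x - y) \<le> 2 * r \<Longrightarrow> A \<in> sets borel \<Longrightarrow>
    measure (P 1 x) A \<le> measure (P 1 y) A + (1 - \<epsilon>)"
    using minorization[OF zero_less_one r0] by blast
  interpret H: harris "\<lambda>n. P (real n)" ?V \<kappa> K R \<epsilon>
  proof
    show "P (real n) \<in> borel \<rightarrow>\<^sub>M prob_algebra borel" for n by (intro P_measurable) simp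
    show "P (real 0) x = return borel x" for x by (simp add: P_0)
    show "P (real (m + n)) x = P (real m) x \<bind> P (real n)" for m n x
      using chapman_kolmogorov[of "real m" "real n" x] by simp
    show "(\<integral>\<^sup>+y. ennreal (?V y) \<partial>P (real 1) x) \<le> ennreal (\<kappa> * ?V x + K)" for x
      using drift[of x] by simp
    show "measure (P (real 1) x) A \<le> measure (P (real 1) y) A + (1 - \<epsilon>)"
      if "?V x \<le> R" "?V y \<le> R" "A \<in> sets borel" for x y A
      using minor[of x y A] ball[OF that(1)] ball[OF that(2)] norm_triangle_ineq4[of x y] that(3) by simp
    show "2 * K / (1 - \<kappa>) < R" by (simp add: R_def)
  qed (use \<kappa> K \<epsilon> in auto)
  obtain C1 where C1: "C1 > 0" "\<And>n \<phi> B m c x. \<phi> \<in> borel_measurable borel \<Longrightarrow> (\<And>y. \<bar>\<phi> y\<bar> \<le> B) \<Longrightarrow>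
     c \<ge> 0 \<Longrightarrow> (\<And>y. \<bar>\<phi> y - m\<bar> \<le> c * (1 + ?V y)) \<Longrightarrow>
     \<bar>(\<integral>z. \<phi> z \<partial>P (real n) x) - (\<integral>z. \<phi> z \<partial>H.\<mu>)\<bar> \<le> C1 * H.\<rho> ^ n * c * (1 + ?V x)"
  proof -
    from H.harris_bounded obtain C1 where *: "C1 > 0" "\<forall>n \<phi> B m c x. \<phi> \<in> borel_measurable borel \<longrightarrow> (\<forall>y. \<bar>\<phi> y\<bar> \<le> B) \<longrightarrow>
     c \<ge> 0 \<longrightarrow> (\<forall>y. \<bar>\<phi> y - m\<bar> \<le> c * (1 + ?V y)) \<longrightarrow>
     \<bar>(\<integral>z. \<phi> z \<partial>P (real n) x) - (\<integral>z. \<phi> z \<partial>H.\<mu>)\<bar> \<le> C1 * H.\<rho> ^ n * c * (1 + ?V x)"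
      by (elim exE conjE)
    show ?thesis by (rule that[OF *(1)], rule *(2)[rule_format]) iprover+
  qed
  obtain C2 where C2: "C2 > 0" "\<And>t x. 0 \<le> t \<Longrightarrow> t \<le> 1 \<Longrightarrow> (\<integral>\<^sup>+y. ennreal (?V y) \<partial>P t x) \<le> ennreal (C2 * (1 + ?V x))"
    using moment_growth[OF \<delta> zero_less_one] by blast
  interpret mu: prob_space H.\<mu> by (rule H.prob_\<mu>)
  define g where "g = - ln H.\<rho>"
  have g: "g > 0" using H.\<rho> by (simp add: g_def)
  define D where "D = C1 * (1 + C2) / H.\<rho>"
  have D: "D > 0" using C1 C2 H.\<rho> by (simp add: D_def add_pos_pos)
  have intV: "integrable (P t x) ?V" "(\<integral>y. ?V y \<partial>P t x) \<le> C2 * (1 + ?V x)" if t: "0 \<le> t" "t \<le> 1" for t x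
  proof -
    have nn: "C2 * (1 + ?V x) \<ge> 0" using C2 by simp
    have "(\<integral>\<^sup>+y. ennreal (?V y) \<partial>P t x) < \<infinity>" using C2(2)[OF t, of x] by (simp add: le_less_trans)
    then show i: "integrable (P t x) ?V" by (intro integrableI_nonneg) auto
    show "(\<integral>y. ?V y \<partial>P t x) \<le> C2 * (1 + ?V x)"
      using C2(2)[OF t, of x] nn nn_integral_eq_integral[OF i] by auto
  qed
  have intV': "integrable (P t x) ?V" if t: "t \<ge> 0" for t x
  proof -
    have "t + 1 > 0" using t by simp
    from moment_growth[OF \<delta> this] obtain E where
      E: "\<forall>s y. 0 \<le> s \<longrightarrow> s \<le> t + 1 \<longrightarrow> (\<integral>\<^sup>+z. ennreal (?V z) \<partial>P s y) \<le> ennreal (E * (1 + ?V y))"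
      by (elim exE conjE)
    have "(\<integral>\<^sup>+y. ennreal (?V y) \<partial>P t x) \<le> ennreal (E * (1 + ?V x))"
      using t by (intro E[rule_format]) auto
    then have "(\<integral>\<^sup>+y. ennreal (?V y) \<partial>P t x) < \<infinity>" by (simp add: le_less_trans)
    then show ?thesis by (intro integrableI_nonneg) auto
  qed
  have bounded: "\<bar>(\<integral>y. \<phi> y \<partial>P t x) - (\<integral>y. \<phi> y \<partial>H.\<mu>)\<bar> \<le> D * exp (- g * t) * c * (1 + ?V x)"
    if t: "t \<ge> 0" and \<phi>[measurable]: "\<phi> \<in> borel_measurable borel" and B: "\<And>y. \<bar>\<phi> y\<bar> \<le> B" and c: "c \<ge> 0"
      and m: "\<And>y. \<bar>\<phi> y - m\<bar> \<le> c * (1 + ?V y)" for t \<phi> m c x B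
  proof -
    \<comment> \<open>The fractional time is run first, so that the integer-time bound is integrated
      against the law at time s at most one, where the weight has grown by a bounded factor
      only.\<close>
    define n where "n = nat \<lfloor>t\<rfloor>"
    define s where "s = t - real n"
    have s: "0 \<le> s" "s \<le> 1" and ts: "t = s + real n" using t by (auto simp: s_def n_def) linarith+
    interpret s: prob_space "P s x" by (rule prob_P[OF s(1)])
    let ?a = "\<lambda>y. \<integral>z. \<phi> z \<partial>P (real n) y"
    let ?m = "\<integral>y. \<phi> y \<partial>H.\<mu>"
    have sub: "P (real n) \<in> borel \<rightarrow>\<^sub>M subprob_algebra borel" by (intro measurable_prob_algebraD P_measurable) simp
    have am[measurable]: "?a \<in> borel_measurable borel"
      using measurable_compose[OF sub integral_measurable_subprob_algebra[OF \<phi>]] by simp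
    have aB: "\<bar>?a y\<bar> \<le> B" for y by (rule H.integral_Q_bounded[OF \<phi> B])
    have ia: "integrable (P s x) ?a" using aB by (intro s.integrable_const_bound[where B=B]) auto
    have "(\<integral>y. \<phi> y \<partial>P t x) = (\<integral>y. ?a y \<partial>P s x)"
      unfolding ts chapman_kolmogorov[OF s(1) of_nat_0_le_iff]
      using B prob_space.emeasure_space_1[OF prob_P[OF of_nat_0_le_iff[of n]]]
      by (intro integral_bind[where K=borel and B=B and B'=1] s.finite_measure_axioms)
         (auto intro: measurable_cong_sets[THEN equalityD1, THEN subsetD, OF sets_P[symmetric] refl sub])
    then have "\<bar>(\<integral>y. \<phi> y \<partial>P t x) - ?m\<bar> = \<bar>\<integral>y. ?a y - ?m \<partial>P s x\<bar>"
      using ia s.prob_space by simp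
    also have "\<dots> \<le> (\<integral>y. \<bar>?a y - ?m\<bar> \<partial>P s x)" by (rule integral_abs_bound)
    also have "\<dots> \<le> (\<integral>y. C1 * H.\<rho> ^ n * c * (1 + ?V y) \<partial>P s x)"
      using ia intV(1)[OF s] C1(2)[OF \<phi> B c m] by (intro integral_mono) auto
    also have "\<dots> = C1 * H.\<rho> ^ n * c * (1 + (\<integral>y. ?V y \<partial>P s x))"
      using intV(1)[OF s] s.prob_space by simp
    also have "\<dots> \<le> C1 * H.\<rho> ^ n * c * ((1 + C2) * (1 + ?V x))"
    proof (rule mult_left_mono)
      have "1 + (\<integral>y. ?V y \<partial>P s x) \<le> 1 + C2 * (1 + ?V x)" using intV(2)[OF s] by simp
      also have "\<dots> \<le> (1 + C2) * (1 + ?V x)" by (simp add: algebra_simps)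
      finally show "1 + (\<integral>y. ?V y \<partial>P s x) \<le> (1 + C2) * (1 + ?V x)" .
      show "0 \<le> C1 * H.\<rho> ^ n * c" using C1 H.\<rho> c by simp
    qed
    also have "\<dots> \<le> C1 * (exp (- g * t) / H.\<rho>) * c * ((1 + C2) * (1 + ?V x))"
    proof (intro mult_right_mono mult_left_mono)
      \<comment> \<open>Passing from n to t loses at most one unit of time, hence the division by
        \<rho> in the definition of D.\<close>
      have "H.\<rho> ^ n = exp (real n * ln H.\<rho>)" using H.\<rho>(1) by (simp add: exp_of_nat_mult)
      also have "\<dots> = exp (- g * t) * exp (g * s)" by (simp add: ts g_def exp_add[symmetric] algebra_simps)
      also have "\<dots> \<le> exp (- g * t) * exp g" using g s by (intro mult_left_mono) auto
      also have "exp g = 1 / H.\<rho>" using H.\<rho>(1) by (simp add: g_def exp_minus divide_inverse)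
      finally show "H.\<rho> ^ n \<le> exp (- g * t) / H.\<rho>" by simp
    qed (use C1(1) C2(1) c in auto)
    finally have "\<bar>(\<integral>y. \<phi> y \<partial>P t x) - ?m\<bar> \<le> C1 * (exp (- g * t) / H.\<rho>) * c * ((1 + C2) * (1 + ?V x))" .
    then show ?thesis by (simp add: D_def mult_ac)
  qed
  have "\<bar>(\<integral>y. \<phi> y \<partial>P t x) - (\<integral>y. \<phi> y \<partial>H.\<mu>)\<bar> \<le> D * exp (- g * t) * c * (1 + ?V x)"
    if t: "t \<ge> 0" and \<phi>[measurable]: "\<phi> \<in> borel_measurable borel" and c: "c \<ge> 0"
      and m: "\<And>y. \<bar>\<phi> y - m\<bar> \<le> c * (1 + ?V y)" for t \<phi> m c x
  proof -
    \<comment> \<open>The truncation is centred at m, so it does not increase the distance to m and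
      keeps the same constant c.\<close>
    define \<psi> where "\<psi> k y = m + max (- real k) (min (real k) (\<phi> y - m))" for k y
    have \<psi>[measurable]: "\<psi> k \<in> borel_measurable borel" for k unfolding \<psi>_def[abs_def] by measurable
    have le: "\<bar>\<psi> k y - m\<bar> \<le> \<bar>\<phi> y - m\<bar>" for k y by (auto simp: \<psi>_def)
    have lim: "(\<lambda>k. \<psi> k y) \<longlonglongrightarrow> \<phi> y" for y
    proof -
      obtain n where n: "\<bar>\<phi> y - m\<bar> \<le> real n" using real_arch_simple by blast
      have "\<psi> k y = \<phi> y" if "k \<ge> n" for k
      proof -
        have "\<bar>\<phi> y - m\<bar> \<le> real k" using n that by (meson of_nat_mono order_trans)
        then show ?thesis by (auto simp: \<psi>_def)
      qed
      then have "eventually (\<lambda>k. \<psi> k y = \<phi> y) sequentially" by (auto simp: eventually_sequentially)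
      then show ?thesis by (rule tendsto_eventually)
    qed
    have bd: "\<bar>\<psi> k y\<bar> \<le> \<bar>m\<bar> + c * (1 + ?V y)" for k y using le[of k y] m[of y] by linarith
    have conv: "(\<lambda>k. \<integral>y. \<psi> k y \<partial>Q) \<longlonglongrightarrow> (\<integral>y. \<phi> y \<partial>Q)"
      if "prob_space Q" "sets Q = sets borel" "integrable Q ?V" for Q
    proof -
      interpret Q: prob_space Q by fact
      have [measurable_cong]: "sets Q = sets borel" by fact
      show ?thesis
        using bd lim that(3)
        by (intro integral_dominated_convergence[where w="\<lambda>y. \<bar>m\<bar> + c * (1 + ?V y)"]) auto
    qed
    have l: "(\<lambda>k. \<bar>(\<integral>y. \<psi> k y \<partial>P t x) - (\<integral>y. \<psi> k y \<partial>H.\<mu>)\<bar>) \<longlonglongrightarrow> \<bar>(\<integral>y. \<phi> y \<partial>P t x) - (\<integral>y. \<phi> y \<partial>H.\<mu>)\<bar>"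
      by (intro tendsto_intros conv prob_P t sets_P intV' H.prob_\<mu> H.sets_\<mu> H.integrable_\<mu>_V)
    have "\<bar>(\<integral>y. \<psi> k y \<partial>P t x) - (\<integral>y. \<psi> k y \<partial>H.\<mu>)\<bar> \<le> D * exp (- g * t) * c * (1 + ?V x)" for k
    proof (rule bounded[OF t \<psi> _ c])
      show "\<bar>\<psi> k y\<bar> \<le> \<bar>m\<bar> + real k" for y by (auto simp: \<psi>_def)
      show "\<bar>\<psi> k y - m\<bar> \<le> c * (1 + ?V y)" for y using le[of k y] m[of y] by linarith
    qed
    then show ?thesis by (intro LIMSEQ_le_const2[OF l] exI allI impI)
  qed
  note main = this
  show ?thesis
  proof (rule exI[of _ H.\<mu>], rule exI[of _ D], rule exI[of _ g], intro conjI allI impI)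
    fix t m c :: real and \<phi> :: "state \<Rightarrow> real" and x
    assume "t \<ge> 0" "\<phi> \<in> borel_measurable borel" "c \<ge> 0" "\<forall>y. \<bar>\<phi> y - m\<bar> \<le> c * (1 + ?V y)"
    then show "\<bar>(\<integral>y. \<phi> y \<partial>P t x) - (\<integral>y. \<phi> y \<partial>H.\<mu>)\<bar> \<le> D * exp (- g * t) * c * (1 + ?V x)"
      by (intro main) iprover+
  qed (rule H.prob_\<mu> H.sets_\<mu> H.integrable_\<mu>_V D g)+
qed

section \<open>The potential, the drift and the Hamiltonian\<close>

text \<open>The growth conditions on the potential concern |x| > 1 only; the remaining interval is
  compact and the functions are continuous.\<close>

lemma bounded_if_bounded_outside_unit:
  fixes f w :: "real \<Rightarrow> real"
  assumes f: "continuous_on UNIV f" and w: "\<And>x. w x \<ge> 1" and b: "\<And>x. \<bar>x\<bar> > 1 \<Longrightarrow> \<bar>f x\<bar> \<le> K * w x"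
  shows "\<exists>C\<ge>0. \<forall>x. \<bar>f x\<bar> \<le> C * w x"
proof -
  have "compact (f ` {-1..1})"
    using f by (intro compact_continuous_image) (auto intro: continuous_on_subset)
  then obtain B where B: "\<And>x. x \<in> {-1..1} \<Longrightarrow> \<bar>f x\<bar> \<le> B"
    using compact_imp_bounded bounded_iff by (metis image_eqI real_norm_def)
  define C where "C = \<bar>B\<bar> + \<bar>K\<bar>"
  have "\<bar>f x\<bar> \<le> C * w x" for x
  proof (cases "\<bar>x\<bar> > 1")
    case True
    have "K * w x \<le> C * w x" using w[of x] by (intro mult_right_mono) (auto simp: C_def)
    then show ?thesis using b[OF True] by simp
  next
    case False
    then have "\<bar>f x\<bar> \<le> B" by (intro B) auto
    also have "\<dots> \<le> C * 1" by (simp add: C_def)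
    also have "\<dots> \<le> C * w x" using w[of x] by (intro mult_left_mono) (auto simp: C_def)
    finally show ?thesis .
  qed
  then show ?thesis by (intro exI[of _ C]) (auto simp: C_def)
qed

lemma lipschitz_of_derivative_bound:
  fixes f f' :: "real \<Rightarrow> real"
  assumes "\<And>x. (f has_real_derivative f' x) (at x)" "\<And>x. \<bar>f' x\<bar> \<le> C"
  shows "\<bar>f x - f y\<bar> \<le> C * \<bar>x - y\<bar>"
  using field_differentiable_bound[of UNIV f f' C x y] assms by simp

text \<open>Replacing 1 + h by 2 max(1, h) turns the sum into products before the power is taken, so
  exponents below and above one need no distinction.\<close>

lemma equivalent_weight:
  fixes a h D \<delta> :: real
  assumes "a \<ge> 0" "h \<ge> 0" "D > 0" "\<delta> > 0" "a \<le> D * (1 + h)"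
  shows "1 + a powr \<delta> \<le> (1 + (2 * D) powr \<delta>) * (1 + h powr \<delta>)"
proof -
  have "D * (1 + h) \<le> D * (2 * max 1 h)" using assms by (intro mult_left_mono) auto
  then have "a \<le> (2 * D) * max 1 h" using assms(5) by simp
  then have "a powr \<delta> \<le> ((2 * D) * max 1 h) powr \<delta>" using assms by (intro powr_mono2) auto
  also have "\<dots> = (2 * D) powr \<delta> * (max 1 h) powr \<delta>" using assms by (intro powr_mult)
  also have "\<dots> \<le> (2 * D) powr \<delta> * (1 + h powr \<delta>)"
    by (intro mult_left_mono) (auto simp: max_def)
  finally have "a powr \<delta> \<le> (2 * D) powr \<delta> * (1 + h powr \<delta>)" .
  moreover have "1 \<le> 1 + h powr \<delta>" by simp
  ultimately show ?thesis unfolding distrib_right[of 1] mult_1_left by (intro add_mono)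
qed

text \<open>Boundedness of V1' - x makes the drift a bounded perturbation of its linear part, and
  boundedness of V1'' - 1 makes it Lipschitz. These are the inputs of the Lyapunov estimate and of
  the coupling.\<close>

lemma kinetic_lyapunov:
  fixes V1 V1d V1dd :: "real \<Rightarrow> real" and \<alpha> \<gamma> :: real
  assumes pos: "\<alpha> > 0" "\<gamma> > 0" "s0 > 0" "s1 > 0"
    and C2: "C2_with V1 V1d V1dd"
    and R1: "\<exists>K. \<forall>x. \<bar>x\<bar> > 1 \<longrightarrow>
               \<bar>V1 x - x^2/2\<bar> \<le> K * \<bar>x\<bar> \<and> \<bar>V1d x - x\<bar> \<le> K \<and> \<bar>V1dd x - 1\<bar> \<le> K / \<bar>x\<bar>"
  shows "\<exists>L (B :: state \<Rightarrow> state \<Rightarrow> real) l C c2 h0. kinetic (drift V1d \<alpha> \<gamma>) L s0 s1 \<and> c2 > 0 \<and>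
    (\<forall>x. (norm x)\<^sup>2 \<le> B x x) \<and> (\<forall>x. B x x \<le> c2 * (norm x)\<^sup>2) \<and> continuous_on UNIV (\<lambda>x. B x x) \<and>
    (\<forall>\<eta> x y. \<eta> > 0 \<longrightarrow> B (x + y) (x + y) \<le> (1 + \<eta>) * B x x + (1 + 1 / \<eta>) * B y y) \<and>
    l > 0 \<and> C \<ge> 0 \<and> h0 > 0 \<and> l * h0 \<le> 1 \<and> (\<forall>h z v. 0 \<le> h \<longrightarrow> h \<le> h0 \<longrightarrow>
      B (z + h *\<^sub>R drift V1d \<alpha> \<gamma> (z + v)) (z + h *\<^sub>R drift V1d \<alpha> \<gamma> (z + v)) \<le> (1 - l * h) * B z z + C * h * (1 + (norm v)\<^sup>2))"
proof -
  let ?b = "drift V1d \<alpha> \<gamma>" and ?A = "lin_drift \<alpha> \<gamma>"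
  obtain K where K: "\<And>x. \<bar>x\<bar> > 1 \<Longrightarrow> \<bar>V1d x - x\<bar> \<le> K" "\<And>x. \<bar>x\<bar> > 1 \<Longrightarrow> \<bar>V1dd x - 1\<bar> \<le> K / \<bar>x\<bar>"
    using R1 by blast
  have d: "(V1d has_real_derivative V1dd x) (at x)" for x using C2 by (simp add: C2_with_def)
  have "continuous_on UNIV (\<lambda>x. V1d x - x)"
    by (intro continuous_intros continuous_at_imp_continuous_on ballI DERIV_isCont[OF d])
  then obtain r where r: "r \<ge> 0" "\<And>x. \<bar>V1d x - x\<bar> \<le> r * 1"
    using bounded_if_bounded_outside_unit[of "\<lambda>x. V1d x - x" "\<lambda>_. 1" K] K(1) by auto
  have "continuous_on UNIV V1dd" using C2 by (simp add: C2_with_def)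
  then have "continuous_on UNIV (\<lambda>x. V1dd x - 1)" by (intro continuous_intros)
  moreover have "\<bar>V1dd x - 1\<bar> \<le> \<bar>K\<bar> * 1" if "\<bar>x\<bar> > 1" for x
  proof -
    have "K / \<bar>x\<bar> \<le> \<bar>K\<bar> / \<bar>x\<bar>" by (intro divide_right_mono) auto
    also have "\<dots> \<le> \<bar>K\<bar> / 1" using that by (intro divide_left_mono) auto
    finally show ?thesis using K(2)[OF that] by simp
  qed
  ultimately obtain M where M: "M \<ge> 0" "\<And>x. \<bar>V1dd x - 1\<bar> \<le> M * 1"
    using bounded_if_bounded_outside_unit[of "\<lambda>x. V1dd x - 1" "\<lambda>_. 1" "\<bar>K\<bar>"] by auto
  have lipr: "\<bar>(V1d x - x) - (V1d y - y)\<bar> \<le> M * \<bar>x - y\<bar>" for x y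
    using M(2) by (intro lipschitz_of_derivative_bound[where f'="\<lambda>x. V1dd x - 1"])
      (auto intro!: derivative_eq_intros d)
  have diff: "?b x - ?A x = (- (V1d (fst (snd x)) - fst (snd x)), 0, - (V1d (snd (snd (snd x))) - snd (snd (snd x))), 0)" for x
    by (cases x) (simp add: drift_def lin_drift_def algebra_simps)
  have near: "norm (?b x - ?A x) \<le> 2 * r" for x
    using norm_state_le[of "?b x - ?A x"] r(2)[of "fst (snd x)"] r(2)[of "snd (snd (snd x))"] unfolding diff by simp
  obtain Ka where Ka: "Ka > 0" "\<And>x. norm (?A x) \<le> norm x * Ka"
    using linear_conv_bounded_linear[THEN iffD1, OF linear_lin_drift, of \<alpha> \<gamma>] bounded_linear.pos_bounded by metis
  have lip: "norm (?b x - ?b y) \<le> (Ka + 2 * M) * norm (x - y)" for x y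
  proof -
    define e where "e = (?b x - ?A x) - (?b y - ?A y)"
    have "norm e \<le> M * \<bar>fst (snd (x - y))\<bar> + M * \<bar>snd (snd (snd (x - y)))\<bar>"
      using norm_state_le[of e] lipr[of "fst (snd x)" "fst (snd y)"] lipr[of "snd (snd (snd x))" "snd (snd (snd y))"]
      unfolding e_def diff by (simp add: abs_minus_commute)
    also have "\<dots> \<le> M * norm (x - y) + M * norm (x - y)"
      using M abs_comp_le_norm[of "x - y"] by (intro add_mono mult_left_mono) auto
    finally have e: "norm e \<le> 2 * M * norm (x - y)" by simp
    have "?b x - ?b y = ?A (x - y) + e" by (simp add: e_def linear_diff[OF linear_lin_drift])
    then have "norm (?b x - ?b y) \<le> norm (?A (x - y)) + norm e" by (simp add: norm_triangle_ineq)
    also have "\<dots> \<le> norm (x - y) * Ka + 2 * M * norm (x - y)" by (intro add_mono Ka(2) e)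
    finally show ?thesis by (simp add: algebra_simps)
  qed
  have kin: "kinetic ?b (Ka + 2 * M) s0 s1"
  proof
    show "fst (snd (?b x)) = fst x" "snd (snd (snd (?b x))) = fst (snd (snd x))" for x
      by (cases x; simp add: drift_def)+
  qed (use Ka M pos lip in auto)
  obtain B c2 l where B: "c2 > 0" "l > 0" "\<forall>x y z. B (x + y) z = B x z + B y z"
    "\<forall>a x y. B (a *\<^sub>R x) y = a * B x y" "\<forall>x y. B x y = B y x"
    "\<forall>x. (norm x)\<^sup>2 \<le> B x x" "\<forall>x. B x x \<le> c2 * (norm x)\<^sup>2"
    "\<forall>x. 2 * B x (?A x) \<le> - 2 * l * B x x" "continuous_on UNIV (\<lambda>x. B x x)"
    using quadratic_lyapunov[OF pos(1,2)] by (elim exE conjE)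
  note ly = euler_step_lyapunov[of c2 l B ?A ?b "2 * r", OF B(1,2) B(3-8)[rule_format] linear_lin_drift near]
  obtain C h0 where "C \<ge> 0" "h0 > 0" "l * h0 \<le> 1" "\<forall>h z v. 0 \<le> h \<longrightarrow> h \<le> h0 \<longrightarrow>
      B (z + h *\<^sub>R ?b (z + v)) (z + h *\<^sub>R ?b (z + v)) \<le> (1 - l * h) * B z z + C * h * (1 + (norm v)\<^sup>2)"
    using ly(2) by (elim exE conjE)
  moreover have "\<forall>\<eta> x y. \<eta> > 0 \<longrightarrow> B (x + y) (x + y) \<le> (1 + \<eta>) * B x x + (1 + 1 / \<eta>) * B y y"
    using ly(1) by (intro allI impI)
  ultimately show ?thesis using kin B(1,2,6,7,9)
    by (intro exI[of _ "Ka + 2 * M"] exI[of _ B] exI[of _ l] exI[of _ C] exI[of _ c2] exI[of _ h0] conjI)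
qed

text \<open>The remainder of the potential grows at most linearly, so half of the quadratic part x^2
  / 2 absorbs it up to a constant; the coupling energy is nonnegative and at most quadratic.\<close>

lemma hamiltonian_bounds:
  fixes V1 V1d V1dd :: "real \<Rightarrow> real" and \<alpha> :: real
  assumes \<alpha>: "\<alpha> > 0" and C2: "C2_with V1 V1d V1dd"
    and R1: "\<exists>K. \<forall>x. \<bar>x\<bar> > 1 \<longrightarrow>
               \<bar>V1 x - x^2/2\<bar> \<le> K * \<bar>x\<bar> \<and> \<bar>V1d x - x\<bar> \<le> K \<and> \<bar>V1dd x - 1\<bar> \<le> K / \<bar>x\<bar>"
    and Hnonneg: "\<And>x. ham V1 \<alpha> x \<ge> 0"
  shows "\<exists>D>0. \<forall>x. ham V1 \<alpha> x \<le> D * (1 + (norm x)\<^sup>2) \<and> (norm x)\<^sup>2 \<le> D * (1 + ham V1 \<alpha> x)"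
proof -
  obtain K where K: "\<And>x. \<bar>x\<bar> > 1 \<Longrightarrow> \<bar>V1 x - x\<^sup>2 / 2\<bar> \<le> K * \<bar>x\<bar>" using R1 by blast
  have d: "(V1 has_real_derivative V1d x) (at x)" for x using C2 by (simp add: C2_with_def)
  have "continuous_on UNIV (\<lambda>x. V1 x - x\<^sup>2 / 2)"
    by (intro continuous_intros continuous_at_imp_continuous_on ballI DERIV_isCont[OF d]) auto
  moreover have "\<bar>V1 x - x\<^sup>2 / 2\<bar> \<le> \<bar>K\<bar> * (1 + \<bar>x\<bar>)" if "\<bar>x\<bar> > 1" for x
  proof -
    have "K * \<bar>x\<bar> \<le> \<bar>K\<bar> * (1 + \<bar>x\<bar>)" by (intro mult_mono) auto
    then show ?thesis using K[OF that] by simp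
  qed
  ultimately obtain C where C: "C \<ge> 0" "\<And>x. \<bar>V1 x - x\<^sup>2 / 2\<bar> \<le> C * (1 + \<bar>x\<bar>)"
    using bounded_if_bounded_outside_unit[of "\<lambda>x. V1 x - x\<^sup>2 / 2" "\<lambda>x. 1 + \<bar>x\<bar>" "\<bar>K\<bar>"] by auto
  \<comment> \<open>Completing the square in |x| / 2 - C.\<close>
  have lin: "C * (1 + \<bar>x\<bar>) \<le> x\<^sup>2 / 4 + (C + C\<^sup>2)" for x
  proof -
    have "0 \<le> (\<bar>x\<bar> / 2 - C)\<^sup>2" by simp
    also have "\<dots> = x\<^sup>2 / 4 - C * \<bar>x\<bar> + C\<^sup>2" by (simp add: power2_diff power_divide)
    finally show ?thesis by (simp add: algebra_simps)
  qed
  define c where "c = 2 * (C + C\<^sup>2)"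
  have c: "c \<ge> 0" using C by (simp add: c_def)
  define D where "D = 4 + 4 * c + 2 * \<alpha>"
  have D: "D > 0" using c \<alpha> by (simp add: D_def)
  have "ham V1 \<alpha> x \<le> D * (1 + (norm x)\<^sup>2) \<and> (norm x)\<^sup>2 \<le> D * (1 + ham V1 \<alpha> x)" for x
  proof -
    obtain p q u v where x: "x = (p, q, u, v)" by (cases x) auto
    define n where "n = p\<^sup>2 + q\<^sup>2 + u\<^sup>2 + v\<^sup>2"
    have n: "(norm x)\<^sup>2 = n" by (simp add: x n_def norm_Pair)
    have n0: "n \<ge> 0" by (simp add: n_def)
    let ?H = "ham V1 \<alpha> x"
    have H: "?H = (p\<^sup>2 + u\<^sup>2) / 2 + V1 q + V1 v + \<alpha> / 2 * (q - v)\<^sup>2" by (simp add: ham_def x)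
    have V: "z / 4 - k \<le> y" "y \<le> z + k" if "\<bar>y - z / 2\<bar> \<le> z / 4 + k" "z \<ge> 0" for y z k :: real
      using that by linarith+
    note q = V[OF order_trans[OF C(2)[of q] lin[of q]] zero_le_power2]
      and v = V[OF order_trans[OF C(2)[of v] lin[of v]] zero_le_power2]
    have pu: "(p\<^sup>2 + u\<^sup>2) / 4 \<le> (p\<^sup>2 + u\<^sup>2) / 2" "(p\<^sup>2 + u\<^sup>2) / 2 \<le> p\<^sup>2 + u\<^sup>2" by simp_all
    have qv: "(q - v)\<^sup>2 \<le> 2 * n"
    proof -
      have "(q - v)\<^sup>2 \<le> 2 * (q\<^sup>2 + v\<^sup>2)" using sum_squares_bound[of q "- v"] by (simp add: power2_diff)
      also have "\<dots> \<le> 2 * n" unfolding n_def by (intro mult_left_mono) auto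
      finally show ?thesis .
    qed
    have "\<alpha> / 2 * (q - v)\<^sup>2 \<le> \<alpha> / 2 * (2 * n)" using qv \<alpha> by (intro mult_left_mono) auto
    then have "?H \<le> (p\<^sup>2 + u\<^sup>2) + (q\<^sup>2 + (C + C\<^sup>2)) + (v\<^sup>2 + (C + C\<^sup>2)) + \<alpha> / 2 * (2 * n)"
      unfolding H by (intro add_mono pu q v)
    also have "\<dots> = n + c + \<alpha> * n" by (simp add: n_def c_def)
    also have "\<dots> \<le> D * (1 + n)"
    proof -
      have "c * n \<ge> 0" "\<alpha> * n \<ge> 0" using c n0 \<alpha> by auto
      then show ?thesis using c n0 \<alpha> by (simp add: D_def algebra_simps)
    qed
    finally have up: "?H \<le> D * (1 + n)" .
    have "0 \<le> \<alpha> / 2 * (q - v)\<^sup>2" using \<alpha> by simp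
    then have "(p\<^sup>2 + u\<^sup>2) / 4 + (q\<^sup>2 / 4 - (C + C\<^sup>2)) + (v\<^sup>2 / 4 - (C + C\<^sup>2)) + 0 \<le> ?H"
      unfolding H by (intro add_mono pu q v)
    moreover have "(p\<^sup>2 + u\<^sup>2) / 4 + (q\<^sup>2 / 4 - (C + C\<^sup>2)) + (v\<^sup>2 / 4 - (C + C\<^sup>2)) + 0 = n / 4 - c"
      by (simp add: n_def c_def add_divide_distrib)
    ultimately have "n \<le> 4 * ?H + 4 * c" by simp
    also have "\<dots> \<le> D * (1 + ?H)"
    proof -
      have "c * ?H \<ge> 0" "\<alpha> * ?H \<ge> 0" using c Hnonneg[of x] \<alpha> by auto
      then show ?thesis using c Hnonneg[of x] \<alpha> by (simp add: D_def algebra_simps)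
    qed
    finally show ?thesis using up by (simp add: n)
  qed
  with D show ?thesis by blast
qed

section \<open>Weighted norms and the spectral gap for the Hamiltonian weight\<close>

lemma wnorm_le:
  assumes "\<And>x. W x \<ge> 0" "\<And>x. \<bar>\<psi> x\<bar> \<le> D * (1 + W x)"
  shows "wnorm W \<psi> \<le> ereal D"
  unfolding wnorm_def
proof (rule SUP_least)
  fix x
  have "1 + W x > 0" using assms(1)[of x] by simp
  then show "ereal (\<bar>\<psi> x\<bar> / (1 + W x)) \<le> ereal D" using assms(2)[of x] by (simp add: divide_le_eq)
qed

text \<open>Replaces the extended real supremum by an attained real constant that bounds the
  function pointwise, which is the form the gap estimate accepts.\<close>

lemma wnorm_finite:
  assumes W: "\<And>x. W x \<ge> 0" and fin: "wnorm W \<psi> < \<infinity>"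
  shows "\<exists>c\<ge>0. wnorm W \<psi> = ereal c \<and> (\<forall>x. \<bar>\<psi> x\<bar> \<le> c * (1 + W x))"
proof -
  have ge: "ereal (\<bar>\<psi> x\<bar> / (1 + W x)) \<le> wnorm W \<psi>" for x unfolding wnorm_def by (rule SUP_upper) simp
  have "ereal 0 \<le> ereal (\<bar>\<psi> undefined\<bar> / (1 + W undefined))" using W[of undefined] by simp
  then have nn: "0 \<le> wnorm W \<psi>" using ge[of undefined] by (metis order_trans zero_ereal_def)
  then obtain c where c: "wnorm W \<psi> = ereal c" using fin by (cases "wnorm W \<psi>") auto
  have "\<bar>\<psi> x\<bar> \<le> c * (1 + W x)" for x
  proof -
    have "1 + W x > 0" using W[of x] by simp
    then show ?thesis using ge[of x] unfolding c by (simp add: divide_le_eq)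
  qed
  then show ?thesis using c nn by auto
qed

text \<open>The gap is proved for the weight built from the quadratic form and carried over, because
  1 + \<open>N powr \<delta>\<close> and the Hamiltonian weight bound each other up to
  constants.\<close>

theorem theorem7p4:
  fixes V1 V1d V1dd :: "real \<Rightarrow> real" and \<alpha> \<gamma> T Tinf \<delta> :: real
  assumes pos: "\<alpha> > 0" "\<gamma> > 0" "T > 0" "Tinf > 0" "\<delta> > 0"
    and even: "\<And>x. V1 (- x) = V1 x"
    and C2: "C2_with V1 V1d V1dd"
    and R1: "\<exists>K. \<forall>x. \<bar>x\<bar> > 1 \<longrightarrow>
               \<bar>V1 x - x^2/2\<bar> \<le> K * \<bar>x\<bar> \<and> \<bar>V1d x - x\<bar> \<le> K \<and> \<bar>V1dd x - 1\<bar> \<le> K / \<bar>x\<bar>"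
    and Hnonneg: "\<And>x. ham V1 \<alpha> x \<ge> 0"
  shows "\<exists>\<mu> :: state measure. \<exists>C \<gamma>'. prob_space \<mu> \<and> sets \<mu> = sets borel \<and>
           integrable \<mu> (\<lambda>x. ham V1 \<alpha> x powr \<delta>) \<and> C > 0 \<and> \<gamma>' > 0 \<and>
           (\<forall>(M :: 'a measure) w0 w1 (X :: state \<Rightarrow> real \<Rightarrow> 'a \<Rightarrow> state).
              brownian2 M w0 w1 \<and> (\<forall>x. sde_solution V1d \<alpha> \<gamma> T Tinf M w0 w1 x (X x)) \<longrightarrow>
              (\<forall>t \<ge> 0. \<forall>\<phi> :: state \<Rightarrow> real. \<phi> \<in> borel_measurable borel \<and>
                  wnorm (\<lambda>x. ham V1 \<alpha> x powr \<delta>) \<phi> < \<infinity> \<longrightarrow>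
                  wnorm (\<lambda>x. ham V1 \<alpha> x powr \<delta>)
                        (\<lambda>x. (\<integral>\<omega>. \<phi> (X x t \<omega>) \<partial>M) - (\<integral>y. \<phi> y \<partial>\<mu>))
                  \<le> ereal (C * exp (- \<gamma>' * t)) *
                    wnorm (\<lambda>x. ham V1 \<alpha> x powr \<delta>) (\<lambda>x. \<phi> x - (\<integral>y. \<phi> y \<partial>\<mu>))))"
proof -
  let ?W = "\<lambda>x. ham V1 \<alpha> x powr \<delta>"
  let ?b = "drift V1d \<alpha> \<gamma>"
  define s0 where "s0 = sqrt (2 * \<gamma> * T)"
  define s1 where "s1 = sqrt (2 * \<gamma> * Tinf)"
  have s: "s0 > 0" "s1 > 0" using pos by (auto simp: s0_def s1_def)
  have "continuous_on UNIV V1"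
    using C2 unfolding C2_with_def by (intro continuous_at_imp_continuous_on ballI) (metis DERIV_isCont)
  then have V1[measurable]: "V1 \<in> borel_measurable borel" by (rule borel_measurable_continuous_onI)
  have ham_eq: "ham V1 \<alpha> x = ((fst x)\<^sup>2 + (fst (snd (snd x)))\<^sup>2) / 2 + V1 (fst (snd x)) + V1 (snd (snd (snd x)))
      + \<alpha> / 2 * (fst (snd x) - snd (snd (snd x)))\<^sup>2" for x
    by (cases x) (simp add: ham_def)
  have cont: "continuous_on UNIV (\<lambda>x. ham V1 \<alpha> x)"
    unfolding ham_eq by (intro continuous_intros continuous_on_compose2[OF \<open>continuous_on UNIV V1\<close>]) auto
  have W[measurable]: "?W \<in> borel_measurable borel"
    using borel_measurable_continuous_onI[OF cont] by measurable
  obtain L B l C c2 h0 where kin: "kinetic ?b L s0 s1" and c2: "c2 > 0"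
    and lo': "\<forall>x. (norm x)\<^sup>2 \<le> B x x" and hi': "\<forall>x. B x x \<le> c2 * (norm x)\<^sup>2"
    and Bc: "continuous_on UNIV (\<lambda>x :: state. B x x)"
    and Badd': "\<forall>\<eta> x y. \<eta> > 0 \<longrightarrow> B (x + y) (x + y) \<le> (1 + \<eta>) * B x x + (1 + 1 / \<eta>) * B y y"
    and l: "l > 0" "C \<ge> 0" "h0 > 0" "l * h0 \<le> 1"
    and step': "\<forall>h z v. 0 \<le> h \<longrightarrow> h \<le> h0 \<longrightarrow>
      B (z + h *\<^sub>R ?b (z + v)) (z + h *\<^sub>R ?b (z + v)) \<le> (1 - l * h) * B z z + C * h * (1 + (norm v)\<^sup>2)"
    using kinetic_lyapunov[OF pos(1,2) s C2 R1] by (elim exE conjE)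
  note lo = lo'[rule_format] and hi = hi'[rule_format] and Badd = Badd'[rule_format] and step = step'[rule_format]
  let ?N = "\<lambda>x. B x x"
  have N0: "?N x \<ge> 0" for x using lo[of x] zero_le_power2[of "norm x"] by linarith
  have flow: "kinetic_flow ?b L s0 s1 M w0 w1 X"
    if "brownian2 M w0 w1" "\<forall>x. sde_solution V1d \<alpha> \<gamma> T Tinf M w0 w1 x (X x)"
    for M :: "'a measure" and w0 w1 X
  proof -
    interpret kinetic ?b L s0 s1 by (rule kin)
    show ?thesis
    proof
      show "brownian2 M w0 w1" by fact
      show "X x t \<in> borel_measurable M" if "t \<ge> 0" for x t
        using spec[OF \<open>\<forall>x. sde_solution V1d \<alpha> \<gamma> T Tinf M w0 w1 x (X x)\<close>, of x] that
        unfolding sde_solution_def by blast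
      show "drives (\<lambda>t. w0 t \<omega>) (\<lambda>t. w1 t \<omega>) x (\<lambda>t. X x t \<omega>)" if "\<omega> \<in> space M" for x \<omega>
        using spec[OF \<open>\<forall>x. sde_solution V1d \<alpha> \<gamma> T Tinf M w0 w1 x (X x)\<close>, of x] \<open>brownian2 M w0 w1\<close> that
        unfolding drives_def unfolding sde_solution_def brownian2_def s0_def s1_def by blast
    qed
  qed
  obtain D where D: "D > 0" "\<And>x. ham V1 \<alpha> x \<le> D * (1 + (norm x)\<^sup>2)" "\<And>x. (norm x)\<^sup>2 \<le> D * (1 + ham V1 \<alpha> x)"
    using hamiltonian_bounds[OF pos(1) C2 R1 Hnonneg] by blast
  have HN: "ham V1 \<alpha> x \<le> D * (1 + ?N x)" for x
  proof -
    have "D * (1 + (norm x)\<^sup>2) \<le> D * (1 + ?N x)" using D(1) lo[of x] by (intro mult_left_mono) auto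
    then show ?thesis using D(2)[of x] by linarith
  qed
  have NH: "?N x \<le> (c2 * D) * (1 + ham V1 \<alpha> x)" for x
  proof -
    have "c2 * (norm x)\<^sup>2 \<le> c2 * (D * (1 + ham V1 \<alpha> x))" using c2 D(3)[of x] by (intro mult_left_mono) auto
    then show ?thesis using hi[of x] by (simp add: mult.assoc)
  qed
  \<comment> \<open>Comparison constants of the two weights in both directions; their product enters
    the final constant.\<close>
  define d1 where "d1 = 1 + (2 * D) powr \<delta>"
  define d2 where "d2 = 1 + (2 * (c2 * D)) powr \<delta>"
  have d: "d1 > 0" "d2 > 0" by (auto simp: d1_def d2_def add_pos_nonneg)
  have WN: "1 + ?W x \<le> d1 * (1 + ?N x powr \<delta>)" for x
    unfolding d1_def by (rule equivalent_weight[OF Hnonneg N0 D(1) pos(5) HN])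
  have NW: "1 + ?N x powr \<delta> \<le> d2 * (1 + ?W x)" for x
    unfolding d2_def using c2 D(1) by (intro equivalent_weight[OF N0 Hnonneg _ pos(5) NH]) auto
  show ?thesis
  \<comment> \<open>The measure must be named before any realization is given. If the type admits
    none, the claim about solutions is vacuous and a point mass serves as witness.\<close>
  proof (cases "\<exists>(M :: 'a measure) w0 w1 X. brownian2 M w0 w1 \<and> (\<forall>x. sde_solution V1d \<alpha> \<gamma> T Tinf M w0 w1 x (X x))")
    case False
    have p: "prob_space (return borel (0 :: state))" by (rule prob_space_return) simp
    have i: "integrable (return borel (0 :: state)) ?W"
      by (intro integrableI_bounded) (auto simp: nn_integral_return)
    show ?thesis
    proof (rule exI[of _ "return borel 0"], rule exI[of _ 1], rule exI[of _ 1], intro conjI allI impI)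
      fix M :: "'a measure" and w0 w1 X
      assume "brownian2 M w0 w1 \<and> (\<forall>x. sde_solution V1d \<alpha> \<gamma> T Tinf M w0 w1 x (X x))"
      with False have False by blast
      then show "wnorm ?W (\<lambda>x. (\<integral>\<omega>. \<phi> (X x t \<omega>) \<partial>M) - (\<integral>y. \<phi> y \<partial>return borel 0))
        \<le> ereal (1 * exp (- 1 * t)) * wnorm ?W (\<lambda>x. \<phi> x - (\<integral>y. \<phi> y \<partial>return borel 0))" for t \<phi> ..
    qed (use p i in auto)
  next
    case True
    \<comment> \<open>One reference realization fixes the measure and the rate; \<open>P_eq\<close>
      carries the estimate to all others.\<close>
    then obtain M0 :: "'a measure" and v0 v1 X0 where
      M0: "brownian2 M0 v0 v1" "\<forall>x. sde_solution V1d \<alpha> \<gamma> T Tinf M0 v0 v1 x (X0 x)" by blast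
    interpret F: kinetic_flow ?b L s0 s1 M0 v0 v1 X0 by (rule flow[OF M0])
    interpret F: lyapunov_flow ?b L s0 s1 M0 v0 v1 X0 ?N l C c2 h0
      by unfold_locales (rule Bc N0 hi Badd step l less_imp_le[OF c2] | assumption)+
    obtain \<mu> E g where \<mu>: "prob_space \<mu>" "sets \<mu> = sets borel" "integrable \<mu> (\<lambda>x. ?N x powr \<delta>)"
      and E: "E > 0" and g: "g > 0"
      and gap: "\<forall>t \<phi> m c x. t \<ge> 0 \<longrightarrow> \<phi> \<in> borel_measurable borel \<longrightarrow> c \<ge> 0 \<longrightarrow>
        (\<forall>y. \<bar>\<phi> y - m\<bar> \<le> c * (1 + ?N y powr \<delta>)) \<longrightarrow>
        \<bar>(\<integral>y. \<phi> y \<partial>F.P t x) - (\<integral>y. \<phi> y \<partial>\<mu>)\<bar> \<le> E * exp (- g * t) * c * (1 + ?N x powr \<delta>)"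
      using F.weighted_spectral_gap[OF lo pos(5)] by (elim exE conjE)
    interpret mu: prob_space \<mu> by (rule \<mu>(1))
    have [measurable_cong]: "sets \<mu> = sets borel" by (rule \<mu>(2))
    have intW: "integrable \<mu> ?W"
    proof (rule Bochner_Integration.integrable_bound[of \<mu> "\<lambda>x. d1 * (1 + ?N x powr \<delta>)"])
      show "integrable \<mu> (\<lambda>x. d1 * (1 + ?N x powr \<delta>))" using \<mu>(3) by simp
      have "norm (?W x) \<le> norm (d1 * (1 + ?N x powr \<delta>))" for x
      proof -
        have "?W x \<le> d1 * (1 + ?N x powr \<delta>)" using WN[of x] by linarith
        then show ?thesis using d(1) by simp
      qed
      then show "AE x in \<mu>. norm (?W x) \<le> norm (d1 * (1 + ?N x powr \<delta>))" by simp
    qed measurable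
    show ?thesis
    proof (rule exI[of _ \<mu>], rule exI[of _ "E * d2 * d1"], rule exI[of _ g], intro conjI allI impI)
      fix M :: "'a measure" and w0 w1 X t and \<phi> :: "state \<Rightarrow> real"
      assume MX: "brownian2 M w0 w1 \<and> (\<forall>x. sde_solution V1d \<alpha> \<gamma> T Tinf M w0 w1 x (X x))"
        and t: "0 \<le> (t :: real)" and \<phi>: "\<phi> \<in> borel_measurable borel \<and> wnorm ?W \<phi> < \<infinity>"
      interpret G: kinetic_flow ?b L s0 s1 M w0 w1 X by (rule flow) (use MX in auto)
      let ?m = "\<integral>y. \<phi> y \<partial>\<mu>"
      have W0: "?W x \<ge> 0" for x by simp
      from wnorm_finite[OF W0 conjunct2[OF \<phi>]] obtain c0 where
        c0: "c0 \<ge> 0" "\<forall>x. \<bar>\<phi> x\<bar> \<le> c0 * (1 + ?W x)" by (elim exE conjE)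
      \<comment> \<open>Subtracting the mean keeps the weighted norm finite, so that it can be
        written as a real constant c.\<close>
      have "\<bar>\<phi> x - ?m\<bar> \<le> (c0 + \<bar>?m\<bar>) * (1 + ?W x)" for x
      proof -
        have "\<bar>?m\<bar> * 1 \<le> \<bar>?m\<bar> * (1 + ?W x)" by (intro mult_left_mono) auto
        then show ?thesis using c0(2)[rule_format, of x] abs_triangle_ineq4[of "\<phi> x" ?m] by (simp add: distrib_right)
      qed
      then have "wnorm ?W (\<lambda>x. \<phi> x - ?m) \<le> ereal (c0 + \<bar>?m\<bar>)" by (intro wnorm_le W0)
      then have "wnorm ?W (\<lambda>x. \<phi> x - ?m) < \<infinity>" by (rule le_less_trans) simp
      from wnorm_finite[OF W0 this] obtain c where c: "c \<ge> 0" "wnorm ?W (\<lambda>x. \<phi> x - ?m) = ereal c"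
        "\<forall>x. \<bar>\<phi> x - ?m\<bar> \<le> c * (1 + ?W x)" by (elim exE conjE)
      have cN: "\<bar>\<phi> y - ?m\<bar> \<le> (c * d1) * (1 + ?N y powr \<delta>)" for y
      proof -
        have "c * (1 + ?W y) \<le> c * (d1 * (1 + ?N y powr \<delta>))" by (intro mult_left_mono WN c(1))
        then show ?thesis using c(3)[rule_format, of y] by (simp add: mult.assoc)
      qed
      have "\<bar>(\<integral>\<omega>. \<phi> (X x t \<omega>) \<partial>M) - ?m\<bar> \<le> (E * d2 * d1 * exp (- g * t) * c) * (1 + ?W x)" for x
      proof -
        have "(\<integral>\<omega>. \<phi> (X x t \<omega>) \<partial>M) = (\<integral>y. \<phi> y \<partial>F.P t x)"
          using \<phi> t by (simp add: F.P_eq[OF G.kinetic_flow_axioms t] G.integral_P)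
        moreover have "\<bar>(\<integral>y. \<phi> y \<partial>F.P t x) - ?m\<bar> \<le> E * exp (- g * t) * (c * d1) * (1 + ?N x powr \<delta>)"
          using \<phi> t c(1) d(1) cN by (intro gap[rule_format, of t \<phi> "c * d1" ?m x]) auto
        moreover have "E * exp (- g * t) * (c * d1) * (1 + ?N x powr \<delta>) \<le> E * exp (- g * t) * (c * d1) * (d2 * (1 + ?W x))"
          using E c(1) d(1) by (intro mult_left_mono NW) auto
        ultimately show ?thesis by (simp add: mult_ac)
      qed
      then have "wnorm ?W (\<lambda>x. (\<integral>\<omega>. \<phi> (X x t \<omega>) \<partial>M) - ?m) \<le> ereal (E * d2 * d1 * exp (- g * t) * c)"
        by (intro wnorm_le W0)
      also have "\<dots> = ereal (E * d2 * d1 * exp (- g * t)) * wnorm ?W (\<lambda>x. \<phi> x - ?m)"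
        by (simp add: c(2))
      finally show "wnorm ?W (\<lambda>x. (\<integral>\<omega>. \<phi> (X x t \<omega>) \<partial>M) - ?m)
        \<le> ereal (E * d2 * d1 * exp (- g * t)) * wnorm ?W (\<lambda>x. \<phi> x - ?m)" .
    qed (use \<mu> intW E d g in auto)
  qed
qed

end
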